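(* Let $V=\{1,\dots,n\}$, $n\ge 2$, be a set of agents. Suppose that initially either (i) all agents $i\in V$ have a probability measure $\mu_{i,0}\in\mathcal{P}^2(\mathbb{R})$ with continuous distribution (absolutely continuous with respect to the Lebesgue measure); or (ii) one agent has the standard Gaussian distribution on $\mathbb{R}^d$ and any other agent $i\in V$ has a Gaussian distribution $\mu_{i,0}=\mathcal{N}(\mathbf{0}_d,\Sigma_{i,0})$ with $\Sigma_{i,0}\in\mathbb{R}^{d\times d}$ positive definite, and there exists an orthogonal matrix $U$ such that $D_{k,0}=U\Sigma_{k,0}U^\top$ is diagonal for all $k$. Consider the directed PaWBar algorithm with an underlying strongly connected digraph $G$. Then, with probability one, $W_2(\mu_i(t),\mu_\infty)\to 0$ as $t\to\infty$ for any $i\in V$, where $\mu_\infty$ is the Wasserstein barycenter of the initial measures with weights $\lambda_1,\dots,\lambda_n$, i.e. $\mu_\infty=\arg\min_{\nu}\sum_{i=1}^n\lambda_iW_2(\nu,\mu_{i,0})^2$ (over $\nu\in\mathcal{P}^2(\mathbb{R})$ in case (i), $\nu\in\mathcal{P}^2(\mathbb{R}^d)$ in case (ii)). In particular, - for case (i), $\mu_\infty=\big(\sum_{j=1}^n\lambda_jF^{-1}_{\mu_{j,0}}\circ F_{\mu_{i,0}}\big)_\#\mu_{i,0}=\big(\sum_{j=1}^n\lambda_jF^{-1}_{\mu_{j,0}}\big)_\#\mathcal{L}$ (for any $i\in V$), with $\mathcal{L}$ the Lebesgue measure on $[0,1]$; and - for case (ii), $\mu_\infty=\mathcal{N}(\mathbf{0}_d,\Sigma_\infty)$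 with $\Sigma_\infty\in\mathbb{R}^{d\times d}$ a positive definite matrix satisfying $\Sigma_\infty=\sum_{j=1}^n\lambda_j(\Sigma_\infty^{1/2}\Sigma_{j,0}\Sigma_\infty^{1/2})^{1/2}$; with $\lambda=(\lambda_1,\dots,\lambda_n)^\top$ being a random convex vector such that $\prod_{\tau=0}^\infty A(\tau)=\mathbf{1}_n\lambda^\top$ with probability one. Moreover, for the symmetric PaWBar algorithm with $G$ a connected undirected graph, and with initial measures as in case (i) or case (ii), the same conclusions hold with the deterministic weights $\lambda=(\frac1n,\dots,\frac1n)^\top$, so that the barycenter is the standard one: with probability one, $W_2(\mu_i(t),\mu_\infty)\to 0$ as $t\to\infty$ for any $i\in V$, where $\mu_\infty=\arg\min_{\nu}\sum_{i=1}^nW_2(\nu,\mu_{i,0})^2$ (over $\nu\in\mathcal{P}^2(\mathbb{R})$ in case (i), $\nu\in\mathcal{P}^2(\mathbb{R}^d)$ in case (ii)); in case (i), $\mu_\infty=\big(\frac1n\sum_{j=1}^nF^{-1}_{\mu_{j,0}}\circ F_{\mu_{i,0}}\big)_\#\mu_{i,0}=\big(\frac1n\sum_{j=1}^nF^{-1}_{\mu_{j,0}}\big)_\#\mathcal{L}$ (for any $i\in V$); and in case (ii), $\mu_\infty=\mathcal{N}(\mathbf{0}_d,\Sigma_\infty)$ with $\Sigma_\infty\in\mathbb{R}^{d\times d}$ a positive definite matrix satisfying $\Sigma_\infty=\frac1n\sum_{j=1}^n(\Sigma_\infty^{1/2}\Sigma_{j,0}\Sigma_\infty^{1/2})^{1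/2}$.
   Context: Notation. $\mathcal{P}^2(\mathbb{R}^d)$ is the set of Borel probability measures on $\mathbb{R}^d$ with finite second moment, and $W_2$ is the 2-Wasserstein distance for the Euclidean norm. For $\mu\in\mathcal{P}^2(\mathbb{R})$, $F_\mu(x)=\mu((-\infty,x])$ is its cumulative distribution function and $F_\mu^{-1}$ its (generalized) inverse. For $\mu,\nu\in\mathcal{P}^2(\mathbb{R}^d)$, $\gamma^{\mathrm{opt}}(\mu,\nu)$ denotes an optimal transport plan between $\mu$ and $\nu$, i.e. a minimizer of $\int\|x-y\|_2^2\,d\gamma(x,y)$ over couplings of $\mu$ and $\nu$. For $a\in[0,1]$, $\pi_a(x,y)=(1-a)x+ay$, and $\#$ denotes push-forward. $\mathcal{N}(m,\Sigma)$ is the Gaussian distribution with mean $m$ and covariance $\Sigma$; for the agent with the standard Gaussian distribution the covariance is $I_d$. A convex vector is a vector in $\mathbb{R}^n$ with nonnegative entries summing to one. $\mathbf{1}_n$ is the all-ones vector, $\mathbf{0}_d$ the zero vector, $e_i$ the $i$th standard basis vector of $\mathbb{R}^n$, $I_n$ the identity matrix. Directed PaWBar algorithm. $G=(V,E)$ is a weighted directed graph with weight $a_{ij}\in(0,1)$ for each $(i,j)\in E$. Set $\mu_i(0)=\mu_{i,0}$ for $i\in V$. At each time $t=0,1,2,\dots$: select a random edge $(i,j)\in E$, independently over time, according to a time-invariant probability distribution giving every edge positive probability; then set $\mu_i(t+1)=(\pi_{a_{ij}})_\#\gamma^{\mathrm{opt}}(\mu_i(t),\mu_j(t))$, the measures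 of all other agents being unchanged. Symmetric PaWBar algorithm. $G=(V,E)$ is an undirected graph. Set $\mu_i(0)=\mu_{i,0}$ for $i\in V$. At each time $t$: select a random edge $\{i,j\}\in E$, independently over time, according to a time-invariant probability distribution giving every edge positive probability; then set $\mu_i(t+1)=\mu_j(t+1)=(\pi_{1/2})_\#\gamma^{\mathrm{opt}}(\mu_i(t),\mu_j(t))$, the measures of all other agents being unchanged. "With probability one" is with respect to the law of the random sequence of selected edges. Evolution random matrix (directed case): if $(i,j)\in E$ is the edge selected at time $t$, then $A(t)=I_n-a_{ij}e_ie_i^\top+a_{ij}e_ie_j^\top$. Products are ordered with later matrices on the left: $\prod_{\tau=s}^{t}A(\tau)=A(t)A(t-1)\cdots A(s)$, and $\prod_{\tau=s}^{\infty}A(\tau)$ is the limit as $t\to\infty$. *)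

theory Defs
  imports "HOL-Probability.Probability"
begin

section \<open>Wasserstein space\<close>

definition P2 :: "'a::euclidean_space measure set" where
  "P2 = {\<mu>. prob_space \<mu> \<and> sets \<mu> = sets borel \<and> integrable \<mu> (\<lambda>x. (norm x)\<^sup>2)}"

definition couplings :: "'a::euclidean_space measure \<Rightarrow> 'a measure \<Rightarrow> ('a \<times> 'a) measure set" where
  "couplings \<mu> \<nu> =
     {\<gamma>. sets \<gamma> = sets borel \<and> distr \<gamma> borel fst = \<mu> \<and> distr \<gamma> borel snd = \<nu>}"

(* Used only for couplings of measures in P2, where the integrand is always integrable. *)
definition transport_cost :: "('a::euclidean_space \<times> 'a) measure \<Rightarrow> real" where
  "transport_cost \<gamma> = (\<integral>z. (norm (fst z - snd z))\<^sup>2 \<partial>\<gamma>)"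

definition W2 :: "'a::euclidean_space measure \<Rightarrow> 'a measure \<Rightarrow> real" where
  "W2 \<mu> \<nu> = sqrt (INF \<gamma>\<in>couplings \<mu> \<nu>. transport_cost \<gamma>)"

definition optimal_plan ::
  "'a::euclidean_space measure \<Rightarrow> 'a measure \<Rightarrow> ('a \<times> 'a) measure \<Rightarrow> bool" where
  "optimal_plan \<mu> \<nu> \<gamma> \<longleftrightarrow> is_arg_min transport_cost (\<lambda>\<gamma>'. \<gamma>' \<in> couplings \<mu> \<nu>) \<gamma>"

(* An arbitrary choice of optimal plans.  The existence premise is always met on P2; it is
   stated so that such a choice trivially exists and assuming one costs nothing. *)
definition optimal_plan_choice ::
  "('a::euclidean_space measure \<Rightarrow> 'a measure \<Rightarrow> ('a \<times> 'a) measure) \<Rightarrow> bool" where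
  "optimal_plan_choice \<gamma>opt \<longleftrightarrow>
     (\<forall>\<mu>\<in>P2. \<forall>\<nu>\<in>P2. (\<exists>\<gamma>. optimal_plan \<mu> \<nu> \<gamma>) \<longrightarrow> optimal_plan \<mu> \<nu> (\<gamma>opt \<mu> \<nu>))"

(* The last argument is the only minimizer over P2. *)
definition wasserstein_barycenter ::
  "real ^ 'n \<Rightarrow> ('n::finite \<Rightarrow> 'a::euclidean_space measure) \<Rightarrow> 'a measure \<Rightarrow> bool" where
  "wasserstein_barycenter lam \<mu> m \<longleftrightarrow>
     {\<nu>. is_arg_min (\<lambda>\<nu>. \<Sum>i\<in>UNIV. lam $ i * (W2 \<nu> (\<mu> i))\<^sup>2) (\<lambda>\<nu>. \<nu> \<in> P2) \<nu>} = {m}"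


section \<open>The two classes of initial measures\<close>

(* On the line.  The values at u = 0 and u = 1 are not meaningful, but they only matter on
   null sets. *)
definition quantile :: "real measure \<Rightarrow> real \<Rightarrow> real" where
  "quantile \<mu> u = Inf {x. u \<le> cdf \<mu> x}"

definition continuous_initial :: "('n::finite \<Rightarrow> real measure) \<Rightarrow> bool" where
  "continuous_initial \<mu> \<longleftrightarrow> (\<forall>i. \<mu> i \<in> P2 \<and> absolutely_continuous lborel (\<mu> i))"

definition quantile_average ::
  "real ^ 'n \<Rightarrow> ('n::finite \<Rightarrow> real measure) \<Rightarrow> real measure \<Rightarrow> bool" where
  "quantile_average lam \<mu> m \<longleftrightarrow>
     (\<forall>i. m = distr (\<mu> i) borel
                (\<lambda>x. \<Sum>j\<in>UNIV. lam $ j * (quantile (\<mu> j) \<circ> cdf (\<mu> i)) x)) \<and>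
     m = distr (restrict_space lborel {0..1}) borel
           (\<lambda>u. \<Sum>j\<in>UNIV. lam $ j * quantile (\<mu> j) u)"

definition pos_semidef :: "real ^ 'd ^ 'd \<Rightarrow> bool" where
  "pos_semidef S \<longleftrightarrow> transpose S = S \<and> (\<forall>x. 0 \<le> x \<bullet> (S *v x))"

definition pos_def :: "real ^ 'd ^ 'd \<Rightarrow> bool" where
  "pos_def S \<longleftrightarrow> transpose S = S \<and> (\<forall>x. x \<noteq> 0 \<longrightarrow> 0 < x \<bullet> (S *v x))"

definition matrix_sqrt :: "real ^ 'd ^ 'd \<Rightarrow> real ^ 'd ^ 'd" where
  "matrix_sqrt S = (THE R. pos_semidef R \<and> R ** R = S)"

definition diagonal_matrix :: "real ^ 'd ^ 'd \<Rightarrow> bool" where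
  "diagonal_matrix S \<longleftrightarrow> (\<forall>i j. i \<noteq> j \<longrightarrow> S $ i $ j = 0)"

(* The Gaussian distribution by its density; for positive definite S. *)
definition gaussian :: "real ^ 'd \<Rightarrow> real ^ 'd ^ 'd \<Rightarrow> (real ^ 'd) measure" where
  "gaussian m S = density lborel (\<lambda>x. ennreal
     (exp (- ((x - m) \<bullet> (matrix_inv S *v (x - m))) / 2) /
      sqrt ((2 * pi) ^ CARD('d) * det S)))"

definition gaussian_initial ::
  "('n::finite \<Rightarrow> (real ^ 'd) measure) \<Rightarrow> ('n \<Rightarrow> real ^ 'd ^ 'd) \<Rightarrow> bool" where
  "gaussian_initial \<mu> S \<longleftrightarrow>
     (\<forall>i. pos_def (S i) \<and> \<mu> i = gaussian 0 (S i)) \<and>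
     (\<exists>k. S k = mat 1) \<and>
     (\<exists>U. orthogonal_matrix U \<and> (\<forall>k. diagonal_matrix (U ** S k ** transpose U)))"

definition gaussian_average ::
  "real ^ 'n \<Rightarrow> ('n::finite \<Rightarrow> real ^ 'd ^ 'd) \<Rightarrow> (real ^ 'd) measure \<Rightarrow> bool" where
  "gaussian_average lam S m \<longleftrightarrow>
     (\<exists>T. pos_def T \<and> m = gaussian 0 T \<and>
        T = (\<Sum>j\<in>UNIV. lam $ j *\<^sub>R matrix_sqrt (matrix_sqrt T ** S j ** matrix_sqrt T)))"


section \<open>The PaWBar algorithms\<close>

(* Push-forward of an optimal plan under (x, y) \<mapsto> (1 - a) x + a y. *)
definition displacement ::
  "('a::euclidean_space measure \<Rightarrow> 'a measure \<Rightarrow> ('a \<times> 'a) measure) \<Rightarrow> real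
   \<Rightarrow> 'a measure \<Rightarrow> 'a measure \<Rightarrow> 'a measure" where
  "displacement \<gamma>opt a \<mu> \<nu> = distr (\<gamma>opt \<mu> \<nu>) borel (\<lambda>(x, y). (1 - a) *\<^sub>R x + a *\<^sub>R y)"

primrec directed_pawbar ::
  "('a::euclidean_space measure \<Rightarrow> 'a measure \<Rightarrow> ('a \<times> 'a) measure)
   \<Rightarrow> ('n \<Rightarrow> 'n \<Rightarrow> real) \<Rightarrow> ('n \<Rightarrow> 'a measure) \<Rightarrow> (nat \<Rightarrow> 'n \<times> 'n)
   \<Rightarrow> nat \<Rightarrow> 'n \<Rightarrow> 'a measure" where
  "directed_pawbar \<gamma>opt a \<mu>0 e 0 = \<mu>0"
| "directed_pawbar \<gamma>opt a \<mu>0 e (Suc t) =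
     (let \<mu> = directed_pawbar \<gamma>opt a \<mu>0 e t; (i, j) = e t
      in \<mu>(i := displacement \<gamma>opt (a i j) (\<mu> i) (\<mu> j)))"

(* Some enumeration of the two end points; their order is immaterial, since (x + y) / 2 is
   symmetric. *)
definition end_points :: "'n set \<Rightarrow> 'n \<times> 'n" where
  "end_points e = (SOME (i, j). e = {i, j})"

primrec symmetric_pawbar ::
  "('a::euclidean_space measure \<Rightarrow> 'a measure \<Rightarrow> ('a \<times> 'a) measure)
   \<Rightarrow> ('n \<Rightarrow> 'a measure) \<Rightarrow> (nat \<Rightarrow> 'n set) \<Rightarrow> nat \<Rightarrow> 'n \<Rightarrow> 'a measure" where
  "symmetric_pawbar \<gamma>opt \<mu>0 e 0 = \<mu>0"
| "symmetric_pawbar \<gamma>opt \<mu>0 e (Suc t) =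
     (let \<mu> = symmetric_pawbar \<gamma>opt \<mu>0 e t; (i, j) = end_points (e t);
          \<nu> = displacement \<gamma>opt (1 / 2) (\<mu> i) (\<mu> j)
      in \<mu>(i := \<nu>, j := \<nu>))"

definition strongly_connected :: "('n \<times> 'n) set \<Rightarrow> bool" where
  "strongly_connected E \<longleftrightarrow> (\<forall>i j. (i, j) \<in> E\<^sup>*)"

definition connected_undirected :: "'n set set \<Rightarrow> bool" where
  "connected_undirected E \<longleftrightarrow>
     (\<forall>e\<in>E. card e = 2) \<and> (\<forall>i j. (i, j) \<in> {(u, v). {u, v} \<in> E}\<^sup>*)"

definition iid_edges :: "'w measure \<Rightarrow> 'e pmf \<Rightarrow> (nat \<Rightarrow> 'w \<Rightarrow> 'e) \<Rightarrow> bool" where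
  "iid_edges M p e \<longleftrightarrow>
     prob_space M \<and>
     prob_space.indep_vars M (\<lambda>_. count_space UNIV) e UNIV \<and>
     (\<forall>t. distr M (count_space UNIV) (e t) = measure_pmf p)"


section \<open>Evolution matrices\<close>

definition outer :: "real ^ 'n \<Rightarrow> real ^ 'n \<Rightarrow> real ^ 'n ^ 'n" where
  "outer u v = (\<chi> i j. u $ i * v $ j)"

definition evolution_matrix :: "('n::finite \<Rightarrow> 'n \<Rightarrow> real) \<Rightarrow> 'n \<times> 'n \<Rightarrow> real ^ 'n ^ 'n" where
  "evolution_matrix a = (\<lambda>(i, j).
     mat 1 - a i j *\<^sub>R outer (axis i 1) (axis i 1) + a i j *\<^sub>R outer (axis i 1) (axis j 1))"

(* A t ** ... ** A 1 ** A 0 *)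
primrec backward_product :: "(nat \<Rightarrow> real ^ 'n ^ 'n) \<Rightarrow> nat \<Rightarrow> real ^ 'n ^ 'n" where
  "backward_product A 0 = A 0"
| "backward_product A (Suc t) = A (Suc t) ** backward_product A t"

definition convex_vector :: "real ^ 'n \<Rightarrow> bool" where
  "convex_vector v \<longleftrightarrow> (\<forall>i. 0 \<le> v $ i) \<and> (\<Sum>i\<in>UNIV. v $ i) = 1"

definition random_convex_vector :: "'w measure \<Rightarrow> ('w \<Rightarrow> real ^ 'n) \<Rightarrow> bool" where
  "random_convex_vector M lam \<longleftrightarrow>
     lam \<in> borel_measurable M \<and> (\<forall>\<omega>\<in>space M. convex_vector (lam \<omega>))"

end

(* A barycentric step acts linearly on random vectors whenever the initial measures are laws of
   random vectors q j on one probability space such that the joint law of any two convex mixtures of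
   the q j is the unique optimal plan between their laws.  The measures at time t are then the laws
   of the mixtures whose weights are the rows of the backward product of the stochastic evolution
   matrices.  Strong connectivity yields a finite word of edges whose matrix product has a positive
   column; almost surely the word occurs infinitely often, each occurrence contracts the oscillation
   of every column by a fixed factor, and so the rows converge to a common convex vector.  In the
   symmetric case the column sums are preserved, which makes the limit uniform.

   On the line the q j are the quantile functions on (0, 1), and comonotone couplings are uniquely
   optimal because the cost is an integral of an expression decreasing in the joint distribution
   function.  For Gaussians with simultaneously diagonalisable covariances the q j are the square
   roots of the covariances acting on a standard Gaussian vector, and optimality follows from Young's
   inequality for the quadratic form of the linear transport map. *)

theory Submission
  imports Defs
begin

section \<open>Consensus of products of stochastic matrices\<close>

text \<open>The algorithm may use any optimal plan, so optimality of a joint law alone would not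
  determine the next measure; uniqueness is demanded in \<open>optimally_coupled\<close> because it
  forces the plan chosen at every step. It must hold for all pairs of mixtures, since the iterates
  leave the initial measures at once. Monotone functions are closed under convex mixtures, and so
  are positive definite matrices that are diagonal in one common frame: this is what the two classes
  share. The evolution matrices depend on the edges only, so a single random vector of weights
  serves both classes. The barycenter has to beat arbitrary measures outside the family. On the line
  \<open>W2\<close> is the L2 distance of quantile functions and the minimization is pointwise. For
  Gaussians the weighted sum of dual lower bounds is the same for every competitor, because the
  weighted mean of the transport maps is the identity. Equality is then exploited through couplings
  that merely approach the infimum defining \<open>W2\<close>; they already determine the
  competitor.\<close>

lemma convex_vector_axis: "convex_vector (axis i 1)"
  by (simp add: convex_vector_def axis_def)

lemma convex_vector_sum:
  assumes "convex_vector u" and "\<And>j. convex_vector (X j)"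
  shows "convex_vector (\<Sum>j\<in>UNIV. u $ j *\<^sub>R X j)"
proof -
  have "(\<Sum>i\<in>UNIV. \<Sum>j\<in>UNIV. u $ j * X j $ i) = (\<Sum>j\<in>UNIV. u $ j * (\<Sum>i\<in>UNIV. X j $ i))"
    by (subst sum.swap) (simp add: sum_distrib_left)
  with assms show ?thesis
    by (auto simp: convex_vector_def sum_nonneg)
qed

lemma convex_vector_pos: "convex_vector v \<Longrightarrow> \<exists>i. 0 < v $ i"
  unfolding convex_vector_def
  by (metis less_eq_real_def sum.neutral zero_neq_one)

text \<open>Agents correspond to rows: the left factor mixes the rows of the right one, which is how
  a step of the algorithm acts on the weights.\<close>

lemma matrix_mult_row: "(A ** X) $ i = (\<Sum>j\<in>UNIV. A $ i $ j *\<^sub>R X $ j)"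
  for A :: "real ^ 'n ^ 'k" and X :: "real ^ 'm ^ 'n"
  by (simp add: matrix_matrix_mult_def vec_eq_iff)

definition stochastic :: "real ^ 'n ^ 'n \<Rightarrow> bool" where
  "stochastic A \<longleftrightarrow> (\<forall>i. convex_vector (A $ i))"

lemma stochastic_mult: "stochastic A \<Longrightarrow> stochastic X \<Longrightarrow> stochastic (A ** X)"
  by (simp add: stochastic_def matrix_mult_row convex_vector_sum)

lemma mat_1_row: "(mat 1 :: real ^ 'n ^ 'n) $ i = axis i 1"
  by (auto simp: mat_def axis_def vec_eq_iff)

lemma stochastic_mat_1: "stochastic (mat 1)"
  by (simp add: stochastic_def mat_1_row convex_vector_axis)

text \<open>Row i at time t is meant to hold the weights with which the initial measures enter the
  measure of agent i. Starting from \<open>mat 1\<close> puts it one factor behind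
  \<open>backward_product\<close>, which contains \<open>A 0\<close> already at index 0.\<close>

primrec evolution :: "('e \<Rightarrow> real ^ 'n ^ 'n) \<Rightarrow> (nat \<Rightarrow> 'e) \<Rightarrow> nat \<Rightarrow> real ^ 'n ^ 'n" where
  "evolution B e 0 = mat 1"
| "evolution B e (Suc t) = B (e t) ** evolution B e t"

lemma stochastic_evolution: "(\<And>t. stochastic (B (e t))) \<Longrightarrow> stochastic (evolution B e t)"
  by (induction t) (auto simp: stochastic_mat_1 stochastic_mult)

lemma backward_product_evolution:
  "backward_product (\<lambda>t. B (e t)) t = evolution B e (Suc t)"
  by (induction t) simp_all

text \<open>The first letter acts first and therefore stands rightmost, as in
  \<open>evolution\<close>.\<close>

primrec word_product :: "('e \<Rightarrow> real ^ 'n ^ 'n) \<Rightarrow> 'e list \<Rightarrow> real ^ 'n ^ 'n" where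
  "word_product B [] = mat 1"
| "word_product B (x # w) = word_product B w ** B x"

lemma word_product_snoc: "word_product B (w @ [x]) = B x ** word_product B w"
  by (induction w) (simp_all add: matrix_mul_assoc)

lemma stochastic_word_product:
  "(\<And>x. x \<in> set w \<Longrightarrow> stochastic (B x)) \<Longrightarrow> stochastic (word_product B w)"
  by (induction w) (auto simp: stochastic_mat_1 stochastic_mult)

lemma evolution_word:
  assumes "\<And>k. k < length w \<Longrightarrow> e (t + k) = w ! k"
  shows "evolution B e (t + length w) = word_product B w ** evolution B e t"
  using assms
proof (induction w arbitrary: t)
  case (Cons x w)
  have "e (Suc t + k) = w ! k" if "k < length w" for k
    using Cons.prems[of "Suc k"] that by simp
  from Cons.IH[OF this] Cons.prems[of 0] show ?case
    by (simp add: matrix_mul_assoc)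
qed simp

text \<open>A word whose product has as many positive entries as possible in column r must have all of
  them positive: otherwise some edge enters the set of positive rows, and appending it enlarges
  the set, because the diagonals are positive.\<close>

lemma positive_column_word:
  fixes B :: "'e \<Rightarrow> real ^ 'n ^ 'n"
  assumes st: "\<And>x. x \<in> E \<Longrightarrow> stochastic (B x)"
    and dg: "\<And>x i. x \<in> E \<Longrightarrow> 0 < B x $ i $ i"
    and conn: "\<And>i j. (i, j) \<in> {(i, j). \<exists>x\<in>E. 0 < B x $ i $ j}\<^sup>*"
  shows "\<exists>w. set w \<subseteq> E \<and> (\<forall>i. 0 < word_product B w $ i $ r)"
proof -
  define S where "S w = {i. 0 < word_product B w $ i $ r}" for w
  have "\<exists>w. set w \<subseteq> E \<and> (\<forall>v. set v \<subseteq> E \<longrightarrow> card (S v) \<le> card (S w))"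
    by (rule ex_has_greatest_nat[of _ "[]" _ "Suc CARD('n)"])
      (auto simp: card_mono less_Suc_eq_le)
  then obtain w where w: "set w \<subseteq> E" "\<And>v. set v \<subseteq> E \<Longrightarrow> card (S v) \<le> card (S w)" by blast
  have nn: "stochastic (word_product B v)" if "set v \<subseteq> E" for v
    using that st by (intro stochastic_word_product) auto
  have step: "0 < word_product B (w @ [x]) $ i $ r"
    if "x \<in> E" "0 < B x $ i $ j" "j \<in> S w" for x i j
  proof -
    have "0 < B x $ i $ j * word_product B w $ j $ r" using that by (simp add: S_def)
    also have "\<dots> \<le> (\<Sum>j\<in>UNIV. B x $ i $ j * word_product B w $ j $ r)"
      using nn[OF w(1)] st[OF that(1)]
      by (intro member_le_sum) (auto simp: stochastic_def convex_vector_def)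
    finally show ?thesis by (simp add: word_product_snoc matrix_mult_row)
  qed
  have closed: "i \<in> S w" if x: "x \<in> E" "0 < B x $ i $ j" "j \<in> S w" for x i j
  proof (rule ccontr)
    assume "i \<notin> S w"
    moreover have "insert i (S w) \<subseteq> S (w @ [x])"
      using step[OF x] step[OF x(1) dg[OF x(1)]] by (auto simp: S_def)
    ultimately have "card (S w) < card (S (w @ [x]))"
      by (metis card_mono card_insert_disjoint finite less_eq_Suc_le)
    with w(2)[of "w @ [x]"] w(1) x(1) show False by simp
  qed
  \<comment> \<open>Entry (r, r) is 1 for the empty word and stays positive because every letter has
    a positive diagonal.\<close>
  have rS: "r \<in> S v" if "set v \<subseteq> E" for v
    using that
  proof (induction v rule: rev_induct)
    case Nil
    then show ?case by (simp add: S_def mat_def)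
  next
    case (snoc x v)
    then have "0 < B x $ r $ r * word_product B v $ r $ r" using dg by (simp add: S_def)
    also have "\<dots> \<le> (\<Sum>j\<in>UNIV. B x $ r $ j * word_product B v $ j $ r)"
      using nn[of v] st[of x] snoc.prems
      by (intro member_le_sum) (auto simp: stochastic_def convex_vector_def)
    finally show ?case by (simp add: S_def word_product_snoc matrix_mult_row)
  qed
  \<comment> \<open>A positive entry (i, j) lets row i draw on row j, so positivity spreads from j
    to i; starting at r it is carried backwards along a path from i to r.\<close>
  have "i \<in> S w" for i
    using conn[of i r]
  proof (induction rule: converse_rtrancl_induct)
    case base
    show ?case using rS[OF w(1)] .
  next
    case (step y z)
    then show ?case using closed by blast
  qed
  then show ?thesis using w(1) by (auto simp: S_def)
qed

text \<open>All terms of the average of \<open>x k - lo\<close> are nonnegative, so the single term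
  r bounds it from below. With \<delta> = 0 this is the bound by the minimum; with \<delta> > 0 it
  is the contraction.\<close>

lemma stochastic_lower:
  assumes "stochastic W" and "\<And>k. lo \<le> x k" and "\<delta> \<le> W $ i $ r"
  shows "lo + \<delta> * (x r - lo) \<le> (\<Sum>k\<in>UNIV. W $ i $ k * x k)"
proof -
  have "\<delta> * (x r - lo) \<le> W $ i $ r * (x r - lo)"
    using assms by (intro mult_right_mono) auto
  also have "\<dots> \<le> (\<Sum>k\<in>UNIV. W $ i $ k * (x k - lo))"
    using assms by (intro member_le_sum) (auto simp: stochastic_def convex_vector_def)
  also have "\<dots> = (\<Sum>k\<in>UNIV. W $ i $ k * x k) - (\<Sum>k\<in>UNIV. W $ i $ k) * lo"
    by (simp add: right_diff_distrib sum_subtractf sum_distrib_right)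
  also have "(\<Sum>k\<in>UNIV. W $ i $ k) = 1" using assms by (auto simp: stochastic_def convex_vector_def)
  finally show ?thesis by simp
qed

lemma stochastic_upper:
  assumes "stochastic W" and "\<And>k. x k \<le> hi" and "\<delta> \<le> W $ i $ r"
  shows "(\<Sum>k\<in>UNIV. W $ i $ k * x k) \<le> hi - \<delta> * (hi - x r)"
  using stochastic_lower[of W "- hi" "\<lambda>k. - x k", OF assms(1) _ assms(3)] assms(2)
  by (simp add: sum_negf algebra_simps)

text \<open>The maximum of column k decreases and the minimum increases along the evolution.
  Contraction factors are not multiplied up: the limits h and l of the two extremes are compared
  directly, with one occurrence of the word at arbitrarily late times.\<close>

lemma column_consensus:
  fixes B :: "'e \<Rightarrow> real ^ 'n ^ 'n"
  assumes st: "\<And>t. stochastic (B (e t))"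
    and W: "stochastic (word_product B w)" "\<And>i. \<delta> \<le> word_product B w $ i $ r" "0 < \<delta>"
    and io: "\<And>N. \<exists>t\<ge>N. \<forall>k<length w. e (t + k) = w ! k"
  shows "\<exists>l. \<forall>i. (\<lambda>t. evolution B e t $ i $ k) \<longlonglongrightarrow> l"
proof -
  define x where "x t i = evolution B e t $ i $ k" for t i
  define hi where "hi t = Max (range (x t))" for t
  define lo where "lo t = Min (range (x t))" for t
  have xh: "x t i \<le> hi t" and xl: "lo t \<le> x t i" for t i
    by (auto simp: hi_def lo_def)
  have hi_le: "hi t \<le> c" if "\<And>i. x t i \<le> c" for t c
    using that by (auto simp: hi_def)
  have lo_ge: "c \<le> lo t" if "\<And>i. c \<le> x t i" for t c
    using that by (auto simp: lo_def)
  have xSuc: "x (Suc t) i = (\<Sum>j\<in>UNIV. B (e t) $ i $ j * x t j)" for t i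
    by (simp add: x_def matrix_mult_row)
  have dec: "decseq hi"
  proof (rule decseq_SucI, rule hi_le)
    fix t i
    show "x (Suc t) i \<le> hi t"
      using stochastic_upper[OF st, of "x t" "hi t" 0 t i i] st[of t] xh
      by (auto simp: xSuc stochastic_def convex_vector_def)
  qed
  have inc: "incseq lo"
  proof (rule incseq_SucI, rule lo_ge)
    fix t i
    show "lo t \<le> x (Suc t) i"
      using stochastic_lower[OF st, of "lo t" "x t" 0 t i i] st[of t] xl
      by (auto simp: xSuc stochastic_def convex_vector_def)
  qed
  have lohi: "lo t \<le> hi t" for t using xh[of t undefined] xl[of t undefined] by linarith
  have "lo t \<le> hi 0" for t
    using lohi[of t] decseqD[OF dec, of 0 t] by simp
  then obtain l where l: "lo \<longlonglongrightarrow> l" using incseq_convergent[OF inc] by blast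
  have "lo 0 \<le> hi t" for t
    using lohi[of t] incseqD[OF inc, of 0 t] by simp
  then obtain h where h: "hi \<longlonglongrightarrow> h" using decseq_convergent[OF dec] by blast
  have hh: "h \<le> hi t" and ll: "lo t \<le> l" for t
    using decseq_ge[OF dec h] incseq_le[OF inc l] by auto
  have lh: "l \<le> h" using LIMSEQ_le[OF l h] lohi by blast
  have \<delta>1: "\<delta> \<le> 1"
  proof -
    have "word_product B w $ r $ r \<le> (\<Sum>j\<in>UNIV. word_product B w $ r $ j)"
      using W(1) by (intro member_le_sum) (auto simp: stochastic_def convex_vector_def)
    also have "\<dots> = 1" using W(1) by (auto simp: stochastic_def convex_vector_def)
    finally show ?thesis using W(2)[of r] by simp
  qed
  \<comment> \<open>Both extremes are pulled by the fraction \<delta> towards the same value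
    \<open>x t r\<close>, which cancels in their difference.\<close>
  have contract: "h - l \<le> (1 - \<delta>) * (hi t - lo t)"
    if occ: "\<forall>k<length w. e (t + k) = w ! k" for t
  proof -
    have xw: "x (t + length w) i = (\<Sum>j\<in>UNIV. word_product B w $ i $ j * x t j)" for i
      using evolution_word[of w e t B] occ by (simp add: x_def matrix_mult_row)
    have "hi (t + length w) \<le> hi t - \<delta> * (hi t - x t r)"
      using stochastic_upper[OF W(1) xh W(2)] by (intro hi_le) (simp add: xw)
    moreover have "lo t + \<delta> * (x t r - lo t) \<le> lo (t + length w)"
      using stochastic_lower[OF W(1) xl W(2)] by (intro lo_ge) (simp add: xw)
    ultimately show ?thesis
      using hh[of "t + length w"] ll[of "t + length w"] by (simp add: algebra_simps)
  qed
  \<comment> \<open>If this failed, \<open>contract\<close> would be violated at every late time,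
    whereas the word occurs at arbitrarily late times.\<close>
  have "h - l \<le> (1 - \<delta>) * (h - l)"
  proof (rule ccontr)
    assume "\<not> ?thesis"
    moreover have "(\<lambda>t. (1 - \<delta>) * (hi t - lo t)) \<longlonglongrightarrow> (1 - \<delta>) * (h - l)"
      by (intro tendsto_intros h l)
    ultimately have "\<forall>\<^sub>F t in sequentially. (1 - \<delta>) * (hi t - lo t) < h - l"
      by (intro order_tendstoD) auto
    then obtain N where "\<And>t. t \<ge> N \<Longrightarrow> (1 - \<delta>) * (hi t - lo t) < h - l"
      by (auto simp: eventually_sequentially)
    moreover obtain t where "t \<ge> N" "\<forall>k<length w. e (t + k) = w ! k" using io by blast
    ultimately show False using contract by fastforce
  qed
  then have "\<delta> * (h - l) \<le> 0" by (simp add: algebra_simps)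
  then have "h = l" using W(3) lh by (simp add: mult_le_0_iff)
  have "(\<lambda>t. x t i) \<longlonglongrightarrow> l" for i
    by (rule tendsto_sandwich[OF _ _ l h[unfolded \<open>h = l\<close>]]) (auto simp: xl xh)
  then show ?thesis by (auto simp: x_def)
qed

lemma convex_vector_limit:
  assumes "\<And>t. convex_vector (X t)" and "X \<longlonglongrightarrow> v"
  shows "convex_vector v"
proof -
  have comp: "(\<lambda>t. X t $ i) \<longlonglongrightarrow> v $ i" for i using assms(2) by (intro tendsto_intros)
  have "(\<lambda>t. \<Sum>i\<in>UNIV. X t $ i) \<longlonglongrightarrow> (\<Sum>i\<in>UNIV. v $ i)"
    by (intro tendsto_intros assms)
  moreover have "(\<lambda>t. \<Sum>i\<in>UNIV. X t $ i) = (\<lambda>t. 1)"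
    using assms(1) by (auto simp: convex_vector_def)
  ultimately have "(\<Sum>i\<in>UNIV. v $ i) = 1"
    using LIMSEQ_unique by (metis tendsto_const)
  moreover have "0 \<le> v $ i" for i
    using comp[of i] assms(1) by (intro LIMSEQ_le_const) (auto simp: convex_vector_def)
  ultimately show ?thesis by (simp add: convex_vector_def)
qed

text \<open>Column r of the word product contracts every column k of the evolution, with one
  constant \<delta>, the least of its finitely many positive entries. All rows then share a limit,
  which is convex as a limit of convex rows.\<close>

lemma consensus:
  fixes B :: "'e \<Rightarrow> real ^ 'n ^ 'n"
  assumes st: "\<And>t. stochastic (B (e t))"
    and W: "stochastic (word_product B w)" "\<And>i. 0 < word_product B w $ i $ r"
    and io: "\<And>N. \<exists>t\<ge>N. \<forall>k<length w. e (t + k) = w ! k"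
  obtains lam where "convex_vector lam" "evolution B e \<longlonglongrightarrow> outer 1 lam"
proof -
  define \<delta> where "\<delta> = Min (range (\<lambda>i. word_product B w $ i $ r))"
  have "0 < \<delta>" "\<And>i. \<delta> \<le> word_product B w $ i $ r" using W(2) by (auto simp: \<delta>_def)
  then have "\<exists>l. \<forall>i. (\<lambda>t. evolution B e t $ i $ k) \<longlonglongrightarrow> l" for k
    using column_consensus[OF st W(1) _ _ io] by blast
  then obtain l where l: "\<And>i k. (\<lambda>t. evolution B e t $ i $ k) \<longlonglongrightarrow> l k" by metis
  have lim: "(\<lambda>t. evolution B e t) \<longlonglongrightarrow> outer 1 (\<chi> k. l k)"
    by (intro vec_tendstoI) (simp add: outer_def l)
  have "(\<lambda>t. evolution B e t $ r) \<longlonglongrightarrow> outer 1 (\<chi> k. l k) $ r"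
    by (intro tendsto_intros lim)
  then have "convex_vector (outer 1 (\<chi> k. l k) $ r)"
    by (rule convex_vector_limit[rotated])
      (use stochastic_evolution[of B e, OF st] in \<open>simp add: stochastic_def\<close>)
  then have "convex_vector (\<chi> k. l k)" by (simp add: outer_def convex_vector_def)
  then show ?thesis using that lim by blast
qed

section \<open>Recurrence of words in an independent sequence of edges\<close>

lemma iid_edges_measurable:
  assumes "iid_edges M p e"
  shows "e t \<in> measurable M (count_space UNIV)"
proof -
  interpret prob_space M using assms by (simp add: iid_edges_def)
  show ?thesis using assms unfolding iid_edges_def indep_vars_def by blast
qed

lemma iid_edges_prob:
  assumes "iid_edges M p e"
  shows "measure M {\<omega> \<in> space M. e t \<omega> = x} = pmf p x"
proof -
  have "pmf p x = measure (distr M (count_space UNIV) (e t)) {x}"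
    using assms by (simp add: iid_edges_def measure_pmf_single)
  also have "\<dots> = measure M (e t -` {x} \<inter> space M)"
    using iid_edges_measurable[OF assms] by (subst measure_distr) auto
  also have "e t -` {x} \<inter> space M = {\<omega> \<in> space M. e t \<omega> = x}" by auto
  finally show ?thesis by simp
qed

lemma iid_edges_support:
  assumes "iid_edges M p e"
  shows "AE \<omega> in M. \<forall>t. e t \<omega> \<in> set_pmf p"
  unfolding AE_all_countable
proof
  fix t
  have "AE x in distr M (count_space UNIV) (e t). x \<in> set_pmf p"
    using assms AE_measure_pmf[of p] unfolding iid_edges_def by metis
  then show "AE \<omega> in M. e t \<omega> \<in> set_pmf p"
    using AE_distrD[OF iid_edges_measurable[OF assms]] by blast
qed

text \<open>Disjoint blocks of the sequence spell out a given word independently of each other, all with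
  the same positive probability.\<close>

lemma iid_edges_word:
  assumes iid: "iid_edges M p e" and w: "set w \<subseteq> set_pmf p"
  shows "AE \<omega> in M. \<forall>N. \<exists>t\<ge>N. \<forall>k<length w. e (t + k) \<omega> = w ! k"
proof (cases "w = []")
  case False
  interpret prob_space M using iid by (simp add: iid_edges_def)
  let ?L = "length w"
  have L: "0 < ?L" using False by simp
  have e[measurable]: "e t \<in> measurable M (count_space UNIV)" for t
    using iid_edges_measurable[OF iid] .
  have ind: "indep_vars (\<lambda>_. count_space UNIV) e UNIV" using iid by (simp add: iid_edges_def)
  define K where "K m = {m * ?L..<m * ?L + ?L}" for m
  have K: "disjoint_family K"
    unfolding disjoint_family_on_def
  proof (intro ballI impI)
    fix m n :: nat assume "m \<noteq> n"
    then show "K m \<inter> K n = {}"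
    proof (induction m n rule: linorder_wlog)
      case (le m n)
      then have "m * ?L + ?L \<le> n * ?L"
        by (metis Suc_leI add.commute le_neq_implies_less mult_Suc mult_le_mono1)
      then show ?case by (auto simp: K_def)
    qed auto
  qed
  have blocks: "indep_vars (\<lambda>m. PiM (K m) (\<lambda>_. count_space UNIV))
      (\<lambda>m \<omega>. restrict (\<lambda>i. e i \<omega>) (K m)) UNIV"
    by (rule indep_vars_restrict[OF ind _ K]) auto
  \<comment> \<open>Failure to spell w, as a set of functions on the indices of block m:
    independence of the blocks speaks about sets in these product spaces, and \<open>bad_A\<close>
    translates back to events in \<open>M\<close>.\<close>
  define A where "A m = {g \<in> space (PiM (K m) (\<lambda>_. count_space (UNIV :: 'b set))).
      \<exists>k\<in>{..<?L}. g (m * ?L + k) \<noteq> w ! k}" for m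
  have A: "A m \<in> sets (PiM (K m) (\<lambda>_. count_space UNIV))" for m
  proof -
    have comp: "(\<lambda>g. g (m * ?L + k)) \<in> measurable (PiM (K m) (\<lambda>_. count_space (UNIV :: 'b set))) (count_space UNIV)"
      if "k < ?L" for k
      by (rule measurable_component_singleton) (use that in \<open>auto simp: K_def\<close>)
    then have "{g \<in> space (PiM (K m) (\<lambda>_. count_space UNIV)). g (m * ?L + k) \<noteq> w ! k}
        \<in> sets (PiM (K m) (\<lambda>_. count_space UNIV))" if "k < ?L" for k
      using measurable_sets[OF comp[OF that], of "- {w ! k}"] by (simp add: vimage_def Int_def conj_commute)
    then show ?thesis
      unfolding A_def by (intro sets.sets_Collect_finite_Ex) auto
  qed
  define bad where "bad m = {\<omega> \<in> space M. \<exists>k<?L. e (m * ?L + k) \<omega> \<noteq> w ! k}" for m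
  have bad[measurable]: "bad m \<in> sets M" for m unfolding bad_def by measurable
  have bad_A: "(\<lambda>\<omega>. restrict (\<lambda>i. e i \<omega>) (K m)) -` A m \<inter> space M = bad m" for m
    by (auto simp: A_def bad_def K_def space_PiM)
  \<comment> \<open>The probability that a given block spells w; positive since all letters lie in
    the support.\<close>
  define c where "c = (\<Prod>k<?L. pmf p (w ! k))"
  have c0: "0 < c"
    using w by (auto simp: c_def set_pmf_iff pmf_pos subset_iff intro!: prod_pos)
  have c: "prob (bad m) = 1 - c" for m
  proof -
    have "space M - bad m = (\<Inter>k\<in>K m. e k -` {w ! (k - m * ?L)} \<inter> space M)"
    proof -
      have "(\<forall>k<?L. e (m * ?L + k) \<omega> = w ! k) \<longleftrightarrow> (\<forall>k\<in>K m. e k \<omega> = w ! (k - m * ?L))" for \<omega>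
        by (auto simp: K_def) (metis add_diff_inverse_nat linorder_not_less nat_add_left_cancel_less)
      then show ?thesis using L by (auto simp: bad_def K_def)
    qed
    then have "prob (space M - bad m) = (\<Prod>k\<in>K m. prob (e k -` {w ! (k - m * ?L)} \<inter> space M))"
      using indep_varsD[OF ind, of "K m" "\<lambda>k. {w ! (k - m * ?L)}"] L by (auto simp: K_def)
    also have "\<dots> = (\<Prod>k\<in>K m. pmf p (w ! (k - m * ?L)))"
      using iid_edges_prob[OF iid] by (intro prod.cong) (auto simp: vimage_def Int_def conj_commute)
    also have "\<dots> = c"
      unfolding c_def K_def
      by (rule prod.reindex_bij_witness[of _ "\<lambda>k. m * ?L + k" "\<lambda>k. k - m * ?L"]) auto
    finally show ?thesis by (simp add: prob_compl)
  qed
  have c1: "c \<le> 1" using c[of 0] measure_nonneg[of M "bad 0"] by linarith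
  have AE: "AE \<omega> in M. \<exists>m\<ge>N. \<omega> \<notin> bad m" for N
  proof -
    \<comment> \<open>Independence is applied to the finitely many blocks N to N + j, which are
      \<open>Suc j\<close> in number.\<close>
    have "prob (\<Inter>m\<in>{N..}. bad m) \<le> (1 - c) ^ Suc j" for j
    proof -
      have "prob (\<Inter>m\<in>{N..}. bad m) \<le> prob (\<Inter>m\<in>{N..N + j}. bad m)"
        by (intro finite_measure_mono INF_superset_mono) auto
      also have "\<dots> = (\<Prod>m\<in>{N..N + j}. prob (bad m))"
        using indep_varsD[OF blocks, of "{N..N + j}" A] A by (simp add: bad_A)
      also have "\<dots> = (1 - c) ^ Suc j" by (simp add: c)
      finally show ?thesis .
    qed
    moreover have "(\<lambda>j. (1 - c) ^ Suc j) \<longlonglongrightarrow> 0"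
      using c0 c1 by (intro LIMSEQ_Suc LIMSEQ_realpow_zero) auto
    ultimately have "prob (\<Inter>m\<in>{N..}. bad m) \<le> 0"
      by (intro LIMSEQ_le_const) auto
    then have "prob (\<Inter>m\<in>{N..}. bad m) = 0" using measure_nonneg by (metis antisym)
    then have "(\<Inter>m\<in>{N..}. bad m) \<in> null_sets M"
      by (simp add: null_sets_def emeasure_eq_measure)
    then have "AE \<omega> in M. \<omega> \<notin> (\<Inter>m\<in>{N..}. bad m)" by (rule AE_not_in)
    then show ?thesis by eventually_elim auto
  qed
  have "AE \<omega> in M. \<forall>N. \<exists>m\<ge>N. \<omega> \<notin> bad m"
    using AE by (simp add: AE_all_countable)
  then show ?thesis
    using AE_space
  proof eventually_elim
    case (elim \<omega>)
    show ?case
    proof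
      fix N
      obtain m where m: "m \<ge> N" "\<omega> \<notin> bad m" using elim by blast
      have "N \<le> m * ?L" using m(1) L by (metis le_trans mult.right_neutral mult_le_mono2 Suc_leI One_nat_def)
      moreover have "\<forall>k<?L. e (m * ?L + k) \<omega> = w ! k" using m elim by (auto simp: bad_def)
      ultimately show "\<exists>t\<ge>N. \<forall>k<?L. e (t + k) \<omega> = w ! k" by blast
    qed
  qed
qed auto

lemma random_consensus:
  fixes B :: "'e \<Rightarrow> real ^ 'n ^ 'n"
  assumes iid: "iid_edges M p e"
    and st: "\<And>x. x \<in> set_pmf p \<Longrightarrow> stochastic (B x)"
    and dg: "\<And>x i. x \<in> set_pmf p \<Longrightarrow> 0 < B x $ i $ i"
    and conn: "\<And>i j. (i, j) \<in> {(i, j). \<exists>x\<in>set_pmf p. 0 < B x $ i $ j}\<^sup>*"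
  shows "AE \<omega> in M. \<exists>lam. convex_vector lam \<and> evolution B (\<lambda>t. e t \<omega>) \<longlonglongrightarrow> outer 1 lam"
proof -
  \<comment> \<open>\<open>undefined\<close> is some fixed agent; any column would serve.\<close>
  obtain w where w: "set w \<subseteq> set_pmf p" "\<And>i. 0 < word_product B w $ i $ undefined"
    using positive_column_word[of "set_pmf p" B, OF st dg conn] by blast
  have "stochastic (word_product B w)"
    using w(1) st by (intro stochastic_word_product) auto
  note W = this w(2)
  from iid_edges_support[OF iid] iid_edges_word[OF iid w(1)] show ?thesis
  proof eventually_elim
    case (elim \<omega>)
    then show ?case
      using consensus[of B "\<lambda>t. e t \<omega>" w, OF _ W] st by metis
  qed
qed

text \<open>\<open>lim\<close> is measurable but has an unspecified value where the sequence
  diverges. Replacing it by a unit vector wherever it is not convex keeps it measurable and makes it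
  a convex vector at every point, not only almost surely.\<close>

lemma random_convex_vector_limit:
  fixes X :: "nat \<Rightarrow> 'w \<Rightarrow> real ^ 'n"
  assumes meas: "\<And>t. X t \<in> borel_measurable M"
    and lim: "AE \<omega> in M. \<exists>v. convex_vector v \<and> (\<lambda>t. X t \<omega>) \<longlonglongrightarrow> v"
  obtains lam where "random_convex_vector M lam" "AE \<omega> in M. (\<lambda>t. X t \<omega>) \<longlonglongrightarrow> lam \<omega>"
proof
  define l where "l \<omega> = lim (\<lambda>t. X t \<omega>)" for \<omega>
  define lam where "lam \<omega> = (if convex_vector (l \<omega>) then l \<omega> else axis undefined 1)" for \<omega>
  have [measurable]: "l \<in> borel_measurable M"
    unfolding l_def by (rule borel_measurable_lim_metric[OF meas])
  have "Measurable.pred M (\<lambda>\<omega>. convex_vector (l \<omega>))"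
    unfolding convex_vector_def by measurable
  then have [measurable]: "lam \<in> borel_measurable M"
    unfolding lam_def by measurable
  then show "random_convex_vector M lam"
    by (auto simp: random_convex_vector_def lam_def convex_vector_axis)
  show "AE \<omega> in M. (\<lambda>t. X t \<omega>) \<longlonglongrightarrow> lam \<omega>"
    using lim
  proof eventually_elim
    case (elim \<omega>)
    then obtain v where v: "convex_vector v" "(\<lambda>t. X t \<omega>) \<longlonglongrightarrow> v" by blast
    then have "l \<omega> = v" unfolding l_def by (simp add: limI)
    with v show ?case by (simp add: lam_def)
  qed
qed

section \<open>Couplings and optimally coupled families\<close>

lemma measurable_fst_borel_prod[measurable]: "fst \<in> borel_measurable (borel :: ('a::second_countable_topology \<times> 'b::second_countable_topology) measure)"
  and measurable_snd_borel_prod[measurable]: "snd \<in> borel_measurable (borel :: ('a \<times> 'b) measure)"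
  by (intro borel_measurable_continuous_onI continuous_intros)+

lemma P2_prob_space: "\<mu> \<in> P2 \<Longrightarrow> prob_space \<mu>"
  and P2_sets: "\<mu> \<in> P2 \<Longrightarrow> sets \<mu> = sets borel"
  and P2_space: "\<mu> \<in> P2 \<Longrightarrow> space \<mu> = UNIV"
  and P2_integrable: "\<mu> \<in> P2 \<Longrightarrow> integrable \<mu> (\<lambda>x. (norm x)\<^sup>2)"
  by (auto simp: P2_def dest: sets_eq_imp_space_eq)

lemma distr_in_P2:
  assumes "prob_space P" "f \<in> borel_measurable P" "integrable P (\<lambda>\<omega>. (norm (f \<omega>))\<^sup>2)"
  shows "distr P borel f \<in> P2"
  using assms by (auto simp: P2_def integrable_distr_eq prob_space.prob_space_distr)

lemma coupling_measurable:
  assumes "\<gamma> \<in> couplings \<mu> \<nu>"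
  shows "fst \<in> borel_measurable \<gamma>" "snd \<in> borel_measurable \<gamma>"
  using assms measurable_fst_borel_prod measurable_snd_borel_prod
  by (auto simp: couplings_def cong: measurable_cong_sets)

lemma coupling_space: "\<gamma> \<in> couplings \<mu> \<nu> \<Longrightarrow> space \<gamma> = UNIV"
  by (auto simp: couplings_def dest: sets_eq_imp_space_eq)

lemma coupling_prob_space:
  assumes "\<gamma> \<in> couplings \<mu> \<nu>" "prob_space \<mu>"
  shows "prob_space \<gamma>"
  using assms coupling_measurable[OF assms(1)] prob_space_distrD[of fst \<gamma> borel]
  by (auto simp: couplings_def)

lemma coupling_integral:
  fixes h :: "'a::euclidean_space \<Rightarrow> real"
  assumes "\<gamma> \<in> couplings \<mu> \<nu>" and [measurable]: "h \<in> borel_measurable borel"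
  shows "integrable \<gamma> (\<lambda>z. h (fst z)) \<longleftrightarrow> integrable \<mu> h" "(\<integral>z. h (fst z) \<partial>\<gamma>) = (\<integral>x. h x \<partial>\<mu>)"
    and "integrable \<gamma> (\<lambda>z. h (snd z)) \<longleftrightarrow> integrable \<nu> h" "(\<integral>z. h (snd z) \<partial>\<gamma>) = (\<integral>x. h x \<partial>\<nu>)"
proof -
  have "distr \<gamma> borel fst = \<mu>" "distr \<gamma> borel snd = \<nu>"
    using assms by (auto simp: couplings_def)
  note eq = this[symmetric]
  note [measurable] = coupling_measurable[OF assms(1)]
  show "integrable \<gamma> (\<lambda>z. h (fst z)) \<longleftrightarrow> integrable \<mu> h" "(\<integral>z. h (fst z) \<partial>\<gamma>) = (\<integral>x. h x \<partial>\<mu>)"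
    by (simp_all add: eq(1) integrable_distr_eq integral_distr)
  show "integrable \<gamma> (\<lambda>z. h (snd z)) \<longleftrightarrow> integrable \<nu> h" "(\<integral>z. h (snd z) \<partial>\<gamma>) = (\<integral>x. h x \<partial>\<nu>)"
    by (simp_all add: eq(2) integrable_distr_eq integral_distr)
qed

lemma norm_diff_sq_le: "(norm (x - y :: 'a::real_inner))\<^sup>2 \<le> 2 * (norm x)\<^sup>2 + 2 * (norm y)\<^sup>2"
proof -
  have "0 \<le> (norm (x + y))\<^sup>2" by simp
  then show ?thesis
    by (simp add: power2_norm_eq_inner inner_diff inner_add inner_commute algebra_simps)
qed

lemma coupling_integrable_sq:
  assumes "\<gamma> \<in> couplings \<mu> \<nu>" "\<mu> \<in> P2" "\<nu> \<in> P2"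
  shows "integrable \<gamma> (\<lambda>z. (norm (fst z))\<^sup>2)" "integrable \<gamma> (\<lambda>z. (norm (snd z))\<^sup>2)"
  using coupling_integral[OF assms(1), of "\<lambda>x. (norm x)\<^sup>2"] assms(2,3) by (auto simp: P2_integrable)

lemma integrable_diff_sq:
  fixes f g :: "'b \<Rightarrow> 'a::euclidean_space"
  assumes [measurable]: "f \<in> borel_measurable P" "g \<in> borel_measurable P"
    and "integrable P (\<lambda>\<omega>. (norm (f \<omega>))\<^sup>2)" "integrable P (\<lambda>\<omega>. (norm (g \<omega>))\<^sup>2)"
  shows "integrable P (\<lambda>\<omega>. (norm (f \<omega> - g \<omega>))\<^sup>2)"
proof (rule Bochner_Integration.integrable_bound)
  show "integrable P (\<lambda>\<omega>. 2 * (norm (f \<omega>))\<^sup>2 + 2 * (norm (g \<omega>))\<^sup>2)" using assms by auto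
  show "AE \<omega> in P. norm ((norm (f \<omega> - g \<omega>))\<^sup>2) \<le> norm (2 * (norm (f \<omega>))\<^sup>2 + 2 * (norm (g \<omega>))\<^sup>2)"
    using norm_diff_sq_le by (auto intro!: AE_I2 simp del: power2_diff)
qed simp

lemma coupling_integrable_cost:
  assumes "\<gamma> \<in> couplings \<mu> \<nu>" "\<mu> \<in> P2" "\<nu> \<in> P2"
  shows "integrable \<gamma> (\<lambda>z. (norm (fst z - snd z))\<^sup>2)"
  using coupling_measurable[OF assms(1)] coupling_integrable_sq[OF assms]
  by (rule integrable_diff_sq)

lemma coupling_distr_pair:
  assumes [measurable]: "f \<in> borel_measurable P" "g \<in> borel_measurable P"
  shows "distr P borel (\<lambda>\<omega>. (f \<omega>, g \<omega>)) \<in> couplings (distr P borel f) (distr P borel g)"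
  by (auto simp: couplings_def distr_distr comp_def)

lemma transport_cost_distr_pair:
  assumes [measurable]: "f \<in> borel_measurable P" "g \<in> borel_measurable P"
  shows "transport_cost (distr P borel (\<lambda>\<omega>. (f \<omega>, g \<omega>))) = (\<integral>\<omega>. (norm (f \<omega> - g \<omega>))\<^sup>2 \<partial>P)"
  by (simp add: transport_cost_def integral_distr)

lemma transport_cost_nonneg: "0 \<le> transport_cost \<gamma>"
  by (simp add: transport_cost_def)

lemma bdd_below_transport_cost: "bdd_below (transport_cost ` C)"
  by (rule bdd_belowI2[of _ 0]) (rule transport_cost_nonneg)

text \<open>The infimum of a set of reals can be used only if the set is nonempty and bounded below;
  nonnegative costs give the bound, and the premise gives the rest.\<close>

lemma W2_sq:
  assumes "couplings \<mu> \<nu> \<noteq> {}"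
  shows "(W2 \<mu> \<nu>)\<^sup>2 = (INF \<gamma>\<in>couplings \<mu> \<nu>. transport_cost \<gamma>)"
  unfolding W2_def
  by (intro real_sqrt_pow2 cINF_greatest assms transport_cost_nonneg)

lemma W2_sq_ge:
  assumes "couplings \<mu> \<nu> \<noteq> {}" "\<And>\<gamma>. \<gamma> \<in> couplings \<mu> \<nu> \<Longrightarrow> c \<le> transport_cost \<gamma>"
  shows "c \<le> (W2 \<mu> \<nu>)\<^sup>2"
  unfolding W2_sq[OF assms(1)] by (intro cINF_greatest assms)

lemma W2_sq_le: "\<gamma> \<in> couplings \<mu> \<nu> \<Longrightarrow> (W2 \<mu> \<nu>)\<^sup>2 \<le> transport_cost \<gamma>"
  by (subst W2_sq) (auto intro!: cINF_lower bdd_below_transport_cost)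

lemma W2_nonneg: "couplings \<mu> \<nu> \<noteq> {} \<Longrightarrow> 0 \<le> W2 \<mu> \<nu>"
  unfolding W2_def by (intro real_sqrt_ge_zero cINF_greatest transport_cost_nonneg)

text \<open>Supplies the nearly optimal couplings on which the uniqueness of the Gaussian barycenter
  rests.\<close>

lemma W2_sq_less_coupling:
  assumes "couplings \<mu> \<nu> \<noteq> {}" "(W2 \<mu> \<nu>)\<^sup>2 < c"
  obtains \<gamma> where "\<gamma> \<in> couplings \<mu> \<nu>" "transport_cost \<gamma> < c"
  using assms W2_sq_ge[OF assms(1), of c] by (meson not_less)

text \<open>The product measure is a witness; its second marginal is read off after swapping the
  factors.\<close>

lemma couplings_nonempty:
  assumes "\<mu> \<in> P2" "\<nu> \<in> P2"
  shows "couplings \<mu> \<nu> \<noteq> {}"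
proof -
  interpret M: prob_space \<mu> using assms by (simp add: P2_prob_space)
  interpret N: prob_space \<nu> using assms by (simp add: P2_prob_space)
  interpret pair_prob_space \<mu> \<nu> ..
  have [measurable_cong]: "sets \<mu> = sets borel" "sets \<nu> = sets borel"
    using assms by (simp_all add: P2_sets)
  have "distr (\<mu> \<Otimes>\<^sub>M \<nu>) borel fst = \<mu>"
    using N.distr_pair_fst[of \<mu>] distr_cong[OF refl P2_sets[OF assms(1), symmetric], of "\<mu> \<Otimes>\<^sub>M \<nu>" fst fst]
    by simp
  moreover have "distr (\<mu> \<Otimes>\<^sub>M \<nu>) borel snd = \<nu>"
  proof -
    have "distr (\<mu> \<Otimes>\<^sub>M \<nu>) borel snd = distr (distr (\<nu> \<Otimes>\<^sub>M \<mu>) (\<mu> \<Otimes>\<^sub>M \<nu>) (\<lambda>(x, y). (y, x))) borel snd"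
      using distr_pair_swap by simp
    also have "\<dots> = distr (\<nu> \<Otimes>\<^sub>M \<mu>) borel fst"
      by (subst distr_distr) (auto simp: comp_def case_prod_beta')
    also have "\<dots> = \<nu>"
      using M.distr_pair_fst[of \<nu>] distr_cong[OF refl P2_sets[OF assms(2), symmetric], of "\<nu> \<Otimes>\<^sub>M \<mu>" fst fst]
      by simp
    finally show ?thesis .
  qed
  moreover have "sets (\<mu> \<Otimes>\<^sub>M \<nu>) = sets borel"
    using sets_pair_measure_cong[OF P2_sets[OF assms(1)] P2_sets[OF assms(2)]] unfolding borel_prod .
  ultimately have "\<mu> \<Otimes>\<^sub>M \<nu> \<in> couplings \<mu> \<nu>" by (simp add: couplings_def)
  then show ?thesis by blast
qed

text \<open>Serves to pass from the weights 1/n to the weights 1 in the symmetric case.\<close>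

lemma wasserstein_barycenter_scale:
  assumes "0 < c"
  shows "wasserstein_barycenter (c *\<^sub>R lam) \<mu> m \<longleftrightarrow> wasserstein_barycenter lam \<mu> m"
proof -
  have "(\<Sum>i\<in>UNIV. (c *\<^sub>R lam) $ i * (W2 \<nu> (\<mu> i))\<^sup>2) = c * (\<Sum>i\<in>UNIV. lam $ i * (W2 \<nu> (\<mu> i))\<^sup>2)" for \<nu>
    by (simp add: sum_distrib_left mult.assoc)
  with assms show ?thesis by (simp add: wasserstein_barycenter_def is_arg_min_def)
qed

section \<open>Mixtures of random vectors and their laws\<close>

definition mix :: "('n::finite \<Rightarrow> 'b \<Rightarrow> 'a::euclidean_space) \<Rightarrow> real ^ 'n \<Rightarrow> 'b \<Rightarrow> 'a" where
  "mix q v \<omega> = (\<Sum>j\<in>UNIV. v $ j *\<^sub>R q j \<omega>)"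

lemma mix_axis: "mix q (axis i 1) = q i"
proof
  fix \<omega>
  have "mix q (axis i 1) \<omega> = (\<Sum>j\<in>UNIV. if j = i then q j \<omega> else 0)"
    unfolding mix_def by (intro sum.cong) (auto simp: axis_def)
  then show "mix q (axis i 1) \<omega> = q i \<omega>" by simp
qed

lemma mix_linear:
  "mix q (v + w) \<omega> = mix q v \<omega> + mix q w \<omega>" "mix q (v - w) \<omega> = mix q v \<omega> - mix q w \<omega>"
  "mix q (c *\<^sub>R v) \<omega> = c *\<^sub>R mix q v \<omega>"
  by (simp_all add: mix_def scaleR_left_distrib scaleR_left_diff_distrib sum.distrib sum_subtractf scaleR_sum_right)

text \<open>Cauchy-Schwarz. It yields square integrability of mixtures and, applied to a difference
  of weights, continuity of the law in the weights.\<close>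

lemma norm_mix_sq_le: "(norm (mix q v \<omega>))\<^sup>2 \<le> (norm v)\<^sup>2 * (\<Sum>j\<in>UNIV. (norm (q j \<omega>))\<^sup>2)"
proof -
  have "norm (mix q v \<omega>) \<le> (\<Sum>j\<in>UNIV. \<bar>v $ j\<bar> * norm (q j \<omega>))"
    unfolding mix_def by (rule order_trans[OF norm_sum]) simp
  then have "(norm (mix q v \<omega>))\<^sup>2 \<le> (\<Sum>j\<in>UNIV. \<bar>v $ j\<bar> * norm (q j \<omega>))\<^sup>2"
    by (intro power_mono) auto
  also have "\<dots> \<le> (\<Sum>j\<in>UNIV. \<bar>v $ j\<bar>\<^sup>2) * (\<Sum>j\<in>UNIV. (norm (q j \<omega>))\<^sup>2)"
    by (rule Cauchy_Schwarz_ineq_sum)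
  also have "(\<Sum>j\<in>UNIV. \<bar>v $ j\<bar>\<^sup>2) = (norm v)\<^sup>2"
    by (simp add: norm_vec_def L2_set_def sum_nonneg)
  finally show ?thesis .
qed

lemma integrable_mix_sq:
  assumes [measurable]: "\<And>j. q j \<in> borel_measurable P"
    and "\<And>j. integrable P (\<lambda>\<omega>. (norm (q j \<omega>))\<^sup>2)"
  shows "integrable P (\<lambda>\<omega>. (norm (mix q v \<omega>))\<^sup>2)"
proof (rule Bochner_Integration.integrable_bound)
  show "integrable P (\<lambda>\<omega>. (norm v)\<^sup>2 * (\<Sum>j\<in>UNIV. (norm (q j \<omega>))\<^sup>2))"
    using assms(2) by auto
  show "AE \<omega> in P. norm ((norm (mix q v \<omega>))\<^sup>2) \<le> norm ((norm v)\<^sup>2 * (\<Sum>j\<in>UNIV. (norm (q j \<omega>))\<^sup>2))"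
    using norm_mix_sq_le[of q v] by (intro AE_I2) (simp add: abs_mult sum_nonneg)
qed (unfold mix_def, measurable)

text \<open>Measures realised as laws of the random vectors \<open>q j\<close> on a common probability space, in such
  a way that the joint law of any two mixtures is the unique optimal plan between their laws.
  Barycentric steps then act linearly on the random vectors.\<close>

locale optimally_coupled = prob_space P
  for P :: "'b measure" and q :: "'n::finite \<Rightarrow> 'b \<Rightarrow> 'a::euclidean_space" +
  assumes measurable_q[measurable]: "\<And>j. q j \<in> borel_measurable P"
    and integrable_q: "\<And>j. integrable P (\<lambda>\<omega>. (norm (q j \<omega>))\<^sup>2)"
    and optimal: "\<And>v w \<gamma>. convex_vector v \<Longrightarrow> convex_vector w \<Longrightarrow>
      \<gamma> \<in> couplings (distr P borel (mix q v)) (distr P borel (mix q w)) \<Longrightarrow>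
      (\<integral>\<omega>. (norm (mix q v \<omega> - mix q w \<omega>))\<^sup>2 \<partial>P) \<le> transport_cost \<gamma>"
    and optimal_unique: "\<And>v w \<gamma>. convex_vector v \<Longrightarrow> convex_vector w \<Longrightarrow>
      \<gamma> \<in> couplings (distr P borel (mix q v)) (distr P borel (mix q w)) \<Longrightarrow>
      transport_cost \<gamma> = (\<integral>\<omega>. (norm (mix q v \<omega> - mix q w \<omega>))\<^sup>2 \<partial>P) \<Longrightarrow>
      \<gamma> = distr P borel (\<lambda>\<omega>. (mix q v \<omega>, mix q w \<omega>))"
begin

definition law :: "real ^ 'n \<Rightarrow> 'a measure" where "law v = distr P borel (mix q v)"

lemma measurable_mix[measurable]: "mix q v \<in> borel_measurable P"
  unfolding mix_def by measurable

lemma integrable_mix: "integrable P (\<lambda>\<omega>. (norm (mix q v \<omega>))\<^sup>2)"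
  by (intro integrable_mix_sq measurable_q integrable_q)

lemma law_P2: "law v \<in> P2"
  unfolding law_def by (intro distr_in_P2 integrable_mix measurable_mix prob_space_axioms)

lemma coupling_mix: "distr P borel (\<lambda>\<omega>. (mix q v \<omega>, mix q w \<omega>)) \<in> couplings (law v) (law w)"
  unfolding law_def by (intro coupling_distr_pair measurable_mix)

lemma W2_law_sq:
  assumes "convex_vector v" "convex_vector w"
  shows "(W2 (law v) (law w))\<^sup>2 = (\<integral>\<omega>. (norm (mix q v \<omega> - mix q w \<omega>))\<^sup>2 \<partial>P)"
proof (rule antisym)
  show "(W2 (law v) (law w))\<^sup>2 \<le> (\<integral>\<omega>. (norm (mix q v \<omega> - mix q w \<omega>))\<^sup>2 \<partial>P)"
    using W2_sq_le[OF coupling_mix] by (simp add: transport_cost_distr_pair)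
  show "(\<integral>\<omega>. (norm (mix q v \<omega> - mix q w \<omega>))\<^sup>2 \<partial>P) \<le> (W2 (law v) (law w))\<^sup>2"
    using optimal[OF assms] coupling_mix by (intro W2_sq_ge) (auto simp: law_def)
qed

text \<open>The joint law of the mixtures is an optimal plan, so the existence premise in
  \<open>optimal_plan_choice\<close> is met and \<gamma>opt returns an optimal plan; uniqueness
  makes it this joint law, whose image under the interpolation map is the law of the interpolated
  mixture.\<close>

lemma displacement_law:
  assumes choice: "optimal_plan_choice \<gamma>opt" and v: "convex_vector v" and w: "convex_vector w"
  shows "displacement \<gamma>opt a (law v) (law w) = law ((1 - a) *\<^sub>R v + a *\<^sub>R w)"
proof -
  let ?\<gamma> = "distr P borel (\<lambda>\<omega>. (mix q v \<omega>, mix q w \<omega>))"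
  have cost: "transport_cost ?\<gamma> = (\<integral>\<omega>. (norm (mix q v \<omega> - mix q w \<omega>))\<^sup>2 \<partial>P)"
    by (simp add: transport_cost_distr_pair)
  have "optimal_plan (law v) (law w) ?\<gamma>"
    using optimal[OF v w] coupling_mix
    by (auto simp: optimal_plan_def is_arg_min_def cost law_def not_less)
  then have opt: "optimal_plan (law v) (law w) (\<gamma>opt (law v) (law w))"
    using choice law_P2 unfolding optimal_plan_choice_def by blast
  then have "\<gamma>opt (law v) (law w) \<in> couplings (law v) (law w)"
    and "transport_cost (\<gamma>opt (law v) (law w)) \<le> transport_cost ?\<gamma>"
    using coupling_mix by (auto simp: optimal_plan_def is_arg_min_def not_less)
  then have "\<gamma>opt (law v) (law w) = ?\<gamma>"
    unfolding law_def cost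
    by (intro optimal_unique[OF v w] antisym optimal[OF v w])
  moreover have "mix q ((1 - a) *\<^sub>R v + a *\<^sub>R w) = (\<lambda>\<omega>. (1 - a) *\<^sub>R mix q v \<omega> + a *\<^sub>R mix q w \<omega>)"
    by (simp add: fun_eq_iff mix_linear)
  ultimately show ?thesis
    by (simp add: displacement_def distr_distr comp_def law_def)
qed

text \<open>The common probability space couples the two laws at a cost of at most \<open>C\<close>
  times the squared distance of the weights.\<close>

lemma W2_law_tendsto:
  assumes "X \<longlonglongrightarrow> v"
  shows "(\<lambda>t. W2 (law (X t)) (law v)) \<longlonglongrightarrow> 0"
proof -
  define C where "C = (\<integral>\<omega>. (\<Sum>j\<in>UNIV. (norm (q j \<omega>))\<^sup>2) \<partial>P)"
  have bound: "(W2 (law u) (law v))\<^sup>2 \<le> (norm (u - v))\<^sup>2 * C" for u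
  proof -
    have "(W2 (law u) (law v))\<^sup>2 \<le> (\<integral>\<omega>. (norm (mix q (u - v) \<omega>))\<^sup>2 \<partial>P)"
      using W2_sq_le[OF coupling_mix] by (simp add: transport_cost_distr_pair mix_linear)
    also have "\<dots> \<le> (\<integral>\<omega>. (norm (u - v))\<^sup>2 * (\<Sum>j\<in>UNIV. (norm (q j \<omega>))\<^sup>2) \<partial>P)"
      using norm_mix_sq_le integrable_mix integrable_q by (intro integral_mono) auto
    finally show ?thesis by (simp add: C_def)
  qed
  have "(\<lambda>t. (W2 (law (X t)) (law v))\<^sup>2) \<longlonglongrightarrow> 0"
  proof (rule tendsto_sandwich[OF _ _ tendsto_const])
    have "(\<lambda>t. (norm (X t - v))\<^sup>2 * C) \<longlonglongrightarrow> (norm (v - v))\<^sup>2 * C"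
      by (intro tendsto_intros assms)
    then show "(\<lambda>t. (norm (X t - v))\<^sup>2 * C) \<longlonglongrightarrow> 0" by simp
  qed (simp_all add: bound)
  then have "(\<lambda>t. sqrt ((W2 (law (X t)) (law v))\<^sup>2)) \<longlonglongrightarrow> sqrt 0" by (intro tendsto_intros)
  moreover have "0 \<le> W2 (law (X t)) (law v)" for t
    using coupling_mix by (intro W2_nonneg) auto
  ultimately show ?thesis by simp
qed

end

section \<open>Measures on the line\<close>

text \<open>The open interval, because quantile functions have meaningful values and are monotone
  there; \<open>distr_closed_unit\<close> leads back to the closed one.\<close>

abbreviation unit_lborel :: "real measure" where
  "unit_lborel \<equiv> restrict_space lborel {0<..<1}"

lemma prob_space_unit_lborel: "prob_space unit_lborel"
  by (auto simp: emeasure_restrict_space space_restrict_space intro!: prob_spaceI)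

definition joint_cdf :: "(real \<times> real) measure \<Rightarrow> real \<Rightarrow> real \<Rightarrow> real" where
  "joint_cdf \<gamma> s t = measure \<gamma> {z. fst z \<le> s \<and> snd z \<le> t}"

text \<open>The right-hand side is the Frechet-Hoeffding upper bound: the joint distribution
  function is as large as its marginals allow.\<close>

definition comonotone :: "(real \<times> real) measure \<Rightarrow> bool" where
  "comonotone \<gamma> \<longleftrightarrow> (\<forall>s t. joint_cdf \<gamma> s t = min (cdf (distr \<gamma> borel fst) s) (cdf (distr \<gamma> borel snd) t))"

text \<open>For \<open>x \<le> y\<close> the square of \<open>y - x\<close> is the area of the square of those \<open>(s, t)\<close> with
  \<open>x \<le> min s t\<close> and \<open>max s t < y\<close>; Tonelli then expresses the cost through the joint
  distribution function.\<close>

definition cost_density :: "(real \<times> real) measure \<Rightarrow> real \<times> real \<Rightarrow> real" where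
  "cost_density \<gamma> = (\<lambda>(s, t).
     measure \<gamma> {z. fst z \<le> min s t \<and> max s t < snd z} +
     measure \<gamma> {z. snd z \<le> min s t \<and> max s t < fst z})"

lemma square_layer:
  "ennreal ((norm (x - y))\<^sup>2) =
    (\<integral>\<^sup>+p. indicator ({x..<y} \<times> {x..<y}) p + indicator ({y..<x} \<times> {y..<x}) p \<partial>lborel)"
  for x y :: real
proof -
  have area: "emeasure lborel ({a..<b} \<times> {a..<b}) = ennreal ((b - a)\<^sup>2)" if "a \<le> b" for a b :: real
  proof -
    have "emeasure lborel ({a..<b} \<times> {a..<b}) = emeasure lborel {a..<b} * emeasure lborel {a..<b}"
      unfolding lborel_prod[symmetric] by (rule lborel.emeasure_pair_measure_Times) auto
    with that show ?thesis by (simp add: ennreal_mult power2_eq_square)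
  qed
  have [measurable]: "{a..<b} \<times> {a..<b} \<in> sets borel" for a b :: real
    unfolding borel_prod[symmetric] by measurable
  \<comment> \<open>At least one of the two squares is empty, so their areas can be added whatever
    the order of x and y.\<close>
  have "(\<integral>\<^sup>+p. indicator ({x..<y} \<times> {x..<y}) p + indicator ({y..<x} \<times> {y..<x}) p \<partial>lborel)
      = emeasure lborel ({x..<y} \<times> {x..<y}) + emeasure lborel ({y..<x} \<times> {y..<x})"
    by (subst nn_integral_add) auto
  also have "\<dots> = ennreal ((norm (x - y))\<^sup>2)"
    using area[of x y] area[of y x] by (cases "x \<le> y") (auto simp: power2_commute)
  finally show ?thesis by simp
qed

lemma pair_borel_sets[measurable]:
  "{z :: real \<times> real. fst z \<le> s \<and> t < snd z} \<in> sets borel"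
  "{z :: real \<times> real. snd z \<le> s \<and> t < fst z} \<in> sets borel"
  "{z :: real \<times> real. fst z \<le> s \<and> snd z \<le> t} \<in> sets borel"
  "{z :: real \<times> real. fst z \<le> s} \<in> sets borel"
  "{z :: real \<times> real. snd z \<le> s} \<in> sets borel"
  by measurable

lemma cost_layer:
  assumes "prob_space \<gamma>" and sets: "sets \<gamma> = sets borel"
  shows "(\<integral>\<^sup>+z. ennreal ((norm (fst z - snd z))\<^sup>2) \<partial>\<gamma>) = (\<integral>\<^sup>+p. ennreal (cost_density \<gamma> p) \<partial>lborel)"
    and "cost_density \<gamma> \<in> borel_measurable borel"
proof -
  interpret prob_space \<gamma> by fact
  interpret pair_sigma_finite \<gamma> "lborel :: (real \<times> real) measure" ..
  note [measurable_cong] = sets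
  \<comment> \<open>For fixed p the kernel is an indicator in z whose integral is the cost density;
    for fixed z it is the pair of squares of \<open>square_layer\<close>. Tonelli exchanges the two
    readings.\<close>
  define K :: "real \<times> real \<Rightarrow> real \<times> real \<Rightarrow> ennreal" where
    "K z p = indicator {z. fst z \<le> min (fst p) (snd p) \<and> max (fst p) (snd p) < snd z} z +
      indicator {z. snd z \<le> min (fst p) (snd p) \<and> max (fst p) (snd p) < fst z} z" for z p
  have K: "K z p = indicator ({fst z..<snd z} \<times> {fst z..<snd z}) p + indicator ({snd z..<fst z} \<times> {snd z..<fst z}) p" for z p
    by (cases p) (auto simp: K_def indicator_def)
  have mK: "(\<lambda>(z, p). K z p) \<in> borel_measurable (\<gamma> \<Otimes>\<^sub>M lborel)"
    unfolding K_def indicator_def mem_Collect_eq by measurable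
  have dens: "(\<integral>\<^sup>+z. K z p \<partial>\<gamma>) = ennreal (cost_density \<gamma> p)" for p
    unfolding K_def
    by (subst nn_integral_add)
      (auto simp: sets emeasure_eq_measure cost_density_def case_prod_beta ennreal_plus)
  have "(\<integral>\<^sup>+z. ennreal ((norm (fst z - snd z))\<^sup>2) \<partial>\<gamma>) = (\<integral>\<^sup>+z. \<integral>\<^sup>+p. K z p \<partial>lborel \<partial>\<gamma>)"
    unfolding K square_layer ..
  also have "\<dots> = (\<integral>\<^sup>+p. \<integral>\<^sup>+z. K z p \<partial>\<gamma> \<partial>lborel)"
    using Fubini'[OF mK] by simp
  finally show "(\<integral>\<^sup>+z. ennreal ((norm (fst z - snd z))\<^sup>2) \<partial>\<gamma>) = (\<integral>\<^sup>+p. ennreal (cost_density \<gamma> p) \<partial>lborel)"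
    by (simp add: dens)
  have "(\<lambda>(p, z). K z p) \<in> borel_measurable (lborel \<Otimes>\<^sub>M \<gamma>)"
    unfolding K_def indicator_def mem_Collect_eq by measurable
  then have "(\<lambda>p. \<integral>\<^sup>+z. K z p \<partial>\<gamma>) \<in> borel_measurable lborel"
    by (rule sigma_finite_measure.borel_measurable_nn_integral[OF prob_space_imp_sigma_finite[OF assms(1)]])
  then have "(\<lambda>p. enn2real (ennreal (cost_density \<gamma> p))) \<in> borel_measurable borel"
    unfolding dens by measurable
  moreover have "enn2real (ennreal (cost_density \<gamma> p)) = cost_density \<gamma> p" for p
    by (intro enn2real_ennreal) (simp add: cost_density_def case_prod_beta)
  ultimately show "cost_density \<gamma> \<in> borel_measurable borel" by simp
qed

lemma joint_cdf_atMost: "joint_cdf \<gamma> s t = measure \<gamma> {..(s, t)}"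
  unfolding joint_cdf_def by (rule arg_cong[where f = "measure \<gamma>"]) (auto simp: less_eq_prod_def)

text \<open>The lower left quadrants are closed under intersection, generate the Borel sets of the
  plane and exhaust it.\<close>

lemma joint_cdf_eqI:
  assumes "prob_space \<gamma>" "sets \<gamma> = sets borel" "prob_space \<gamma>'" "sets \<gamma>' = sets borel"
    and eq: "\<And>s t. joint_cdf \<gamma> s t = joint_cdf \<gamma>' s t"
  shows "\<gamma> = \<gamma>'"
proof -
  interpret a: prob_space \<gamma> by fact
  interpret b: prob_space \<gamma>' by fact
  let ?E = "range (\<lambda>a. {..a :: real \<times> real})"
  have E: "sets borel = sigma_sets UNIV ?E"
    unfolding borel_eq_atMost by (rule sets_measure_of) simp
  show ?thesis
  proof (rule measure_eqI_generator_eq[where \<Omega> = UNIV and E = ?E and A = "\<lambda>n. {..(real n, real n)}"])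
    show "Int_stable ?E"
    proof (rule Int_stableI)
      fix a b assume "a \<in> ?E" "b \<in> ?E"
      then obtain x y where "a = {..x}" "b = {..y}" by blast
      then have "a \<inter> b = {..inf x y}" by auto
      then show "a \<inter> b \<in> ?E" by blast
    qed
    show "\<And>X. X \<in> ?E \<Longrightarrow> emeasure \<gamma> X = emeasure \<gamma>' X"
      using eq by (auto simp: a.emeasure_eq_measure b.emeasure_eq_measure joint_cdf_atMost)
    show "(\<Union>i. {..(real i, real i)}) = (UNIV :: (real \<times> real) set)"
    proof (auto)
      fix a b :: real
      obtain n where "max a b \<le> real n" using real_arch_simple by blast
      then show "\<exists>n. a \<le> real n \<and> b \<le> real n" by auto
    qed
  qed (auto simp: assms E a.emeasure_eq_measure)
qed

lemma coupling_cdf: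
  assumes "\<gamma> \<in> couplings \<mu> \<nu>"
  shows "cdf \<mu> s = measure \<gamma> {z. fst z \<le> s}" "cdf \<nu> s = measure \<gamma> {z. snd z \<le> s}"
proof -
  note [measurable] = coupling_measurable[OF assms]
  have eq: "\<mu> = distr \<gamma> borel fst" "\<nu> = distr \<gamma> borel snd"
    using assms by (auto simp: couplings_def)
  show "cdf \<mu> s = measure \<gamma> {z. fst z \<le> s}" "cdf \<nu> s = measure \<gamma> {z. snd z \<le> s}"
    unfolding eq cdf_def
    by (subst measure_distr; auto simp: coupling_space[OF assms] vimage_def)+
qed

locale line_coupling =
  fixes \<mu> \<nu> :: "real measure" and \<gamma> :: "(real \<times> real) measure"
  assumes coupling: "\<gamma> \<in> couplings \<mu> \<nu>" and P2: "\<mu> \<in> P2" "\<nu> \<in> P2"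

sublocale line_coupling \<subseteq> prob_space \<gamma>
  using coupling_prob_space[OF coupling] P2 by (simp add: P2_prob_space)

context line_coupling
begin

lemma sets_coupling: "sets \<gamma> = sets borel"
  using coupling by (simp add: couplings_def)

lemma real_distribution: "real_distribution \<mu>" "real_distribution \<nu>"
  using P2 by (simp_all add: real_distribution_def real_distribution_axioms_def P2_prob_space P2_sets P2_space)

lemma joint_cdf_le: "joint_cdf \<gamma> s t \<le> min (cdf \<mu> s) (cdf \<nu> t)"
  unfolding joint_cdf_def coupling_cdf[OF coupling]
  by (auto intro!: finite_measure_mono simp: sets_coupling)

text \<open>The larger quadrant is covered by the smaller one, a vertical strip and a horizontal
  strip. This carries a deficit of the joint distribution function from one point to nearby points
  on its upper right.\<close>

lemma joint_cdf_increment: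
  assumes "s \<le> s'" "t \<le> t'"
  shows "joint_cdf \<gamma> s' t' \<le> joint_cdf \<gamma> s t + (cdf \<mu> s' - cdf \<mu> s) + (cdf \<nu> t' - cdf \<nu> t)"
proof -
  let ?A = "{z. fst z \<le> s \<and> snd z \<le> t}"
  let ?B = "{z. fst z \<le> s'} - {z. fst z \<le> s}" and ?C = "{z. snd z \<le> t'} - {z. snd z \<le> t}"
  have "joint_cdf \<gamma> s' t' \<le> prob (?A \<union> ?B \<union> ?C)"
    unfolding joint_cdf_def by (intro finite_measure_mono) (auto simp: sets_coupling)
  also have "\<dots> \<le> prob ?A + prob ?B + prob ?C"
    by (intro order_trans[OF measure_Un_le] add_right_mono) (auto simp: sets_coupling)
  also have "prob ?B = cdf \<mu> s' - cdf \<mu> s" unfolding coupling_cdf[OF coupling]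
    using assms by (intro finite_measure_Diff) (auto simp: sets_coupling)
  also have "prob ?C = cdf \<nu> t' - cdf \<nu> t" unfolding coupling_cdf[OF coupling]
    using assms by (intro finite_measure_Diff) (auto simp: sets_coupling)
  finally show ?thesis by (simp add: joint_cdf_def)
qed

text \<open>With fixed marginals the joint distribution function enters only with a minus sign, so
  making it larger makes the cost smaller.\<close>

lemma cost_density_eq:
  "cost_density \<gamma> (s, t) =
    (cdf \<mu> (min s t) - joint_cdf \<gamma> (min s t) (max s t)) + (cdf \<nu> (min s t) - joint_cdf \<gamma> (max s t) (min s t))"
proof -
  have "prob {z. fst z \<le> a \<and> b < snd z} = cdf \<mu> a - joint_cdf \<gamma> a b" for a b
    unfolding coupling_cdf[OF coupling] joint_cdf_def
    by (subst finite_measure_Diff[symmetric])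
      (auto simp: sets_coupling intro!: arg_cong[where f = prob])
  moreover have "prob {z. snd z \<le> a \<and> b < fst z} = cdf \<nu> a - joint_cdf \<gamma> b a" for a b
    unfolding coupling_cdf[OF coupling] joint_cdf_def
    by (subst finite_measure_Diff[symmetric])
      (auto simp: sets_coupling intro!: arg_cong[where f = prob])
  ultimately show ?thesis by (simp only: cost_density_def prod.case)
qed

lemma cost_density_nonneg: "0 \<le> cost_density \<gamma> p"
  by (simp add: cost_density_def case_prod_beta)

lemma has_bochner_integral_cost_density:
  "integrable lborel (cost_density \<gamma>)" "transport_cost \<gamma> = (\<integral>p. cost_density \<gamma> p \<partial>lborel)"
proof -
  have "(\<integral>\<^sup>+z. ennreal ((norm (fst z - snd z))\<^sup>2) \<partial>\<gamma>) = ennreal (transport_cost \<gamma>)"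
    unfolding transport_cost_def
    using coupling_integrable_cost[OF coupling P2] by (intro nn_integral_eq_integral) auto
  then have "(\<integral>\<^sup>+p. ennreal (cost_density \<gamma> p) \<partial>lborel) = ennreal (transport_cost \<gamma>)"
    using cost_layer(1)[OF prob_space_axioms sets_coupling] by simp
  moreover have "cost_density \<gamma> \<in> borel_measurable lborel"
    using cost_layer(2)[OF prob_space_axioms sets_coupling] by simp
  ultimately have "has_bochner_integral lborel (cost_density \<gamma>) (transport_cost \<gamma>)"
    by (intro has_bochner_integral_nn_integral) (auto simp: cost_density_nonneg transport_cost_nonneg)
  then show "integrable lborel (cost_density \<gamma>)" "transport_cost \<gamma> = (\<integral>p. cost_density \<gamma> p \<partial>lborel)"
    by (auto simp: has_bochner_integral_iff)
qed

end

text \<open>The densities are ordered pointwise, hence so are the costs. Equal costs make the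
  densities agree almost everywhere, whereas a strict deficit of the joint distribution function at
  one point would persist, by right continuity of the marginals, on a box of positive area.\<close>

lemma comonotone_optimal:
  assumes P2: "\<mu> \<in> P2" "\<nu> \<in> P2" and \<gamma>: "\<gamma> \<in> couplings \<mu> \<nu>"
    and \<gamma>0: "\<gamma>0 \<in> couplings \<mu> \<nu>" "comonotone \<gamma>0"
  shows "transport_cost \<gamma>0 \<le> transport_cost \<gamma>"
    and "transport_cost \<gamma> = transport_cost \<gamma>0 \<Longrightarrow> \<gamma> = \<gamma>0"
proof -
  interpret G: line_coupling \<mu> \<nu> \<gamma> by unfold_locales fact+
  interpret H: line_coupling \<mu> \<nu> \<gamma>0 by unfold_locales fact+
  interpret M: real_distribution \<mu> by (rule G.real_distribution)
  interpret N: real_distribution \<nu> by (rule G.real_distribution)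
  have H: "joint_cdf \<gamma>0 s t = min (cdf \<mu> s) (cdf \<nu> t)" for s t
    using \<gamma>0 by (auto simp: comonotone_def couplings_def)
  have le: "joint_cdf \<gamma> s t \<le> joint_cdf \<gamma>0 s t" for s t
    using G.joint_cdf_le by (simp add: H)
  have dens: "cost_density \<gamma>0 p \<le> cost_density \<gamma> p" for p
    using le by (cases p) (simp add: G.cost_density_eq H.cost_density_eq add_mono)
  show "transport_cost \<gamma>0 \<le> transport_cost \<gamma>"
    unfolding G.has_bochner_integral_cost_density(2) H.has_bochner_integral_cost_density(2)
    by (intro integral_mono dens G.has_bochner_integral_cost_density H.has_bochner_integral_cost_density)
  assume eq: "transport_cost \<gamma> = transport_cost \<gamma>0"
  have "(\<integral>p. cost_density \<gamma> p - cost_density \<gamma>0 p \<partial>lborel) = 0"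
    using eq G.has_bochner_integral_cost_density H.has_bochner_integral_cost_density by simp
  then have AE: "AE p in lborel. cost_density \<gamma> p - cost_density \<gamma>0 p = 0"
    using dens G.has_bochner_integral_cost_density(1) H.has_bochner_integral_cost_density(1)
    by (subst (asm) integral_nonneg_eq_0_iff_AE) auto
  have "joint_cdf \<gamma> s t = joint_cdf \<gamma>0 s t" for s t
  proof (rule ccontr)
    assume "\<not> ?thesis"
    then have less: "joint_cdf \<gamma> s t < joint_cdf \<gamma>0 s t" using le[of s t] by simp
    \<comment> \<open>Half the deficit: two marginal increments, each below \<epsilon>, cannot use
      it up.\<close>
    define \<epsilon> where "\<epsilon> = (joint_cdf \<gamma>0 s t - joint_cdf \<gamma> s t) / 2"
    have \<epsilon>: "0 < \<epsilon>" using less by (simp add: \<epsilon>_def)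
    have "\<forall>\<^sub>F x in at_right s. cdf \<mu> x < cdf \<mu> s + \<epsilon>"
      using M.cdf_is_right_cont[of s] \<epsilon>
      by (auto simp: continuous_within intro!: order_tendstoD(2)[of "cdf \<mu>"])
    then obtain b where b: "s < b" "\<And>x. s < x \<Longrightarrow> x < b \<Longrightarrow> cdf \<mu> x < cdf \<mu> s + \<epsilon>"
      by (auto simp: eventually_at_right_field)
    have "\<forall>\<^sub>F x in at_right t. cdf \<nu> x < cdf \<nu> t + \<epsilon>"
      using N.cdf_is_right_cont[of t] \<epsilon>
      by (auto simp: continuous_within intro!: order_tendstoD(2)[of "cdf \<nu>"])
    then obtain c where c: "t < c" "\<And>x. t < x \<Longrightarrow> x < c \<Longrightarrow> cdf \<nu> x < cdf \<nu> t + \<epsilon>"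
      by (auto simp: eventually_at_right_field)
    have neq: "cost_density \<gamma> p - cost_density \<gamma>0 p \<noteq> 0" if p: "p \<in> box (s, t) (b, c)" for p
    proof -
      obtain s' t' where p': "p = (s', t')" by (cases p)
      have box: "s < s'" "s' < b" "t < t'" "t' < c"
        using p by (auto simp: p' box_def Basis_prod_def inner_prod_def)
      have "joint_cdf \<gamma> s' t' \<le> joint_cdf \<gamma> s t + (cdf \<mu> s' - cdf \<mu> s) + (cdf \<nu> t' - cdf \<nu> t)"
        using box by (intro G.joint_cdf_increment) auto
      also have "\<dots> < joint_cdf \<gamma>0 s t"
        using b(2)[OF box(1,2)] c(2)[OF box(3,4)] unfolding \<epsilon>_def by (simp add: field_simps)
      also have "\<dots> \<le> joint_cdf \<gamma>0 s' t'"
        using M.cdf_nondecreasing[of s s'] N.cdf_nondecreasing[of t t'] box unfolding H by auto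
      finally have "joint_cdf \<gamma> s' t' < joint_cdf \<gamma>0 s' t'" .
      \<comment> \<open>The point (s', t') is seen by the first summand of the density if s' \<le>
        t' and by the second otherwise; that summand is strictly larger, and the other one is not
        smaller.\<close>
      then show ?thesis
        using le[of "min s' t'" "max s' t'"] le[of "max s' t'" "min s' t'"]
        by (cases "s' \<le> t'") (auto simp: p' G.cost_density_eq H.cost_density_eq min_def max_def)
    qed
    have "AE p in lborel. p \<notin> box (s, t) (b, c)"
      using AE by eventually_elim (use neq in blast)
    then have "emeasure lborel (box (s, t) (b, c)) = 0"
      by (subst (asm) AE_iff_measurable[of "box (s, t) (b, c)"]) auto
    moreover have "emeasure lborel (box (s, t) (b, c)) = ennreal ((b - s) * (c - t))"
      using b(1) c(1)
      by (subst emeasure_lborel_box) (auto simp: Basis_prod_def inner_prod_def prod.union_disjoint)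
    ultimately show False using b(1) c(1) by (simp add: ennreal_eq_0_iff mult_le_0_iff)
  qed
  then show "\<gamma> = \<gamma>0"
    by (intro joint_cdf_eqI G.prob_space_axioms H.prob_space_axioms G.sets_coupling H.sets_coupling)
qed

lemma measurable_mono_unit:
  "mono_on {0<..<1} f \<Longrightarrow> f \<in> borel_measurable unit_lborel" for f :: "real \<Rightarrow> real"
  using borel_measurable_mono_on_fnc[of "{0<..<1}" f]
  by (simp add: measurable_cong_sets[OF sets_restrict_space_cong[OF sets_lborel] refl])

text \<open>Sublevel sets of increasing functions are initial pieces of the interval, so one of the
  two contains the other and the intersection has the smaller probability.\<close>

lemma comonotone_distr:
  assumes f: "mono_on {0<..<1} f" and g: "mono_on {0<..<1} g"
  shows "comonotone (distr unit_lborel borel (\<lambda>u. (f u, g u)))"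
  unfolding comonotone_def
proof (intro allI)
  fix s t
  let ?P = unit_lborel
  interpret prob_space ?P by (rule prob_space_unit_lborel)
  note [measurable] = f[THEN measurable_mono_unit] g[THEN measurable_mono_unit]
  let ?A = "{u \<in> {0<..<1}. f u \<le> s}" and ?B = "{u \<in> {0<..<1}. g u \<le> t}"
  have A: "cdf (distr ?P borel f) s = prob ?A" "?A \<in> events"
    and B: "cdf (distr ?P borel g) t = prob ?B" "?B \<in> events"
    and AB: "joint_cdf (distr ?P borel (\<lambda>u. (f u, g u))) s t = prob (?A \<inter> ?B)"
  proof -
    have eq: "f -` {..s} \<inter> space ?P = ?A" "g -` {..t} \<inter> space ?P = ?B"
      "(\<lambda>u. (f u, g u)) -` {z. fst z \<le> s \<and> snd z \<le> t} \<inter> space ?P = ?A \<inter> ?B"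
      by (auto simp: space_restrict_space)
    show "cdf (distr ?P borel f) s = prob ?A" "cdf (distr ?P borel g) t = prob ?B"
      "joint_cdf (distr ?P borel (\<lambda>u. (f u, g u))) s t = prob (?A \<inter> ?B)"
      unfolding cdf_def joint_cdf_def by (subst measure_distr; (simp only: eq | measurable | simp))+
    have "f -` {..s} \<inter> space ?P \<in> events" "g -` {..t} \<inter> space ?P \<in> events" by measurable
    then show "?A \<in> events" "?B \<in> events" by (simp_all only: eq)
  qed
  have "?A \<subseteq> ?B \<or> ?B \<subseteq> ?A"
  proof (rule ccontr)
    assume "\<not> ?thesis"
    then obtain u v where "u \<in> ?A" "u \<notin> ?B" "v \<in> ?B" "v \<notin> ?A" by blast
    then show False
      using mono_onD[OF f, of u v] mono_onD[OF f, of v u] mono_onD[OF g, of u v] mono_onD[OF g, of v u]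
      by (cases "u \<le> v") auto
  qed
  then have "prob (?A \<inter> ?B) = min (prob ?A) (prob ?B)"
  proof
    assume "?A \<subseteq> ?B"
    then show ?thesis using finite_measure_mono[OF _ B(2)] by (simp only: Int_absorb2 min_absorb1)
  next
    assume "?B \<subseteq> ?A"
    then show ?thesis using finite_measure_mono[OF _ A(2)] by (simp only: Int_absorb1 min_absorb2)
  qed
  then show "joint_cdf (distr ?P borel (\<lambda>u. (f u, g u))) s t =
      min (cdf (distr (distr ?P borel (\<lambda>u. (f u, g u))) borel fst) s)
          (cdf (distr (distr ?P borel (\<lambda>u. (f u, g u))) borel snd) t)"
    by (simp add: distr_distr comp_def A B AB)
qed

section \<open>Quantile functions\<close>

lemma P2_cdf_distribution: "\<mu> \<in> P2 \<Longrightarrow> cdf_distribution \<mu>"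
  by (simp add: cdf_distribution_def real_distribution_def real_distribution_axioms_def
      P2_prob_space P2_sets P2_space)

text \<open>The Galois connection from which monotonicity, measurability and the right inverse
  property \<open>cdf_quantile\<close> are drawn.\<close>

lemma quantile_le_iff:
  assumes "\<mu> \<in> P2" "0 < u" "u < 1"
  shows "quantile \<mu> u \<le> x \<longleftrightarrow> u \<le> cdf \<mu> x"
proof -
  interpret cdf_distribution \<mu> by (rule P2_cdf_distribution[OF assms(1)])
  show ?thesis unfolding quantile_def by (rule pseudoinverse[OF assms(2,3), symmetric])
qed

lemma mono_on_quantile:
  assumes "\<mu> \<in> P2"
  shows "mono_on {0<..<1} (quantile \<mu>)"
proof (rule mono_onI)
  fix r s :: real assume rs: "r \<in> {0<..<1}" "s \<in> {0<..<1}" "r \<le> s"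
  then have "s \<le> cdf \<mu> (quantile \<mu> s)"
    using quantile_le_iff[OF assms, of s "quantile \<mu> s"] by simp
  with rs show "quantile \<mu> r \<le> quantile \<mu> s"
    using quantile_le_iff[OF assms, of r "quantile \<mu> s"] by simp
qed

lemma distr_quantile:
  assumes "\<mu> \<in> P2"
  shows "distr unit_lborel borel (quantile \<mu>) = \<mu>"
proof -
  interpret cdf_distribution \<mu> by (rule P2_cdf_distribution[OF assms])
  show ?thesis using distr_I_eq_M by (simp add: quantile_def[abs_def])
qed

text \<open>Measurability is wanted on the whole line because quantiles get composed with
  distribution functions, which may take the values 0 and 1. Outside the open unit interval the
  function is constant on either side, up to the single point 1.\<close>

lemma measurable_quantile:
  assumes "\<mu> \<in> P2"
  shows "quantile \<mu> \<in> borel_measurable borel"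
proof (rule borel_measurableI_le)
  fix x
  interpret cdf_distribution \<mu> by (rule P2_cdf_distribution[OF assms])
  have low: "quantile \<mu> u = Inf UNIV" if "u \<le> 0" for u
    using that order_trans[OF _ cdf_nonneg] by (auto simp: quantile_def intro!: arg_cong[where f = Inf])
  have high: "quantile \<mu> u = Inf {}" if "1 < u" for u
  proof -
    have "\<not> u \<le> cdf \<mu> y" for y using cdf_bounded_prob[of y] that by linarith
    then show ?thesis by (simp add: quantile_def)
  qed
  have "{u \<in> space borel. quantile \<mu> u \<le> x} =
      {u \<in> {..0}. Inf UNIV \<le> x} \<union> {u \<in> {0<..<1}. u \<le> cdf \<mu> x} \<union>
      {u \<in> {1}. quantile \<mu> 1 \<le> x} \<union> {u \<in> {1<..}. Inf {} \<le> x}" (is "?L = ?R")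
  proof (rule set_eqI)
    fix u :: real
    consider "u \<le> 0" | "0 < u" "u < 1" | "u = 1" | "1 < u" by linarith
    then show "u \<in> ?L \<longleftrightarrow> u \<in> ?R"
      by cases (simp_all add: low high quantile_le_iff[OF assms])
  qed
  then show "{u \<in> space borel. quantile \<mu> u \<le> x} \<in> sets borel" by simp
qed

lemma integrable_quantile_sq:
  assumes "\<mu> \<in> P2"
  shows "integrable unit_lborel (\<lambda>u. (norm (quantile \<mu> u))\<^sup>2)"
  using P2_integrable[OF assms] mono_on_quantile[OF assms, THEN measurable_mono_unit]
  by (subst (asm) distr_quantile[OF assms, symmetric], subst (asm) integrable_distr_eq) auto

lemma mono_on_mix:
  fixes q :: "'n::finite \<Rightarrow> real \<Rightarrow> real"
  assumes "convex_vector v" "\<And>j. mono_on A (q j)"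
  shows "mono_on A (mix q v)"
  using assms unfolding mix_def convex_vector_def
  by (auto intro!: mono_onI sum_mono mult_left_mono dest: mono_onD)

text \<open>Nonnegative weights keep mixtures of increasing functions increasing, so the joint law
  of any two mixtures is comonotone.\<close>

lemma quantiles_optimally_coupled:
  assumes P2: "\<And>j :: 'n::finite. \<mu> j \<in> P2"
  shows "optimally_coupled unit_lborel (\<lambda>j. quantile (\<mu> j))"
proof -
  interpret prob_space unit_lborel by (rule prob_space_unit_lborel)
  let ?q = "\<lambda>j. quantile (\<mu> j)"
  have mono: "mono_on {0<..<1} (mix ?q v)" if "convex_vector v" for v
    using that mono_on_quantile[OF P2] by (rule mono_on_mix)
  have q[measurable]: "?q j \<in> borel_measurable unit_lborel" for j
    using mono_on_quantile[OF P2] by (rule measurable_mono_unit)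
  note mix = mono[THEN measurable_mono_unit]
  have sq: "integrable unit_lborel (\<lambda>u. (norm (mix ?q v u))\<^sup>2)" for v
    by (intro integrable_mix_sq q integrable_quantile_sq P2)
  note law = distr_in_P2[OF prob_space_axioms mix sq]
  have opt: "(\<integral>u. (norm (mix ?q v u - mix ?q w u))\<^sup>2 \<partial>unit_lborel) \<le> transport_cost \<gamma>"
    "transport_cost \<gamma> = (\<integral>u. (norm (mix ?q v u - mix ?q w u))\<^sup>2 \<partial>unit_lborel) \<Longrightarrow>
      \<gamma> = distr unit_lborel borel (\<lambda>u. (mix ?q v u, mix ?q w u))"
    if v: "convex_vector v" and w: "convex_vector w"
      and \<gamma>: "\<gamma> \<in> couplings (distr unit_lborel borel (mix ?q v)) (distr unit_lborel borel (mix ?q w))" for v w \<gamma>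
    using comonotone_optimal[OF law[OF v] law[OF w] \<gamma> coupling_distr_pair[OF mix[OF v] mix[OF w]]
        comonotone_distr[OF mono[OF v] mono[OF w]]]
    unfolding transport_cost_distr_pair[OF mix[OF v] mix[OF w]] by blast+
  show ?thesis
  proof (unfold_locales, goal_cases)
    case (1 j)
    show ?case by (rule q)
  next
    case (2 j)
    show ?case by (rule integrable_quantile_sq[OF P2])
  next
    case (3 v w \<gamma>)
    show ?case using 3 by (rule opt(1))
  next
    case (4 v w \<gamma>)
    show ?case using 4 by (rule opt(2))
  qed
qed

text \<open>The quantile map is an isometry into L2 of the unit interval, which turns the barycenter
  problem into a pointwise one.\<close>

lemma W2_line:
  assumes "\<mu> \<in> P2" "\<nu> \<in> P2"
  shows "(W2 \<mu> \<nu>)\<^sup>2 = (\<integral>u. (quantile \<mu> u - quantile \<nu> u)\<^sup>2 \<partial>unit_lborel)"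
proof -
  note m = mono_on_quantile[OF assms(1)] mono_on_quantile[OF assms(2)]
  note mm = m[THEN measurable_mono_unit]
  let ?\<gamma> = "distr unit_lborel borel (\<lambda>u. (quantile \<mu> u, quantile \<nu> u))"
  have c: "?\<gamma> \<in> couplings \<mu> \<nu>"
    using coupling_distr_pair[OF mm] by (simp add: distr_quantile assms)
  have "(W2 \<mu> \<nu>)\<^sup>2 = transport_cost ?\<gamma>"
    using comonotone_optimal(1)[OF assms _ c comonotone_distr[OF m]] c
    by (intro antisym W2_sq_le W2_sq_ge) auto
  then show ?thesis by (simp add: transport_cost_distr_pair[OF mm])
qed

text \<open>Steiner's identity for the weighted mean.\<close>

lemma sum_squares_about_mean:
  fixes x :: real and y :: "'n::finite \<Rightarrow> real"
  assumes "convex_vector lam"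
  defines "m \<equiv> \<Sum>j\<in>UNIV. lam $ j * y j"
  shows "(\<Sum>j\<in>UNIV. lam $ j * (x - y j)\<^sup>2) = (x - m)\<^sup>2 + (\<Sum>j\<in>UNIV. lam $ j * (m - y j)\<^sup>2)"
proof -
  have l: "(\<Sum>j\<in>UNIV. lam $ j) = 1" using assms by (simp add: convex_vector_def)
  have E: "(\<Sum>j\<in>UNIV. lam $ j * (z - y j)\<^sup>2) = z\<^sup>2 - 2 * z * m + (\<Sum>j\<in>UNIV. lam $ j * (y j)\<^sup>2)" for z
  proof -
    have "(\<Sum>j\<in>UNIV. lam $ j * (z - y j)\<^sup>2)
        = (\<Sum>j\<in>UNIV. lam $ j * z\<^sup>2 - 2 * z * (lam $ j * y j) + lam $ j * (y j)\<^sup>2)"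
      by (intro sum.cong) (auto simp: power2_eq_square algebra_simps)
    also have "\<dots> = (\<Sum>j\<in>UNIV. lam $ j) * z\<^sup>2 - 2 * z * m + (\<Sum>j\<in>UNIV. lam $ j * (y j)\<^sup>2)"
      by (simp add: sum.distrib sum_subtractf sum_distrib_left[symmetric] sum_distrib_right[symmetric] m_def)
    finally show ?thesis by (simp add: l)
  qed
  show ?thesis unfolding E[of x] E[of m] by (simp add: power2_eq_square algebra_simps)
qed

text \<open>Integrating Steiner's identity shows that the objective at \<nu> exceeds its value
  \<open>c\<close> at the mixture by the squared L2 distance of the quantile of \<nu> from the
  mixture. Zero excess identifies the quantile function almost everywhere, and with it
  \<nu>.\<close>

lemma line_barycenter:
  fixes \<mu> :: "'n::finite \<Rightarrow> real measure"
  assumes P2: "\<And>j. \<mu> j \<in> P2" and lam: "convex_vector lam"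
  shows "wasserstein_barycenter lam \<mu> (distr unit_lborel borel (mix (\<lambda>j. quantile (\<mu> j)) lam))"
proof -
  let ?q = "\<lambda>j. quantile (\<mu> j)"
  interpret optimally_coupled unit_lborel ?q by (rule quantiles_optimally_coupled[OF P2])
  define c where "c = (\<Sum>j\<in>UNIV. lam $ j * (\<integral>u. (mix ?q lam u - ?q j u)\<^sup>2 \<partial>unit_lborel))"
  have mix_sq: "integrable unit_lborel (\<lambda>u. (mix ?q lam u - ?q j u)\<^sup>2)" for j
    using integrable_diff_sq[OF measurable_mix measurable_q integrable_mix integrable_q, of lam j] by simp
  have law_axis: "law (axis j 1) = \<mu> j" for j
    by (simp add: law_def mix_axis distr_quantile P2)
  have at_law: "(\<Sum>j\<in>UNIV. lam $ j * (W2 (law lam) (\<mu> j))\<^sup>2) = c"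
    using W2_law_sq[OF lam convex_vector_axis] by (simp add: c_def law_axis mix_axis)
  have excess: "(\<Sum>j\<in>UNIV. lam $ j * (W2 \<nu> (\<mu> j))\<^sup>2) = (\<integral>u. (quantile \<nu> u - mix ?q lam u)\<^sup>2 \<partial>unit_lborel) + c"
    and int: "integrable unit_lborel (\<lambda>u. (quantile \<nu> u - mix ?q lam u)\<^sup>2)"
    if \<nu>: "\<nu> \<in> P2" for \<nu>
  proof -
    have [measurable]: "quantile \<nu> \<in> borel_measurable unit_lborel"
      using mono_on_quantile[OF \<nu>] by (rule measurable_mono_unit)
    have i: "integrable unit_lborel (\<lambda>u. (quantile \<nu> u - ?q j u)\<^sup>2)" for j
      using integrable_diff_sq[OF _ measurable_q integrable_quantile_sq[OF \<nu>] integrable_q, of j] by simp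
    show i': "integrable unit_lborel (\<lambda>u. (quantile \<nu> u - mix ?q lam u)\<^sup>2)"
      using integrable_diff_sq[OF _ measurable_mix integrable_quantile_sq[OF \<nu>] integrable_mix, of lam] by simp
    have "(\<Sum>j\<in>UNIV. lam $ j * (W2 \<nu> (\<mu> j))\<^sup>2) = (\<integral>u. (\<Sum>j\<in>UNIV. lam $ j * (quantile \<nu> u - ?q j u)\<^sup>2) \<partial>unit_lborel)"
      using i by (simp add: W2_line \<nu> P2)
    also have "\<dots> = (\<integral>u. (quantile \<nu> u - mix ?q lam u)\<^sup>2 + (\<Sum>j\<in>UNIV. lam $ j * (mix ?q lam u - ?q j u)\<^sup>2) \<partial>unit_lborel)"
      unfolding mix_def real_scaleR_def
      by (intro Bochner_Integration.integral_cong refl sum_squares_about_mean[OF lam])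
    also have "\<dots> = (\<integral>u. (quantile \<nu> u - mix ?q lam u)\<^sup>2 \<partial>unit_lborel) + c"
      using i' mix_sq by (simp add: c_def)
    finally show "(\<Sum>j\<in>UNIV. lam $ j * (W2 \<nu> (\<mu> j))\<^sup>2) = (\<integral>u. (quantile \<nu> u - mix ?q lam u)\<^sup>2 \<partial>unit_lborel) + c" .
  qed
  have uniq: "\<nu> = law lam" if \<nu>: "\<nu> \<in> P2" and le: "(\<Sum>j\<in>UNIV. lam $ j * (W2 \<nu> (\<mu> j))\<^sup>2) \<le> c" for \<nu>
  proof -
    have [measurable]: "quantile \<nu> \<in> borel_measurable unit_lborel"
      using mono_on_quantile[OF \<nu>] by (rule measurable_mono_unit)
    have "(\<integral>u. (quantile \<nu> u - mix ?q lam u)\<^sup>2 \<partial>unit_lborel) = 0"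
      using le excess[OF \<nu>] by (intro antisym) auto
    then have "AE u in unit_lborel. (quantile \<nu> u - mix ?q lam u)\<^sup>2 = 0"
      using int[OF \<nu>] by (subst (asm) integral_nonneg_eq_0_iff_AE) auto
    then have "AE u in unit_lborel. quantile \<nu> u = mix ?q lam u" by eventually_elim simp
    then have "distr unit_lborel borel (quantile \<nu>) = law lam"
      unfolding law_def by (intro distr_cong_AE) auto
    then show ?thesis by (simp add: distr_quantile \<nu>)
  qed
  have lower: "c \<le> (\<Sum>j\<in>UNIV. lam $ j * (W2 \<nu> (\<mu> j))\<^sup>2)" if "\<nu> \<in> P2" for \<nu>
    using excess[OF that] by simp
  have "wasserstein_barycenter lam \<mu> (law lam)"
    unfolding wasserstein_barycenter_def is_arg_min_def
    using at_law lower uniq law_P2 by (auto simp: not_less)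
  then show ?thesis by (simp add: law_def)
qed

lemma distr_closed_unit:
  assumes [measurable]: "h \<in> borel_measurable borel"
  shows "distr (restrict_space lborel {0..1::real}) borel h = distr unit_lborel borel h"
proof (rule measure_eqI)
  fix A assume "A \<in> sets (distr (restrict_space lborel {0..1}) borel h)"
  then have [measurable]: "A \<in> sets borel" by simp
  have "AE x in lborel. x \<in> h -` A \<inter> {0..1} \<longleftrightarrow> x \<in> h -` A \<inter> {0<..<1}"
    using AE_lborel_singleton[of 0] AE_lborel_singleton[of 1] by eventually_elim auto
  then have "emeasure lborel (h -` A \<inter> {0..1}) = emeasure lborel (h -` A \<inter> {0<..<1})"
    by (intro emeasure_eq_AE) (auto simp: measurable_sets_borel)
  moreover have "h \<in> borel_measurable (restrict_space lborel S)" for S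
    by (intro measurable_restrict_space1) simp
  ultimately show "emeasure (distr (restrict_space lborel {0..1}) borel h) A = emeasure (distr unit_lborel borel h) A"
    by (simp add: emeasure_distr emeasure_restrict_space space_restrict_space Int_commute[of "vimage _ _"] Int_absorb1)
qed simp

lemma continuous_initial_P2: "continuous_initial \<mu> \<Longrightarrow> \<mu> j \<in> P2"
  by (simp add: continuous_initial_def)

text \<open>Left of the quantile the distribution function stays at or below u, and it does not jump
  there because absolute continuity excludes atoms.\<close>

lemma cdf_quantile:
  assumes "\<mu> \<in> P2" "absolutely_continuous lborel \<mu>" "0 < u" "u < 1"
  shows "cdf \<mu> (quantile \<mu> u) = u"
proof (rule antisym)
  interpret cdf_distribution \<mu> by (rule P2_cdf_distribution[OF assms(1)])
  show "u \<le> cdf \<mu> (quantile \<mu> u)"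
    using quantile_le_iff[OF assms(1,3,4), of "quantile \<mu> u"] by simp
  have "emeasure \<mu> {quantile \<mu> u} = 0"
  proof -
    have "{quantile \<mu> u} \<in> null_sets lborel" by (simp add: null_sets_def)
    with assms(2) show ?thesis by (auto simp: absolutely_continuous_def)
  qed
  then have "isCont (cdf \<mu>) (quantile \<mu> u)"
    by (simp add: isCont_cdf measure_def)
  then have "(cdf \<mu> \<longlongrightarrow> cdf \<mu> (quantile \<mu> u)) (at_left (quantile \<mu> u))"
    by (simp add: isCont_def filterlim_at_split)
  moreover have "\<forall>\<^sub>F x in at_left (quantile \<mu> u). cdf \<mu> x \<le> u"
    using quantile_le_iff[OF assms(1,3,4)]
    by (auto simp: eventually_at_left_field intro!: exI[of _ "quantile \<mu> u - 1"]) (meson not_le nle_le)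
  ultimately show "cdf \<mu> (quantile \<mu> u) \<le> u"
    by (intro tendsto_upperbound) auto
qed

text \<open>Each initial measure is the law of its own quantile function, and following that
  function by the distribution function gives back u.\<close>

lemma line_quantile_average:
  assumes "continuous_initial \<mu>"
  shows "quantile_average lam \<mu> (distr unit_lborel borel (mix (\<lambda>j. quantile (\<mu> j)) lam))"
proof -
  note P2 = continuous_initial_P2[OF assms]
  let ?h = "\<lambda>u. \<Sum>j\<in>UNIV. lam $ j * quantile (\<mu> j) u"
  have h[measurable]: "?h \<in> borel_measurable borel"
    by (intro borel_measurable_sum borel_measurable_times borel_measurable_const measurable_quantile P2)
  have mix: "mix (\<lambda>j. quantile (\<mu> j)) lam = ?h" by (simp add: mix_def fun_eq_iff)
  have "distr (\<mu> i) borel (\<lambda>x. ?h (cdf (\<mu> i) x)) = distr unit_lborel borel ?h" for i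
  proof -
    interpret cdf_distribution "\<mu> i" by (rule P2_cdf_distribution[OF P2])
    have q: "quantile (\<mu> i) \<in> borel_measurable unit_lborel"
      using mono_on_quantile[OF P2] by (rule measurable_mono_unit)
    have [measurable]: "cdf (\<mu> i) \<in> borel_measurable borel" by (rule measurable_C)
    have "distr (\<mu> i) borel (\<lambda>x. ?h (cdf (\<mu> i) x)) =
        distr (distr unit_lborel borel (quantile (\<mu> i))) borel (\<lambda>x. ?h (cdf (\<mu> i) x))"
      by (simp only: distr_quantile[OF P2])
    also have "\<dots> = distr unit_lborel borel ((\<lambda>x. ?h (cdf (\<mu> i) x)) \<circ> quantile (\<mu> i))"
      by (intro distr_distr q measurable_compose[OF _ h]) measurable
    also have "\<dots> = distr unit_lborel borel ?h"
      using assms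
      by (intro distr_cong) (auto simp: space_restrict_space cdf_quantile P2 continuous_initial_def)
    finally show ?thesis .
  qed
  then show ?thesis
    unfolding quantile_average_def mix comp_def by (simp add: distr_closed_unit[OF h])
qed

section \<open>Gaussian measures with simultaneously diagonalisable covariances\<close>

lemma measure_closed_le_of_couplings:
  fixes \<mu> \<nu> :: "'a::euclidean_space measure"
  assumes P2: "\<mu> \<in> P2" "\<nu> \<in> P2"
    and small: "\<And>\<epsilon>. 0 < \<epsilon> \<Longrightarrow> \<exists>\<gamma>\<in>couplings \<mu> \<nu>. transport_cost \<gamma> < \<epsilon>"
    and C: "closed C"
  shows "measure \<mu> C \<le> measure \<nu> C"
\<comment> \<open>\<open>infdist\<close> to the empty set is 0 by convention, so neighbourhoods of
  the empty set would be the whole space.\<close>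
proof (cases "C = {}")
  case False
  interpret M: prob_space \<mu> using P2 by (simp add: P2_prob_space)
  interpret N: prob_space \<nu> using P2 by (simp add: P2_prob_space)
  have [measurable_cong]: "sets \<mu> = sets borel" "sets \<nu> = sets borel" using P2 by (simp_all add: P2_sets)
  define D where "D \<delta> = {y. infdist y C \<le> \<delta>}" for \<delta> :: real
  have D_closed: "closed (D \<delta>)" for \<delta>
    unfolding D_def by (intro closed_Collect_le continuous_intros)
  have C_meas: "C \<in> sets borel" using C by simp
  have D_meas: "D \<delta> \<in> sets borel" for \<delta> using D_closed by simp
  have nbhd: "measure \<mu> C \<le> measure \<nu> (D \<delta>)" if \<delta>: "0 < \<delta>" for \<delta>
  proof (rule field_le_epsilon)
    fix \<epsilon> :: real assume \<epsilon>: "0 < \<epsilon>"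
    \<comment> \<open>With this bound on the cost, Markov's inequality limits the probability of a
      displacement of at least \<delta> to \<epsilon>.\<close>
    then obtain \<gamma> where \<gamma>: "\<gamma> \<in> couplings \<mu> \<nu>" "transport_cost \<gamma> < \<epsilon> * \<delta>\<^sup>2"
      using small[of "\<epsilon> * \<delta>\<^sup>2"] \<delta> by auto
    interpret G: prob_space \<gamma> using coupling_prob_space[OF \<gamma>(1)] P2 by (simp add: P2_prob_space)
    note [measurable] = coupling_measurable[OF \<gamma>(1)] C_meas D_meas
    have sp: "space \<gamma> = UNIV" using coupling_space[OF \<gamma>(1)] .
    have eq: "\<mu> = distr \<gamma> borel fst" "\<nu> = distr \<gamma> borel snd" using \<gamma> by (auto simp: couplings_def)
    have marg: "measure \<mu> C = G.prob (fst -` C)" "measure \<nu> (D \<delta>) = G.prob (snd -` D \<delta>)"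
      unfolding eq by (simp_all add: measure_distr sp)
    have m1: "snd -` D \<delta> \<in> G.events"
      using measurable_sets[OF coupling_measurable(2)[OF \<gamma>(1)] D_meas] by (simp add: sp)
    let ?B = "{z \<in> space \<gamma>. \<delta>\<^sup>2 \<le> (norm (fst z - snd z))\<^sup>2}"
    have B: "?B \<in> G.events" by measurable
    have sub: "fst -` C \<subseteq> snd -` D \<delta> \<union> ?B"
    proof
      fix z :: "'a \<times> 'a" assume "z \<in> fst -` C"
      then have "infdist (snd z) C \<le> norm (fst z - snd z)"
        by (auto intro: infdist_le2[of "fst z"] simp: dist_norm norm_minus_commute)
      then show "z \<in> snd -` D \<delta> \<union> ?B"
        using \<delta> by (cases "\<delta> \<le> norm (fst z - snd z)") (auto simp: D_def sp power_mono)
    qed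
    have "measure \<mu> C \<le> G.prob (snd -` D \<delta> \<union> ?B)"
      unfolding marg by (intro G.finite_measure_mono sub sets.Un m1 B)
    also have "\<dots> \<le> measure \<nu> (D \<delta>) + G.prob ?B"
      unfolding marg by (intro measure_Un_le m1 B)
    also have "G.prob ?B \<le> transport_cost \<gamma> / \<delta>\<^sup>2"
      unfolding transport_cost_def
      using \<delta> coupling_integrable_cost[OF \<gamma>(1) P2]
      by (intro integral_Markov_inequality_measure[of _ _ "{}"]) auto
    also have "\<dots> \<le> \<epsilon>"
      using \<gamma>(2) \<delta> by (simp add: pos_divide_le_eq)
    finally show "measure \<mu> C \<le> measure \<nu> (D \<delta>) + \<epsilon>" by simp
  qed
  have "(\<lambda>n. measure \<nu> (D (inverse (real (Suc n))))) \<longlonglongrightarrow> measure \<nu> (\<Inter>n. D (inverse (real (Suc n))))"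
  proof (rule N.finite_Lim_measure_decseq)
    show "decseq (\<lambda>n. D (inverse (real (Suc n))))"
    proof (rule decseq_SucI)
      fix n
      have "inverse (real (Suc (Suc n))) \<le> inverse (real (Suc n))" by (intro le_imp_inverse_le) auto
      then show "D (inverse (real (Suc (Suc n)))) \<subseteq> D (inverse (real (Suc n)))"
        by (auto simp: D_def simp del: of_nat_Suc intro: order_trans)
    qed
  qed (use D_meas P2 in \<open>auto simp: P2_sets\<close>)
  moreover have "(\<Inter>n. D (inverse (real (Suc n)))) = C"
  proof
    show "(\<Inter>n. D (inverse (real (Suc n)))) \<subseteq> C"
    proof
      fix y assume y: "y \<in> (\<Inter>n. D (inverse (real (Suc n))))"
      have "infdist y C \<le> 0"
      proof (rule LIMSEQ_le_const[OF LIMSEQ_inverse_real_of_nat])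
        show "\<exists>N. \<forall>n\<ge>N. infdist y C \<le> inverse (real (Suc n))" using y by (auto simp: D_def)
      qed
      then have "infdist y C = 0" using infdist_nonneg[of y C] by simp
      then show "y \<in> C" using in_closed_iff_infdist_zero[OF C False] by simp
    qed
    show "C \<subseteq> (\<Inter>n. D (inverse (real (Suc n))))" by (auto simp: D_def)
  qed
  ultimately have "(\<lambda>n. measure \<nu> (D (inverse (real (Suc n))))) \<longlonglongrightarrow> measure \<nu> C" by simp
  then show ?thesis
    by (rule LIMSEQ_le_const) (use nbhd in auto)
qed simp

lemma coupling_swap:
  assumes "\<gamma> \<in> couplings \<mu> \<nu>"
  shows "distr \<gamma> borel (\<lambda>z. (snd z, fst z)) \<in> couplings \<nu> \<mu>"
    and "transport_cost (distr \<gamma> borel (\<lambda>z. (snd z, fst z))) = transport_cost \<gamma>"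
proof -
  note [measurable] = coupling_measurable[OF assms]
  show "distr \<gamma> borel (\<lambda>z. (snd z, fst z)) \<in> couplings \<nu> \<mu>"
    using coupling_distr_pair[of snd \<gamma> fst] assms by (simp add: couplings_def)
  show "transport_cost (distr \<gamma> borel (\<lambda>z. (snd z, fst z))) = transport_cost \<gamma>"
    by (simp add: transport_cost_def integral_distr norm_minus_commute)
qed

text \<open>Swapping couplings gives equality on closed sets, which are closed under intersection
  and generate the Borel sets.\<close>

lemma eq_of_small_couplings:
  fixes \<mu> \<nu> :: "'a::euclidean_space measure"
  assumes P2: "\<mu> \<in> P2" "\<nu> \<in> P2"
    and small: "\<And>\<epsilon>. 0 < \<epsilon> \<Longrightarrow> \<exists>\<gamma>\<in>couplings \<mu> \<nu>. transport_cost \<gamma> < \<epsilon>"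
  shows "\<mu> = \<nu>"
proof -
  interpret M: prob_space \<mu> using P2 by (simp add: P2_prob_space)
  interpret N: prob_space \<nu> using P2 by (simp add: P2_prob_space)
  have "\<And>\<epsilon>. 0 < \<epsilon> \<Longrightarrow> \<exists>\<gamma>\<in>couplings \<nu> \<mu>. transport_cost \<gamma> < \<epsilon>"
    using small coupling_swap by metis
  then have eq: "measure \<mu> C = measure \<nu> C" if "closed C" for C
    using measure_closed_le_of_couplings P2 small that by (metis antisym)
  have closed: "sets borel = sigma_sets UNIV (Collect closed :: 'a set set)"
    unfolding borel_eq_closed by (rule sets_measure_of) simp
  show ?thesis
  proof (rule measure_eqI_generator_eq[where \<Omega> = UNIV and E = "Collect closed" and A = "\<lambda>_. UNIV"])
    show "Int_stable (Collect closed)" by (auto simp: Int_stable_def)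
    show "\<And>X. X \<in> Collect closed \<Longrightarrow> emeasure \<mu> X = emeasure \<nu> X"
      using eq by (simp add: M.emeasure_eq_measure N.emeasure_eq_measure)
  qed (auto simp: closed P2_sets P2 M.emeasure_eq_measure)
qed

text \<open>The common probability space of the Gaussian case, with a density free of
  \<open>matrix_inv\<close> and \<open>det\<close>.\<close>

definition std_gaussian :: "(real ^ 'd) measure" where
  "std_gaussian = density lborel (\<lambda>x. ennreal (exp (- (x \<bullet> x) / 2) / sqrt ((2 * pi) ^ CARD('d))))"

text \<open>Independence of the coordinates: integrals reduce to products of one-dimensional
  ones.\<close>

lemma std_gaussian_density:
  fixes x :: "real ^ 'd"
  shows "exp (- (x \<bullet> x) / 2) / sqrt ((2 * pi) ^ CARD('d)) = (\<Prod>b\<in>Basis. std_normal_density (x \<bullet> b))"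
proof -
  have "(\<Prod>b\<in>Basis. std_normal_density (x \<bullet> b)) =
      (1 / sqrt (2 * pi)) ^ card (Basis :: (real ^ 'd) set) * (\<Prod>b\<in>Basis. exp (- (x \<bullet> b)\<^sup>2 / 2))"
    unfolding std_normal_density_def prod.distrib by simp
  also have "(\<Prod>b\<in>Basis. exp (- (x \<bullet> b)\<^sup>2 / 2)) = exp (\<Sum>b\<in>Basis. - (x \<bullet> b)\<^sup>2 / 2)"
    by (simp add: exp_sum)
  also have "(\<Sum>b\<in>Basis. - (x \<bullet> b)\<^sup>2 / 2) = - (x \<bullet> x) / 2"
    by (simp add: euclidean_inner[of x x] sum_negf sum_divide_distrib power2_eq_square)
  finally show ?thesis
    unfolding real_sqrt_power by (simp add: power_divide)
qed

lemma prob_space_std_gaussian: "prob_space (std_gaussian :: (real ^ 'd) measure)"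
proof (rule prob_spaceI)
  have "(\<integral>\<^sup>+x. ennreal (std_normal_density x) \<partial>lborel) = 1"
    using prob_space.emeasure_space_1[OF prob_space_normal_density[of 1 0]]
    by (simp add: emeasure_density)
  then show "emeasure (std_gaussian :: (real ^ 'd) measure) (space std_gaussian) = 1"
    unfolding std_gaussian_def std_gaussian_density
    by (simp add: emeasure_density prod_ennreal[symmetric]
        nn_integral_lborel_prod[where f = "\<lambda>_ x. ennreal (std_normal_density x)"])
qed

lemma integrable_std_gaussian_sq: "integrable (std_gaussian :: (real ^ 'd) measure) (\<lambda>x. (norm x)\<^sup>2)"
proof -
  have mass: "(\<integral>\<^sup>+x. ennreal (std_normal_density x) \<partial>lborel) = 1"
    using prob_space.emeasure_space_1[OF prob_space_normal_density[of 1 0]]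
    by (simp add: emeasure_density)
  have moment: "(\<integral>\<^sup>+x. ennreal (std_normal_density x * x\<^sup>2) \<partial>lborel) < \<infinity>"
    using std_normal_moment_even[of 1]
    by (subst nn_integral_eq_integral) (auto simp: has_bochner_integral_iff)
  have coord: "integrable (std_gaussian :: (real ^ 'd) measure) (\<lambda>x. (x \<bullet> c)\<^sup>2)" if c: "c \<in> Basis" for c
  proof (rule integrableI_nonneg)
    \<comment> \<open>Only coordinate c carries the square, so the integral is one second moment
      times total masses equal to 1.\<close>
    let ?f = "\<lambda>b t. ennreal (if b = c then std_normal_density t * t\<^sup>2 else std_normal_density t)"
    have "(\<integral>\<^sup>+x. ennreal ((x \<bullet> c)\<^sup>2) \<partial>(std_gaussian :: (real ^ 'd) measure))
        = (\<integral>\<^sup>+x. (\<Prod>b\<in>Basis. ?f b (x \<bullet> b)) \<partial>lborel)"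
    proof -
      have "(\<Prod>b\<in>Basis. std_normal_density (x \<bullet> b)) * (x \<bullet> c)\<^sup>2 =
          (\<Prod>b\<in>Basis. if b = c then std_normal_density (x \<bullet> b) * (x \<bullet> b)\<^sup>2 else std_normal_density (x \<bullet> b))" for x :: "real ^ 'd"
        using c by (simp add: prod.remove[of Basis c] mult_ac)
      then show ?thesis
        unfolding std_gaussian_def std_gaussian_density
        by (subst nn_integral_density) (auto simp: ennreal_mult[symmetric] prod_ennreal prod_nonneg intro!: nn_integral_cong)
    qed
    also have "\<dots> = (\<Prod>b\<in>Basis. \<integral>\<^sup>+t. ?f b t \<partial>lborel)"
      by (rule nn_integral_lborel_prod) auto
    also have "\<dots> = (\<integral>\<^sup>+t. ennreal (std_normal_density t * t\<^sup>2) \<partial>lborel)"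
      using c by (simp add: prod.remove[of Basis c] mass)
    also note moment
    finally show "(\<integral>\<^sup>+x. ennreal ((x \<bullet> c)\<^sup>2) \<partial>(std_gaussian :: (real ^ 'd) measure)) < \<infinity>" .
  qed (auto simp: std_gaussian_def)
  have "(\<lambda>x :: real ^ 'd. (norm x)\<^sup>2) = (\<lambda>x. \<Sum>b\<in>Basis. (x \<bullet> b)\<^sup>2)"
    by (simp add: power2_norm_eq_inner fun_eq_iff euclidean_inner[of x x for x :: "real ^ 'd"] power2_eq_square[of "_ \<bullet> _"])
  then show ?thesis using coord by simp
qed

lemma measurable_matrix_vector[measurable]:
  "(\<lambda>x. A *v x) \<in> borel_measurable borel" for A :: "real ^ 'd ^ 'd"
  by (intro borel_measurable_continuous_onI continuous_intros)

lemma nn_integral_lborel_translate: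
  fixes a :: "'a::euclidean_space"
  assumes [measurable]: "h \<in> borel_measurable borel"
  shows "(\<integral>\<^sup>+x. h (x + a) \<partial>lborel) = (\<integral>\<^sup>+x. h x \<partial>lborel)"
proof -
  have "(\<integral>\<^sup>+x. h x \<partial>lborel) = (\<integral>\<^sup>+x. h x \<partial>distr lborel borel ((+) a))"
    by (simp only: lborel_distr_plus)
  then show ?thesis by (simp add: nn_integral_distr add.commute)
qed

text \<open>The image of Lebesgue measure under an orthogonal map is translation invariant, hence a
  multiple of Lebesgue measure; the factor is 1 because both give the same mass to the rotation
  invariant Gaussian density.\<close>

declare transpose_matrix_vector[simp del]

lemma orthogonal_cancel:
  fixes U :: "real ^ 'd ^ 'd"
  assumes "orthogonal_matrix U"
  shows "U *v (transpose U *v x) = x" "transpose U *v (U *v x) = x"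
  using assms by (simp_all add: orthogonal_matrix_def matrix_vector_mul_assoc)

lemma inner_transpose: "x \<bullet> (transpose A *v y) = (A *v x) \<bullet> y" for A :: "real ^ 'd ^ 'd"
  by (metis dot_lmul_matrix inner_commute transpose_matrix_vector)

lemma lborel_orthogonal:
  fixes U :: "real ^ 'd ^ 'd"
  assumes U: "orthogonal_matrix U"
  shows "distr lborel borel (\<lambda>x. U *v x) = lborel"
proof -
  define \<phi> :: "real ^ 'd \<Rightarrow> ennreal" where
    "\<phi> x = ennreal (exp (- (x \<bullet> x) / 2) / sqrt ((2 * pi) ^ CARD('d)))" for x
  have [measurable]: "\<phi> \<in> borel_measurable borel" unfolding \<phi>_def by measurable
  have mass: "(\<integral>\<^sup>+x. \<phi> x \<partial>lborel) = 1"
  proof -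
    have "prob_space (std_gaussian :: (real ^ 'd) measure)" by (rule prob_space_std_gaussian)
    from prob_space.emeasure_space_1[OF this] show ?thesis
      by (simp add: std_gaussian_def emeasure_density \<phi>_def)
  qed
  note UU = orthogonal_cancel[OF U]
  have \<phi>_U: "\<phi> (y - U *v x) = \<phi> (x - transpose U *v y)" for x y
  proof -
    have "y - U *v x = - (U *v (x - transpose U *v y))"
      by (simp add: matrix_vector_mult_diff_distrib UU)
    then have "(y - U *v x) \<bullet> (y - U *v x) = (x - transpose U *v y) \<bullet> (x - transpose U *v y)"
      by (simp add: inner_transpose[symmetric] UU)
    then show ?thesis by (simp add: \<phi>_def)
  qed
  \<comment> \<open>The uniqueness of invariant measures, unrolled: the mass 1 of \<phi> is
    inserted, x is shifted by \<open>transpose U *v y\<close>, then y is shifted by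
    \<open>U *v x\<close>, and \<open>\<phi>_U\<close> makes the inner integral in x a shifted mass
    of \<phi>.\<close>
  have main: "(\<integral>\<^sup>+x. g (U *v x) \<partial>lborel) = (\<integral>\<^sup>+x. g x \<partial>lborel)"
    if [measurable]: "g \<in> borel_measurable borel" for g
  proof -
    have "(\<integral>\<^sup>+x. g (U *v x) \<partial>lborel) = (\<integral>\<^sup>+y. \<integral>\<^sup>+x. g (U *v x) * \<phi> y \<partial>lborel \<partial>lborel)"
      by (simp add: nn_integral_multc nn_integral_cmult mass)
    also have "\<dots> = (\<integral>\<^sup>+y. \<integral>\<^sup>+x. g (U *v x + y) * \<phi> y \<partial>lborel \<partial>lborel)"
      using nn_integral_lborel_translate[of "\<lambda>x. g (U *v x) * \<phi> y" "transpose U *v y" for y]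
      by (simp add: matrix_vector_right_distrib UU)
    also have "\<dots> = (\<integral>\<^sup>+x. \<integral>\<^sup>+y. g (U *v x + y) * \<phi> y \<partial>lborel \<partial>lborel)"
      by (rule lborel_pair.Fubini'[of "\<lambda>x y. g (U *v x + y) * \<phi> y", unfolded prod.case]) measurable
    also have "\<dots> = (\<integral>\<^sup>+x. \<integral>\<^sup>+y. g y * \<phi> (y - U *v x) \<partial>lborel \<partial>lborel)"
      using nn_integral_lborel_translate[of "\<lambda>y. g y * \<phi> (y - U *v x)" "U *v x" for x]
      by (simp add: add.commute)
    also have "\<dots> = (\<integral>\<^sup>+y. \<integral>\<^sup>+x. g y * \<phi> (y - U *v x) \<partial>lborel \<partial>lborel)"
      by (rule lborel_pair.Fubini'[of "\<lambda>x y. g y * \<phi> (y - U *v x)", unfolded prod.case, symmetric]) measurable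
    also have "\<dots> = (\<integral>\<^sup>+y. g y * (\<integral>\<^sup>+x. \<phi> (x + - (transpose U *v y)) \<partial>lborel) \<partial>lborel)"
      by (simp add: \<phi>_U nn_integral_cmult)
    also have "\<dots> = (\<integral>\<^sup>+y. g y \<partial>lborel)"
      by (subst nn_integral_lborel_translate) (simp_all add: mass)
    finally show ?thesis .
  qed
  show ?thesis
  proof (rule measure_eqI)
    fix A assume "A \<in> sets (distr lborel borel (\<lambda>x. U *v x))"
    then have A[measurable]: "A \<in> sets borel" by simp
    have "emeasure (distr lborel borel (\<lambda>x. U *v x)) A = (\<integral>\<^sup>+x. indicator A x \<partial>distr lborel borel (\<lambda>x. U *v x))"
      by simp
    also have "\<dots> = (\<integral>\<^sup>+x. indicator A (U *v x) \<partial>lborel)"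
      by (rule nn_integral_distr) auto
    also have "\<dots> = emeasure lborel A" by (subst main) auto
    finally show "emeasure (distr lborel borel (\<lambda>x. U *v x)) A = emeasure lborel A" .
  qed simp
qed

section \<open>Matrices that are diagonal in one orthogonal frame\<close>

definition spectral :: "real ^ 'd ^ 'd \<Rightarrow> real ^ 'd \<Rightarrow> real ^ 'd ^ 'd" where
  "spectral U v = transpose U ** (\<chi> i j. if i = j then v $ i else 0) ** U"

text \<open>The product of vectors is componentwise: rotate, scale each coordinate, rotate
  back.\<close>

lemma spectral_vec: "spectral U v *v x = transpose U *v (v * (U *v x))"
proof -
  have "(\<chi> i j. if i = j then v $ i else 0) *v y = v * y" for y :: "real ^ 'a"
    by (simp add: matrix_vector_mult_def vec_eq_iff if_distrib[of "\<lambda>z. z * _"] cong: if_cong)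
  then show ?thesis by (simp add: spectral_def matrix_vector_mul_assoc[symmetric])
qed

lemma inner_spectral: "x \<bullet> (spectral U v *v y) = (\<Sum>i\<in>UNIV. v $ i * ((U *v x) $ i * (U *v y) $ i))"
  unfolding spectral_vec inner_transpose by (simp add: inner_vec_def mult_ac)

lemma inner_spectral_self: "x \<bullet> (spectral U v *v x) = (\<Sum>i\<in>UNIV. v $ i * ((U *v x) $ i)\<^sup>2)"
  by (simp add: inner_spectral power2_eq_square)

lemma inner_spectral_swap: "(spectral U v *v x) \<bullet> y = x \<bullet> (spectral U v *v y)"
  by (subst inner_commute) (simp add: inner_spectral mult_ac)

lemma transpose_spectral: "transpose (spectral U v) = spectral U v"
proof -
  have "transpose (\<chi> i j. if i = j then v $ i else 0) = (\<chi> i j. if i = j then v $ i else 0)"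
    by (auto simp: transpose_def vec_eq_iff)
  then show ?thesis
    by (simp add: spectral_def matrix_transpose_mul matrix_mul_assoc)
qed

lemma spectral_sum:
  "spectral U (\<Sum>j\<in>A. c j *\<^sub>R v j) = (\<Sum>j\<in>A. c j *\<^sub>R spectral U (v j))"
proof -
  have add: "spectral U (v + w) = spectral U v + spectral U w" for v w
    unfolding matrix_eq
    by (simp add: spectral_vec matrix_vector_mult_add_rdistrib distrib_right matrix_vector_right_distrib)
  have scale: "spectral U (c *\<^sub>R v) = c *\<^sub>R spectral U v" for c v
    unfolding matrix_eq
  proof
    fix x
    have "(c *\<^sub>R v) * (U *v x) = c *\<^sub>R (v * (U *v x))" by (simp add: vec_eq_iff)
    then show "spectral U (c *\<^sub>R v) *v x = (c *\<^sub>R spectral U v) *v x"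
      by (simp add: spectral_vec scaleR_matrix_vector_assoc[symmetric] matrix_vector_mult_scaleR)
  qed
  have zero: "spectral U 0 = 0" using scale[of 0 0] by simp
  show ?thesis
    by (induction A rule: infinite_finite_induct) (simp_all add: zero add scale)
qed

locale orthogonal_frame =
  fixes U :: "real ^ 'd ^ 'd"
  assumes orthogonal: "orthogonal_matrix U"
begin

lemmas cancel = orthogonal_cancel[OF orthogonal]

lemma spectral_mult: "spectral U v ** spectral U w = spectral U (v * w)"
  by (simp add: matrix_eq matrix_vector_mul_assoc[symmetric] spectral_vec cancel mult.assoc)

lemma spectral_mult_vec: "spectral U v *v (spectral U w *v x) = spectral U (v * w) *v x"
  by (simp add: matrix_vector_mul_assoc spectral_mult)

lemma spectral_1: "spectral U 1 = mat 1"
  by (simp add: matrix_eq spectral_vec cancel)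

lemma det_spectral: "det (spectral U v) = (\<Prod>i\<in>UNIV. v $ i)"
proof -
  have "det U * det U = 1" using det_orthogonal_matrix[OF orthogonal] by auto
  moreover have "det (\<chi> i j. if i = j then v $ i else 0) = (\<Prod>i\<in>UNIV. v $ i)"
    by (subst det_diagonal) auto
  ultimately show ?thesis by (simp add: spectral_def det_mul)
qed

lemma pos_semidef_spectral: "(\<And>i. 0 \<le> v $ i) \<Longrightarrow> pos_semidef (spectral U v)"
  by (simp add: pos_semidef_def transpose_spectral inner_spectral_self sum_nonneg)

lemma pos_def_spectral:
  assumes "\<And>i. 0 < v $ i"
  shows "pos_def (spectral U v)"
  unfolding pos_def_def
proof (intro conjI allI impI transpose_spectral)
  fix x :: "real ^ 'd" assume "x \<noteq> 0"
  then have "U *v x \<noteq> 0" using cancel(2)[of x] by (metis matrix_vector_mult_0_right)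
  then obtain i where "(U *v x) $ i \<noteq> 0" by (auto simp: vec_eq_iff)
  then have "0 < v $ i * ((U *v x) $ i)\<^sup>2" using assms by simp
  also have "\<dots> \<le> (\<Sum>i\<in>UNIV. v $ i * ((U *v x) $ i)\<^sup>2)"
    using assms by (intro member_le_sum) (auto simp: less_imp_le)
  finally show "0 < x \<bullet> (spectral U v *v x)" by (simp add: inner_spectral_self)
qed

text \<open>The eigenvalues are the diagonal entries in the rotated frame; they are positive because
  each is the quadratic form at a column of \<open>transpose U\<close>.\<close>

lemma spectral_of_diagonal:
  assumes "pos_def S" "diagonal_matrix (U ** S ** transpose U)"
  obtains s where "\<And>i. 0 < s $ i" "S = spectral U s"
proof -
  let ?D = "U ** S ** transpose U"
  define s where "s = (\<chi> i. ?D $ i $ i)"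
  have "?D = (\<chi> i j. if i = j then s $ i else 0)"
    using assms(2) by (auto simp: s_def vec_eq_iff diagonal_matrix_def)
  moreover have "S = transpose U ** ?D ** U"
    by (simp add: matrix_eq matrix_vector_mul_assoc[symmetric] cancel)
  ultimately have S: "S = spectral U s" by (simp add: spectral_def)
  have "0 < s $ i" for i
  proof -
    let ?x = "transpose U *v axis i 1"
    have "?x \<noteq> 0" using cancel(1)[of "axis i 1"] by (metis axis_eq_0_iff matrix_vector_mult_0_right zero_neq_one)
    then have "0 < ?x \<bullet> (S *v ?x)" using assms(1) by (simp add: pos_def_def)
    also have "\<dots> = (\<Sum>k\<in>UNIV. if k = i then s $ k else 0)"
      unfolding S inner_spectral_self cancel by (intro sum.cong) (auto simp: axis_def)
    finally show ?thesis by simp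
  qed
  with S show ?thesis by (rule that[rotated])
qed

text \<open>\<open>matrix_inv\<close> is a choice, so the point is that a two-sided inverse is
  unique.\<close>

lemma matrix_inv_spectral:
  assumes "\<And>i. v $ i \<noteq> 0"
  shows "matrix_inv (spectral U v) = spectral U (\<chi> i. 1 / v $ i)"
proof -
  have vv: "v * (\<chi> i. 1 / v $ i) = 1" "(\<chi> i. 1 / v $ i) * v = 1"
    using assms by (simp_all add: vec_eq_iff)
  show ?thesis
    unfolding matrix_inv_def
  proof (rule some_equality)
    fix B assume "spectral U v ** B = mat 1 \<and> B ** spectral U v = mat 1"
    then show "B = spectral U (\<chi> i. 1 / v $ i)"
      by (metis matrix_mul_assoc matrix_mul_lid matrix_mul_rid spectral_1 spectral_mult vv(1))
  qed (simp add: spectral_mult vv spectral_1)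
qed

text \<open>If \<open>B\<close> is a positive semidefinite square root and \<open>x\<close> an eigenvector of \<open>B ** B\<close> with
  eigenvalue \<open>a\<^sup>2\<close>, then \<open>B x - a x\<close> is an eigenvector of \<open>B\<close> with eigenvalue \<open>- a\<close> or zero.\<close>

lemma matrix_sqrt_spectral:
  assumes v: "\<And>i. 0 < v $ i"
  shows "matrix_sqrt (spectral U v) = spectral U (\<chi> i. sqrt (v $ i))"
  unfolding matrix_sqrt_def
proof (rule the_equality)
  have "(\<chi> i. sqrt (v $ i)) * (\<chi> i. sqrt (v $ i)) = v"
    using v by (simp add: vec_eq_iff less_imp_le)
  with v show "pos_semidef (spectral U (\<chi> i. sqrt (v $ i))) \<and>
      spectral U (\<chi> i. sqrt (v $ i)) ** spectral U (\<chi> i. sqrt (v $ i)) = spectral U v"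
    by (simp add: spectral_mult pos_semidef_spectral less_imp_le)
  fix B assume B: "pos_semidef B \<and> B ** B = spectral U v"
  have "B *v (transpose U *v axis i 1) = sqrt (v $ i) *\<^sub>R (transpose U *v axis i 1)" for i
  proof -
    let ?x = "transpose U *v axis i 1" and ?a = "sqrt (v $ i)"
    have a: "0 < ?a" using v by simp
    have "v * axis i 1 = (v $ i) *\<^sub>R axis i 1" by (simp add: vec_eq_iff axis_def)
    then have BB: "B *v (B *v ?x) = ?a\<^sup>2 *\<^sub>R ?x"
    proof -
      have "B *v (B *v ?x) = spectral U v *v ?x" using B matrix_vector_mul_assoc[of B B ?x] by simp
      with \<open>v * axis i 1 = (v $ i) *\<^sub>R axis i 1\<close> v[of i] show ?thesis
        by (simp add: spectral_vec cancel matrix_vector_mult_scaleR)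
    qed
    define y where "y = B *v ?x - ?a *\<^sub>R ?x"
    have "B *v y = - (?a *\<^sub>R y)"
      by (simp add: y_def matrix_vector_mult_diff_distrib matrix_vector_mult_scaleR BB scaleR_diff_right power2_eq_square)
    moreover have "0 \<le> y \<bullet> (B *v y)" using B by (simp add: pos_semidef_def)
    ultimately have "y \<bullet> y \<le> 0" using a by (simp add: mult_le_0_iff)
    then have "y = 0" using inner_ge_zero[of y] by (metis antisym inner_eq_zero_iff)
    then show ?thesis by (simp add: y_def)
  qed
  then have "(B ** transpose U) *v axis i 1 = (spectral U (\<chi> i. sqrt (v $ i)) ** transpose U) *v axis i 1" for i
  proof -
    have "(\<chi> i. sqrt (v $ i)) * axis i 1 = sqrt (v $ i) *\<^sub>R axis i 1" by (simp add: vec_eq_iff axis_def)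
    with \<open>B *v (transpose U *v axis i 1) = sqrt (v $ i) *\<^sub>R (transpose U *v axis i 1)\<close> show ?thesis
      by (simp add: matrix_vector_mul_assoc[symmetric] spectral_vec cancel matrix_vector_mult_scaleR)
  qed
  then have "B ** transpose U = spectral U (\<chi> i. sqrt (v $ i)) ** transpose U"
    by (simp add: matrix_vector_mul_component vec_eq_iff matrix_vector_mult_basis column_def)
  then have "B ** transpose U ** U = spectral U (\<chi> i. sqrt (v $ i)) ** transpose U ** U" by simp
  moreover have "transpose U ** U = mat 1" using orthogonal by (simp add: orthogonal_matrix_def)
  ultimately show "B = spectral U (\<chi> i. sqrt (v $ i))"
    by (simp add: matrix_mul_assoc[symmetric])
qed

text \<open>The map is a rotation, a coordinate scaling and the inverse rotation; only the scaling
  changes Lebesgue measure, by a constant that the density compensates.\<close>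

lemma lborel_spectral:
  assumes w: "\<And>i. 0 < w $ i"
  shows "density (distr lborel borel (\<lambda>x. spectral U w *v x)) (\<lambda>_. ennreal (\<Prod>i\<in>UNIV. w $ i)) = lborel"
proof -
  have [measurable]: "(\<lambda>x. w * x) \<in> borel_measurable borel"
    by (simp add: times_vec_def) (intro borel_measurable_continuous_onI continuous_intros)
  have scale: "density (distr lborel borel (\<lambda>x. w * x)) (\<lambda>_. ennreal (\<Prod>i\<in>UNIV. w $ i)) = lborel"
  proof -
    let ?c = "\<lambda>b. w \<bullet> b"
    have c: "?c b \<noteq> 0" if b: "b \<in> Basis" for b
    proof -
      obtain i where "b = axis i 1" using b by (auto simp: Basis_vec_def)
      with w[of i] show ?thesis by (simp add: inner_axis)
    qed
    have T: "0 + (\<Sum>j\<in>Basis. (?c j * (x \<bullet> j)) *\<^sub>R j) = w * x" for x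
      by (rule euclidean_eqI)
        (auto simp: inner_sum_left inner_Basis if_distrib Basis_vec_def inner_axis sum.delta' cong: if_cong)
    have p: "(\<Prod>j\<in>Basis. \<bar>?c j\<bar>) = (\<Prod>i\<in>UNIV. w $ i)"
      using w
      by (intro prod.reindex_bij_witness[of _ "\<lambda>i. axis i 1" "\<lambda>b. SOME i. b = axis i 1"])
        (auto simp: Basis_vec_def inner_axis axis_eq_axis less_imp_le)
    show ?thesis
      using lborel_affine_euclidean[of ?c 0, OF c] unfolding T p by simp
  qed
  have "distr lborel borel (\<lambda>x. spectral U w *v x) =
      distr (distr (distr lborel borel (\<lambda>x. U *v x)) borel (\<lambda>x. w * x)) borel (\<lambda>x. transpose U *v x)"
    by (simp add: distr_distr comp_def spectral_vec)
  also have "\<dots> = distr (distr lborel borel (\<lambda>x. w * x)) borel (\<lambda>x. transpose U *v x)"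
    by (simp add: lborel_orthogonal orthogonal)
  finally have "density (distr lborel borel (\<lambda>x. spectral U w *v x)) (\<lambda>_. ennreal (\<Prod>i\<in>UNIV. w $ i)) =
      distr (density (distr lborel borel (\<lambda>x. w * x)) (\<lambda>_. ennreal (\<Prod>i\<in>UNIV. w $ i))) borel (\<lambda>x. transpose U *v x)"
    by (simp add: density_distr)
  also have "\<dots> = lborel"
    unfolding scale by (rule lborel_orthogonal) (simp add: orthogonal)
  finally show ?thesis .
qed

text \<open>Change of variables along the square root of the covariance. Writing the eigenvalues as
  \<open>w * w\<close> makes w itself the root, and the product of its entries cancels the
  determinant in the normalisation.\<close>

lemma gaussian_spectral:
  assumes w: "\<And>i. 0 < w $ i"
  shows "gaussian 0 (spectral U (w * w)) = distr std_gaussian borel (\<lambda>x. spectral U w *v x)"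
proof -
  let ?A = "\<lambda>x. spectral U w *v x" and ?p = "\<Prod>i\<in>UNIV. w $ i"
  let ?\<phi> = "\<lambda>x. exp (- (x \<bullet> (matrix_inv (spectral U (w * w)) *v x)) / 2) /
      sqrt ((2 * pi) ^ CARD('d) * det (spectral U (w * w)))"
  have p: "0 < ?p" using w by (intro prod_pos) auto
  have w0: "w $ i \<noteq> 0" for i using w[of i] by simp
  have det: "sqrt ((2 * pi) ^ CARD('d) * det (spectral U (w * w))) = sqrt ((2 * pi) ^ CARD('d)) * ?p"
    using p by (simp add: det_spectral prod.distrib real_sqrt_mult)
  have "(spectral U w *v x) \<bullet> (matrix_inv (spectral U (w * w)) *v (spectral U w *v x)) = x \<bullet> x" for x
  proof -
    have "w * ((\<chi> i. 1 / (w * w) $ i) * w) = 1"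
      using w by (simp add: vec_eq_iff) (metis less_irrefl)
    moreover have "matrix_inv (spectral U (w * w)) = spectral U (\<chi> i. 1 / (w * w) $ i)"
      using w by (intro matrix_inv_spectral) (simp add: less_imp_neq[symmetric])
    ultimately show ?thesis
      by (simp add: inner_spectral_swap spectral_mult_vec spectral_1 del: times_vec_def)
  qed
  then have \<phi>: "?p * ?\<phi> (?A x) = exp (- (x \<bullet> x) / 2) / sqrt ((2 * pi) ^ CARD('d))" for x
    using p w0 unfolding det by simp
  have [measurable]: "?\<phi> \<in> borel_measurable borel" by measurable
  have "gaussian 0 (spectral U (w * w)) = density lborel ?\<phi>"
    by (simp add: gaussian_def)
  also have "\<dots> = density (density (distr lborel borel ?A) (\<lambda>_. ennreal ?p)) ?\<phi>"
    by (simp add: lborel_spectral w)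
  also have "\<dots> = density (distr lborel borel ?A) (\<lambda>x. ennreal (?p * ?\<phi> x))"
    using p by (subst density_density_eq) (auto simp: ennreal_mult'[symmetric] less_imp_le)
  also have "\<dots> = distr (density lborel (\<lambda>x. ennreal (?p * ?\<phi> (?A x)))) borel ?A"
    by (rule density_distr) measurable
  also have "\<dots> = distr std_gaussian borel ?A"
    unfolding \<phi> std_gaussian_def ..
  finally show ?thesis .
qed

section \<open>Kantorovich duality for linear transport maps\<close>

definition excess :: "real ^ 'd \<Rightarrow> real ^ 'd \<Rightarrow> real" where
  "excess c x = x \<bullet> x - x \<bullet> (spectral U c *v x)"

text \<open>With T the matrix \<open>spectral U c\<close>, \<open>excess c\<close> and the excess of
  the inverse eigenvalues act as Kantorovich potentials, and the gap is what they leave of the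
  squared distance: the residual T x - y in the quadratic form of the inverse of T. For positive c
  it vanishes exactly on the graph of T.\<close>

definition gap :: "real ^ 'd \<Rightarrow> (real ^ 'd) \<times> (real ^ 'd) \<Rightarrow> real" where
  "gap c z = (let r = spectral U c *v fst z - snd z in r \<bullet> (spectral U (\<chi> i. 1 / c $ i) *v r))"

lemma measurable_excess[measurable]: "excess c \<in> borel_measurable borel"
  unfolding excess_def by measurable

lemma norm_orthogonal: "norm (U *v x) = norm x"
  by (simp add: norm_eq_sqrt_inner inner_transpose[symmetric] cancel)

lemma integrable_excess:
  assumes "\<mu> \<in> P2"
  shows "integrable \<mu> (excess c)"
proof (rule Bochner_Integration.integrable_bound)
  show "integrable \<mu> (\<lambda>x. (1 + (\<Sum>i\<in>UNIV. \<bar>c $ i\<bar>)) * (norm x)\<^sup>2)"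
    using P2_integrable[OF assms] by simp
  show "excess c \<in> borel_measurable \<mu>"
    using measurable_excess measurable_cong_sets[OF P2_sets[OF assms] refl] by blast
  have "\<bar>excess c x\<bar> \<le> (1 + (\<Sum>i\<in>UNIV. \<bar>c $ i\<bar>)) * (norm x)\<^sup>2" for x
  proof -
    have "\<bar>x \<bullet> (spectral U c *v x)\<bar> \<le> (\<Sum>i\<in>UNIV. \<bar>c $ i\<bar> * ((U *v x) $ i)\<^sup>2)"
      unfolding inner_spectral_self by (rule order_trans[OF sum_abs]) (simp add: abs_mult)
    also have "\<dots> \<le> (\<Sum>i\<in>UNIV. \<bar>c $ i\<bar> * (norm x)\<^sup>2)"
    proof (intro sum_mono mult_left_mono)
      fix i
      have "\<bar>(U *v x) $ i\<bar> \<le> norm x" using component_le_norm_cart[of "U *v x" i] by (simp add: norm_orthogonal)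
      then show "((U *v x) $ i)\<^sup>2 \<le> (norm x)\<^sup>2" by (metis abs_ge_zero power2_abs power_mono)
    qed simp
    finally have "\<bar>x \<bullet> (spectral U c *v x)\<bar> \<le> (\<Sum>i\<in>UNIV. \<bar>c $ i\<bar>) * (norm x)\<^sup>2"
      by (simp add: sum_distrib_right)
    then show ?thesis
      using inner_ge_zero[of x] unfolding excess_def power2_norm_eq_inner distrib_right mult_1 by linarith
  qed
  then show "AE x in \<mu>. norm (excess c x) \<le> norm ((1 + (\<Sum>i\<in>UNIV. \<bar>c $ i\<bar>)) * (norm x)\<^sup>2)"
    by (intro AE_I2) (simp add: abs_mult sum_nonneg abs_of_nonneg)
qed

lemma distr_in_P2_spectral:
  assumes \<mu>: "\<mu> \<in> P2"
  shows "distr \<mu> borel (\<lambda>x. spectral U v *v x) \<in> P2"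
proof (rule distr_in_P2)
  show m: "(\<lambda>x. spectral U v *v x) \<in> borel_measurable \<mu>"
    using measurable_matrix_vector measurable_cong_sets[OF P2_sets[OF \<mu>] refl] by blast
  obtain K where K: "\<And>x. norm (spectral U v *v x) \<le> norm x * K" "0 < K"
    using bounded_linear.pos_bounded[OF matrix_vector_mul_bounded_linear[of "spectral U v"]] by blast
  show "integrable \<mu> (\<lambda>x. (norm (spectral U v *v x))\<^sup>2)"
  proof (rule Bochner_Integration.integrable_bound)
    show "integrable \<mu> (\<lambda>x. (norm x)\<^sup>2 * K\<^sup>2)" using P2_integrable[OF \<mu>] by simp
    show "AE x in \<mu>. norm ((norm (spectral U v *v x))\<^sup>2) \<le> norm ((norm x)\<^sup>2 * K\<^sup>2)"
      using K by (intro AE_I2) (simp add: power_mult_distrib[symmetric] abs_mult power_mono)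
  qed (use m in measurable)
qed (rule P2_prob_space[OF \<mu>])

context
  fixes c :: "real ^ 'd"
  assumes c: "\<And>i. 0 < c $ i"
begin

lemma inverse_mult: "c * (\<chi> i. 1 / c $ i) = 1" "(\<chi> i. 1 / c $ i) * c = 1"
  using c[THEN less_imp_neq] by (simp_all add: vec_eq_iff)

lemma inverse_pos: "0 < (\<chi> i. 1 / c $ i) $ i"
  using c by simp

text \<open>Young's inequality for the quadratic form of \<open>spectral U c\<close>, as an identity: this is the
  Kantorovich duality certificate for the linear map \<open>spectral U c\<close>.\<close>

lemma norm_diff_split:
  "(norm (x - y))\<^sup>2 = excess c x + excess (\<chi> i. 1 / c $ i) y + gap c (x, y)"
proof -
  let ?T = "spectral U c" and ?T' = "spectral U (\<chi> i. 1 / c $ i)"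
  have "?T' *v (?T *v x) = x"
    by (simp add: spectral_mult_vec inverse_mult spectral_1)
  then have "gap c (x, y) = x \<bullet> (?T *v x) - 2 * (x \<bullet> y) + y \<bullet> (?T' *v y)"
    unfolding gap_def Let_def fst_conv snd_conv
    by (simp add: matrix_vector_mult_diff_distrib inner_diff inner_spectral_swap[symmetric, of "?T *v x"] inner_commute)
  then show ?thesis
    by (simp add: excess_def power2_norm_eq_inner inner_diff inner_commute)
qed

lemma gap_nonneg: "0 \<le> gap c z"
  using c by (simp add: gap_def Let_def inner_spectral_self sum_nonneg less_imp_le)

lemma gap_zero: "gap c z = 0 \<longleftrightarrow> snd z = spectral U c *v fst z"
  using pos_def_spectral[of "\<chi> i. 1 / c $ i", OF inverse_pos]
  by (auto simp: gap_def Let_def pos_def_def) (metis less_irrefl right_minus_eq)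

text \<open>The constant is the least eigenvalue of the inverse map. This quantitative form of
  \<open>gap_zero\<close> is meant for couplings that are only nearly optimal.\<close>

lemma gap_lower: "\<exists>k>0. \<forall>z. k * (norm (spectral U c *v fst z - snd z))\<^sup>2 \<le> gap c z"
proof (intro exI conjI allI)
  let ?k = "Min (range (\<lambda>i. 1 / c $ i))"
  show "0 < ?k" using c by (subst Min_gr_iff) auto
  fix z :: "(real ^ 'd) \<times> (real ^ 'd)"
  define r where "r = spectral U c *v fst z - snd z"
  have "(norm (U *v r))\<^sup>2 = (\<Sum>i\<in>UNIV. ((U *v r) $ i)\<^sup>2)"
    by (simp add: norm_vec_def L2_set_def sum_nonneg)
  then have "?k * (norm r)\<^sup>2 = (\<Sum>i\<in>UNIV. ?k * ((U *v r) $ i)\<^sup>2)"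
    by (simp only: norm_orthogonal sum_distrib_left)
  also have "\<dots> \<le> (\<Sum>i\<in>UNIV. 1 / c $ i * ((U *v r) $ i)\<^sup>2)"
    by (intro sum_mono mult_right_mono Min_le) auto
  also have "\<dots> = gap c z"
    by (simp add: gap_def Let_def inner_spectral_self flip: r_def)
  finally show "?k * (norm (spectral U c *v fst z - snd z))\<^sup>2 \<le> gap c z"
    unfolding r_def .
qed

text \<open>The potentials contribute through the marginals only, so among couplings of given
  marginals the cost varies with the integral of the gap alone.\<close>

lemma transport_cost_split:
  assumes \<gamma>: "\<gamma> \<in> couplings \<mu> \<nu>" and P2: "\<mu> \<in> P2" "\<nu> \<in> P2"
  shows "integrable \<gamma> (gap c)"
    and "transport_cost \<gamma> = (\<integral>x. excess c x \<partial>\<mu>) + (\<integral>y. excess (\<chi> i. 1 / c $ i) y \<partial>\<nu>) + (\<integral>z. gap c z \<partial>\<gamma>)"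
proof -
  note i = coupling_integral[OF \<gamma> measurable_excess]
  have i1: "integrable \<gamma> (\<lambda>z. excess c (fst z))" "integrable \<gamma> (\<lambda>z. excess (\<chi> i. 1 / c $ i) (snd z))"
    using i integrable_excess P2 by simp_all
  have gap: "gap c z = (norm (fst z - snd z))\<^sup>2 - excess c (fst z) - excess (\<chi> i. 1 / c $ i) (snd z)" for z
    using norm_diff_split[of "fst z" "snd z"] by simp
  note i2 = coupling_integrable_cost[OF \<gamma> P2]
  show "integrable \<gamma> (gap c)"
    unfolding gap[abs_def] using i1 i2 by simp
  show "transport_cost \<gamma> = (\<integral>x. excess c x \<partial>\<mu>) + (\<integral>y. excess (\<chi> i. 1 / c $ i) y \<partial>\<nu>) + (\<integral>z. gap c z \<partial>\<gamma>)"
    unfolding gap[abs_def] transport_cost_def using i1 i2 by (simp add: i)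
qed

lemma transport_cost_ge:
  assumes \<gamma>: "\<gamma> \<in> couplings \<mu> \<nu>" and P2: "\<mu> \<in> P2" "\<nu> \<in> P2"
  shows "(\<integral>x. excess c x \<partial>\<mu>) + (\<integral>y. excess (\<chi> i. 1 / c $ i) y \<partial>\<nu>) \<le> transport_cost \<gamma>"
  using transport_cost_split(2)[OF assms] gap_nonneg by simp

text \<open>Zero mean of a nonnegative gap concentrates the coupling on the graph of the map, where
  the first marginal determines it.\<close>

lemma coupling_graph:
  assumes \<gamma>: "\<gamma> \<in> couplings \<mu> \<nu>" and P2: "\<mu> \<in> P2" "\<nu> \<in> P2"
    and eq: "transport_cost \<gamma> = (\<integral>x. excess c x \<partial>\<mu>) + (\<integral>y. excess (\<chi> i. 1 / c $ i) y \<partial>\<nu>)"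
  shows "\<gamma> = distr \<mu> borel (\<lambda>x. (x, spectral U c *v x))"
proof -
  note [measurable] = coupling_measurable[OF \<gamma>]
  have sets: "sets \<gamma> = sets borel" and \<mu>: "\<mu> = distr \<gamma> borel fst" using \<gamma> by (auto simp: couplings_def)
  have "(\<integral>z. gap c z \<partial>\<gamma>) = 0" using transport_cost_split(2)[OF \<gamma> P2] eq by simp
  then have "AE z in \<gamma>. gap c z = 0"
    using transport_cost_split(1)[OF \<gamma> P2] gap_nonneg by (subst (asm) integral_nonneg_eq_0_iff_AE) auto
  then have "AE z in \<gamma>. z = (fst z, spectral U c *v fst z)"
    by eventually_elim (metis gap_zero prod.collapse)
  then have "distr \<gamma> borel (\<lambda>z. z) = distr \<gamma> borel (\<lambda>z. (fst z, spectral U c *v fst z))"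
    by (intro distr_cong_AE) (auto simp: measurable_cong_sets[OF sets refl])
  also have "\<dots> = distr \<mu> borel (\<lambda>x. (x, spectral U c *v x))"
    unfolding \<mu> by (simp add: distr_distr comp_def)
  finally show ?thesis by (simp add: distr_id2 sets)
qed

lemma W2_sq_ge_excess:
  assumes "\<mu> \<in> P2" "\<nu> \<in> P2"
  shows "(\<integral>x. excess c x \<partial>\<mu>) + (\<integral>y. excess (\<chi> i. 1 / c $ i) y \<partial>\<nu>) \<le> (W2 \<mu> \<nu>)\<^sup>2"
  by (intro W2_sq_ge couplings_nonempty transport_cost_ge assms)

text \<open>A coupling within k * \<epsilon> of the dual bound has a gap of mean below k *
  \<epsilon>. Moving its first component by the linear map therefore couples the image of \<mu> with
  \<nu> at cost below \<epsilon>, and \<epsilon> is arbitrary.\<close>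

lemma W2_sq_eq_excess_image:
  assumes \<mu>: "\<mu> \<in> P2" and \<nu>: "\<nu> \<in> P2"
    and le: "(W2 \<mu> \<nu>)\<^sup>2 \<le> (\<integral>x. excess c x \<partial>\<mu>) + (\<integral>y. excess (\<chi> i. 1 / c $ i) y \<partial>\<nu>)"
  shows "distr \<mu> borel (\<lambda>x. spectral U c *v x) = \<nu>"
proof (rule eq_of_small_couplings)
  obtain k where k: "0 < k" "\<And>z. k * (norm (spectral U c *v fst z - snd z))\<^sup>2 \<le> gap c z"
    using gap_lower by blast
  fix \<epsilon> :: real assume "0 < \<epsilon>"
  then have "(W2 \<mu> \<nu>)\<^sup>2 < (\<integral>x. excess c x \<partial>\<mu>) + (\<integral>y. excess (\<chi> i. 1 / c $ i) y \<partial>\<nu>) + k * \<epsilon>"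
    using le k(1) by (simp add: add_le_less_mono order.strict_trans1)
  then obtain \<gamma> where \<gamma>: "\<gamma> \<in> couplings \<mu> \<nu>"
      "transport_cost \<gamma> < (\<integral>x. excess c x \<partial>\<mu>) + (\<integral>y. excess (\<chi> i. 1 / c $ i) y \<partial>\<nu>) + k * \<epsilon>"
    using W2_sq_less_coupling[OF couplings_nonempty[OF \<mu> \<nu>]] by blast
  note [measurable] = coupling_measurable[OF \<gamma>(1)]
  let ?\<gamma> = "distr \<gamma> borel (\<lambda>z. (spectral U c *v fst z, snd z))"
  have "distr \<gamma> borel (\<lambda>z. spectral U c *v fst z) = distr \<mu> borel (\<lambda>x. spectral U c *v x)"
  proof -
    have "\<mu> = distr \<gamma> borel fst" using \<gamma>(1) by (simp add: couplings_def)
    then show ?thesis by (simp add: distr_distr comp_def)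
  qed
  moreover have "distr \<gamma> borel snd = \<nu>" using \<gamma>(1) by (simp add: couplings_def)
  ultimately have coup: "?\<gamma> \<in> couplings (distr \<mu> borel (\<lambda>x. spectral U c *v x)) \<nu>"
    using coupling_distr_pair[of "\<lambda>z. spectral U c *v fst z" \<gamma> snd] by simp
  have int: "integrable \<gamma> (\<lambda>z. (norm (spectral U c *v fst z - snd z))\<^sup>2)"
    using coupling_integrable_cost[OF coup distr_in_P2_spectral[OF \<mu>] \<nu>]
    by (simp add: integrable_distr_eq)
  have "k * transport_cost ?\<gamma> = (\<integral>z. k * (norm (spectral U c *v fst z - snd z))\<^sup>2 \<partial>\<gamma>)"
    by (simp add: transport_cost_distr_pair)
  also have "\<dots> \<le> (\<integral>z. gap c z \<partial>\<gamma>)"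
    using int k(2) transport_cost_split(1)[OF \<gamma>(1) \<mu> \<nu>] by (intro integral_mono) auto
  also have "\<dots> < k * \<epsilon>" using \<gamma>(2) transport_cost_split(2)[OF \<gamma>(1) \<mu> \<nu>] by simp
  finally have "transport_cost ?\<gamma> < \<epsilon>" using k(1) by simp
  with coup show "\<exists>\<gamma>\<in>couplings (distr \<mu> borel (\<lambda>x. spectral U c *v x)) \<nu>. transport_cost \<gamma> < \<epsilon>" by blast
qed (use assms distr_in_P2_spectral in auto)

end

end

lemma sum_matrix_vector: "(\<Sum>j\<in>A. B j) *v x = (\<Sum>j\<in>A. B j *v x)" for B :: "'i \<Rightarrow> real ^ 'd ^ 'd"
  by (induction A rule: infinite_finite_induct) (simp_all add: matrix_vector_mult_add_rdistrib)

lemma std_gaussian_P2: "std_gaussian \<in> P2"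
  by (simp add: P2_def prob_space_std_gaussian integrable_std_gaussian_sq) (simp add: std_gaussian_def)

lemma sets_std_gaussian[measurable_cong]: "sets std_gaussian = sets borel"
  by (simp add: std_gaussian_def)

section \<open>Gaussian families with commuting covariances\<close>

locale gaussian_family = orthogonal_frame U for U :: "real ^ 'd ^ 'd" +
  fixes r :: "'n::finite \<Rightarrow> real ^ 'd"
  assumes r_pos: "\<And>j i. 0 < r j $ i"
begin

definition mean_root :: "real ^ 'n \<Rightarrow> real ^ 'd" where "mean_root v = (\<Sum>j\<in>UNIV. v $ j *\<^sub>R r j)"

text \<open>The eigenvalues of the linear map that carries \<open>law v\<close> to
  \<open>law w\<close>: mixing averages the square roots of the covariances, and their quotient is
  the transport map because all of them commute.\<close>

definition ratio :: "real ^ 'n \<Rightarrow> real ^ 'n \<Rightarrow> real ^ 'd" where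
  "ratio v w = (\<chi> i. mean_root w $ i / mean_root v $ i)"

abbreviation q :: "'n \<Rightarrow> real ^ 'd \<Rightarrow> real ^ 'd" where "q \<equiv> (\<lambda>j x. spectral U (r j) *v x)"

lemma mix_q: "mix q v = (\<lambda>x. spectral U (mean_root v) *v x)"
  by (simp add: fun_eq_iff mix_def mean_root_def spectral_sum sum_matrix_vector scaleR_matrix_vector_assoc)

lemma mean_root_pos:
  assumes "convex_vector v"
  shows "0 < mean_root v $ i"
proof -
  obtain k where k: "0 < v $ k" using convex_vector_pos[OF assms] by blast
  then have "0 < v $ k * r k $ i" using r_pos by simp
  also have "\<dots> \<le> (\<Sum>j\<in>UNIV. v $ j * r j $ i)"
    using assms r_pos[THEN less_imp_le] by (intro member_le_sum) (auto simp: convex_vector_def)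
  finally show ?thesis by (simp add: mean_root_def)
qed

lemma mean_root_axis: "mean_root (axis j 1) = r j"
proof -
  have "mean_root (axis j 1) = (\<Sum>k\<in>UNIV. if k = j then r k else 0)"
    unfolding mean_root_def by (intro sum.cong) (auto simp: axis_def)
  then show ?thesis by simp
qed

context
  fixes v w :: "real ^ 'n"
  assumes v: "convex_vector v" and w: "convex_vector w"
begin

lemma ratio_pos: "0 < ratio v w $ i"
  using mean_root_pos[OF v] mean_root_pos[OF w] by (simp add: ratio_def)

lemma ratio_mult: "ratio v w * mean_root v = mean_root w"
  using mean_root_pos[OF v, THEN less_imp_neq] by (simp add: ratio_def vec_eq_iff)

lemma ratio_mix: "spectral U (ratio v w) *v mix q v x = mix q w x"
  by (simp add: mix_q spectral_mult_vec ratio_mult)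

lemma mix_P2: "distr std_gaussian borel (mix q v) \<in> P2"
  unfolding mix_q by (rule distr_in_P2_spectral[OF std_gaussian_P2])

end

lemma measurable_mix_q[measurable]: "mix q v \<in> borel_measurable std_gaussian"
  unfolding mix_q by measurable

text \<open>The joint law lives on the graph of the ratio map, where the gap vanishes, so it attains
  the dual bound.\<close>

lemma transport_cost_mix:
  assumes v: "convex_vector v" and w: "convex_vector w"
  shows "(\<integral>x. (norm (mix q v x - mix q w x))\<^sup>2 \<partial>std_gaussian) =
    (\<integral>x. excess (ratio v w) x \<partial>distr std_gaussian borel (mix q v)) +
    (\<integral>y. excess (\<chi> i. 1 / ratio v w $ i) y \<partial>distr std_gaussian borel (mix q w))"
proof -
  note pos = ratio_pos[OF v w]
  let ?\<gamma> = "distr std_gaussian borel (\<lambda>x. (mix q v x, mix q w x))"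
  have coup: "?\<gamma> \<in> couplings (distr std_gaussian borel (mix q v)) (distr std_gaussian borel (mix q w))"
    by (intro coupling_distr_pair measurable_mix_q)
  note split = transport_cost_split[OF pos coup mix_P2[OF v w] mix_P2[OF w v]]
  have "(\<integral>z. gap (ratio v w) z \<partial>?\<gamma>) = (\<integral>x. gap (ratio v w) (mix q v x, mix q w x) \<partial>std_gaussian)"
    using borel_measurable_integrable[OF split(1)] by (intro integral_distr) auto
  also have "\<dots> = 0"
    using gap_zero[OF pos, of "(mix q v x, mix q w x)" for x] by (simp add: ratio_mix[OF v w])
  finally show ?thesis
    using split(2) transport_cost_distr_pair[OF measurable_mix_q measurable_mix_q, of v w] by simp
qed

sublocale optimally_coupled std_gaussian q
proof (rule optimally_coupled.intro[OF prob_space_std_gaussian], unfold_locales, goal_cases)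
  case (1 j)
  show ?case by measurable
next
  case (2 j)
  have "integrable (distr std_gaussian borel (\<lambda>x. spectral U (r j) *v x)) (\<lambda>x. (norm x)\<^sup>2)"
    by (rule P2_integrable[OF distr_in_P2_spectral[OF std_gaussian_P2]])
  then show ?case by (subst (asm) integrable_distr_eq) auto
next
  case (3 v w \<gamma>)
  then show ?case
    using transport_cost_ge[OF ratio_pos _ mix_P2 mix_P2, of v w \<gamma>] by (simp add: transport_cost_mix)
next
  case (4 v w \<gamma>)
  then have "\<gamma> = distr (distr std_gaussian borel (mix q v)) borel (\<lambda>x. (x, spectral U (ratio v w) *v x))"
    by (intro coupling_graph[OF ratio_pos _ mix_P2 mix_P2]) (auto simp: transport_cost_mix)
  also have "\<dots> = distr std_gaussian borel (\<lambda>x. (mix q v x, mix q w x))"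
    using 4 by (simp add: distr_distr comp_def ratio_mix)
  finally show ?case .
qed

lemma law_gaussian: "convex_vector v \<Longrightarrow> law v = gaussian 0 (spectral U (mean_root v * mean_root v))"
  by (simp add: law_def mix_q gaussian_spectral mean_root_pos)

lemma distr_spectral_inverse:
  assumes c: "\<And>i. 0 < c $ i" and sets: "sets \<nu> = sets borel"
  shows "distr (distr \<nu> borel (\<lambda>x. spectral U c *v x)) borel (\<lambda>x. spectral U (\<chi> i. 1 / c $ i) *v x) = \<nu>"
proof -
  note [measurable_cong] = sets
  show ?thesis
    by (subst distr_distr) (simp_all add: comp_def spectral_mult_vec inverse_mult[OF c] spectral_1 distr_id2 sets)
qed

text \<open>A dual certificate: in the weighted sum of the dual bounds for the maps from
  \<open>law lam\<close> to the initial laws, the terms depending on the competitor cancel, which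
  leaves the constant \<open>K\<close>, attained at \<open>law lam\<close>. A competitor attaining
  \<open>K\<close> is carried by one of these maps to the same initial law as \<open>law lam\<close>
  is, and the map is invertible.\<close>

lemma barycenter:
  assumes lam: "convex_vector lam"
  shows "wasserstein_barycenter lam (\<lambda>j. law (axis j 1)) (law lam)"
proof -
  let ?c = "\<lambda>j. ratio lam (axis j 1)"
  let ?I = "\<lambda>\<nu> j. \<integral>x. excess (?c j) x \<partial>\<nu>"
  let ?K = "\<lambda>j. \<integral>y. excess (\<chi> i. 1 / ?c j $ i) y \<partial>law (axis j 1)"
  note c = ratio_pos[OF lam convex_vector_axis]
  have lam0: "0 \<le> lam $ j" for j using lam by (simp add: convex_vector_def)
  \<comment> \<open>The first-order condition of the barycenter: the weighted mean of the transport
    maps is the identity.\<close>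
  have c_sum: "(\<Sum>j\<in>UNIV. lam $ j *\<^sub>R ?c j) = 1"
  proof -
    have "(\<Sum>j\<in>UNIV. lam $ j * (r j $ i / mean_root lam $ i)) = (\<Sum>j\<in>UNIV. lam $ j * r j $ i) / mean_root lam $ i" for i
      by (simp add: sum_divide_distrib)
    also have "\<dots> i = 1" for i
      using mean_root_pos[OF lam, of i] by (simp add: mean_root_def)
    finally show ?thesis by (simp add: vec_eq_iff ratio_def mean_root_axis)
  qed
  have I_sum: "(\<Sum>j\<in>UNIV. lam $ j * ?I \<nu> j) = 0" if \<nu>: "\<nu> \<in> P2" for \<nu>
  proof -
    have "(\<Sum>j\<in>UNIV. lam $ j * excess (?c j) x) = 0" for x
    proof -
      have "(\<Sum>j\<in>UNIV. lam $ j * (x \<bullet> (spectral U (?c j) *v x))) = x \<bullet> (spectral U (\<Sum>j\<in>UNIV. lam $ j *\<^sub>R ?c j) *v x)"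
        by (simp add: spectral_sum sum_matrix_vector inner_sum_right scaleR_matrix_vector_assoc[symmetric])
      also have "\<dots> = x \<bullet> x" by (simp add: c_sum spectral_1)
      finally show ?thesis
        using lam by (simp add: excess_def right_diff_distrib sum_subtractf sum_distrib_right[symmetric] convex_vector_def)
    qed
    then have "(\<integral>x. (\<Sum>j\<in>UNIV. lam $ j * excess (?c j) x) \<partial>\<nu>) = 0" by simp
    then show ?thesis using integrable_excess[OF \<nu>] by simp
  qed
  have summand: "?I \<nu> j + ?K j \<le> (W2 \<nu> (law (axis j 1)))\<^sup>2" if "\<nu> \<in> P2" for \<nu> j
    by (intro W2_sq_ge_excess c that law_P2)
  define K where "K = (\<Sum>j\<in>UNIV. lam $ j * ?K j)"
  have total: "(\<Sum>j\<in>UNIV. lam $ j * (?I \<nu> j + ?K j)) = K" if "\<nu> \<in> P2" for \<nu>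
    using I_sum[OF that] by (simp add: K_def distrib_left sum.distrib)
  have lower: "K \<le> (\<Sum>j\<in>UNIV. lam $ j * (W2 \<nu> (law (axis j 1)))\<^sup>2)" if "\<nu> \<in> P2" for \<nu>
    unfolding total[OF that, symmetric] by (intro sum_mono mult_left_mono summand that lam0)
  have at_law: "(\<Sum>j\<in>UNIV. lam $ j * (W2 (law lam) (law (axis j 1)))\<^sup>2) = K"
    unfolding total[OF law_P2, of lam, symmetric]
    using transport_cost_mix[OF lam convex_vector_axis]
    by (simp add: W2_law_sq lam convex_vector_axis flip: law_def)
  have uniq: "\<nu> = law lam" if \<nu>: "\<nu> \<in> P2" and le: "(\<Sum>j\<in>UNIV. lam $ j * (W2 \<nu> (law (axis j 1)))\<^sup>2) \<le> K" for \<nu>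
  proof -
    \<comment> \<open>Equality in the sum controls only summands of positive weight.\<close>
    obtain k where k: "0 < lam $ k" using convex_vector_pos[OF lam] by blast
    \<comment> \<open>The weighted slacks of the dual bounds: nonnegative, with a sum of at most
      0.\<close>
    let ?d = "\<lambda>j. lam $ j * ((W2 \<nu> (law (axis j 1)))\<^sup>2 - (?I \<nu> j + ?K j))"
    have "?d k \<le> (\<Sum>j\<in>UNIV. ?d j)"
      by (intro member_le_sum) (auto intro!: mult_nonneg_nonneg lam0 summand[OF \<nu>] simp del: right_diff_distrib)
    also have "\<dots> \<le> 0" using le total[OF \<nu>] by (simp add: right_diff_distrib sum_subtractf)
    finally have "(W2 \<nu> (law (axis k 1)))\<^sup>2 \<le> ?I \<nu> k + ?K k" using k by (simp add: mult_le_0_iff)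
    then have "distr \<nu> borel (\<lambda>x. spectral U (?c k) *v x) = law (axis k 1)"
      by (intro W2_sq_eq_excess_image c \<nu> law_P2)
    moreover have "distr (law lam) borel (\<lambda>x. spectral U (?c k) *v x) = law (axis k 1)"
      by (simp add: law_def distr_distr comp_def ratio_mix[OF lam convex_vector_axis])
    ultimately show ?thesis
      using distr_spectral_inverse[OF c, of _ k] P2_sets[OF \<nu>] P2_sets[OF law_P2, of lam] by metis
  qed
  show ?thesis
    unfolding wasserstein_barycenter_def is_arg_min_def
    using at_law lower uniq law_P2 by (auto simp: not_less)
qed

lemma matrix_sqrt_square:
  assumes "\<And>i. 0 < w $ i"
  shows "matrix_sqrt (spectral U (w * w)) = spectral U w"
proof -
  have "(\<chi> i. sqrt ((w * w) $ i)) = w"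
    using assms by (simp add: vec_eq_iff less_imp_le)
  then show ?thesis using matrix_sqrt_spectral[of "w * w"] assms by simp
qed

text \<open>With \<tau> the root of the limiting covariance, the j-th inner root has eigenvalues
  \<open>\<tau> * r j\<close>, and their weighted mean is \<open>\<tau> * \<tau>\<close> because
  \<tau> is the weighted mean of the \<open>r j\<close>.\<close>

lemma law_gaussian_average:
  assumes lam: "convex_vector lam"
  shows "gaussian_average lam (\<lambda>j. spectral U (r j * r j)) (law lam)"
  unfolding gaussian_average_def
proof (intro exI conjI)
  let ?\<tau> = "mean_root lam"
  note \<tau> = mean_root_pos[OF lam]
  show "pos_def (spectral U (?\<tau> * ?\<tau>))" using \<tau> by (intro pos_def_spectral) simp
  show "law lam = gaussian 0 (spectral U (?\<tau> * ?\<tau>))" by (rule law_gaussian[OF lam])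
  have "matrix_sqrt (spectral U ?\<tau> ** spectral U (r j * r j) ** spectral U ?\<tau>) = spectral U (?\<tau> * r j)" for j
  proof -
    have "?\<tau> * (r j * r j) * ?\<tau> = (?\<tau> * r j) * (?\<tau> * r j)" by (simp add: vec_eq_iff)
    then have "spectral U ?\<tau> ** spectral U (r j * r j) ** spectral U ?\<tau> =
        spectral U ((?\<tau> * r j) * (?\<tau> * r j))"
      by (simp only: spectral_mult)
    then show ?thesis
      using matrix_sqrt_square[of "?\<tau> * r j"] \<tau> r_pos[of j] by simp
  qed
  moreover have "(\<Sum>j\<in>UNIV. lam $ j *\<^sub>R (?\<tau> * r j)) = ?\<tau> * ?\<tau>"
    by (simp add: vec_eq_iff mean_root_def sum_distrib_left mult_ac)
  ultimately show "spectral U (?\<tau> * ?\<tau>) = (\<Sum>j\<in>UNIV. lam $ j *\<^sub>R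
      matrix_sqrt (matrix_sqrt (spectral U (?\<tau> * ?\<tau>)) ** spectral U (r j * r j) ** matrix_sqrt (spectral U (?\<tau> * ?\<tau>))))"
    by (simp add: matrix_sqrt_square[OF \<tau>] flip: spectral_sum)
qed

end

lemma gaussian_initial_family:
  assumes "gaussian_initial \<nu> S"
  obtains U r where "gaussian_family U r" "S = (\<lambda>j. spectral U (r j * r j))"
    "\<nu> = (\<lambda>j. distr std_gaussian borel (\<lambda>x. spectral U (r j) *v x))"
proof -
  obtain U where U: "orthogonal_matrix U" "\<And>k. diagonal_matrix (U ** S k ** transpose U)"
    using assms by (auto simp: gaussian_initial_def)
  have S: "pos_def (S k)" "\<nu> k = gaussian 0 (S k)" for k using assms by (auto simp: gaussian_initial_def)
  interpret orthogonal_frame U by unfold_locales (rule U)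
  have "\<exists>s. (\<forall>i. 0 < s $ i) \<and> S k = spectral U s" for k
    using spectral_of_diagonal[OF S(1) U(2)] by metis
  then obtain s where s: "\<And>k i. 0 < s k $ i" "\<And>k. S k = spectral U (s k)" by metis
  define r where "r k = (\<chi> i. sqrt (s k $ i))" for k
  have r: "0 < r k $ i" for k i using s by (simp add: r_def)
  have rr: "r k * r k = s k" for k using s by (simp add: r_def vec_eq_iff less_imp_le)
  show ?thesis
  proof
    show "gaussian_family U r" by unfold_locales (rule r)
    show "S = (\<lambda>j. spectral U (r j * r j))" by (simp add: rr s fun_eq_iff)
    show "\<nu> = (\<lambda>j. distr std_gaussian borel (\<lambda>x. spectral U (r j) *v x))"
      using gaussian_spectral[OF r] by (simp add: rr s S fun_eq_iff)
  qed
qed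

section \<open>The PaWBar algorithms\<close>

lemma evolution_matrix_row:
  "evolution_matrix a (i, j) $ k =
    (if k = i then (1 - a i j) *\<^sub>R axis i 1 + a i j *\<^sub>R axis j 1 else axis k 1)"
  by (auto simp: evolution_matrix_def outer_def mat_def axis_def vec_eq_iff)

lemma sum_axis_scaleR: "(\<Sum>l\<in>UNIV. axis k 1 $ l *\<^sub>R X l) = X k" for X :: "'n::finite \<Rightarrow> 'a::real_vector"
proof -
  have "(\<Sum>l\<in>UNIV. axis k 1 $ l *\<^sub>R X l) = (\<Sum>l\<in>UNIV. if l = k then X l else 0)"
    by (intro sum.cong) (auto simp: axis_def)
  then show ?thesis by simp
qed

lemma sum_axis_combination:
  fixes X :: "'n::finite \<Rightarrow> 'a::real_vector"
  shows "(\<Sum>l\<in>UNIV. (b *\<^sub>R axis i 1 + c *\<^sub>R axis j 1) $ l *\<^sub>R X l) = b *\<^sub>R X i + c *\<^sub>R X j"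
proof -
  have "(\<Sum>l\<in>UNIV. (b *\<^sub>R axis i 1 + c *\<^sub>R axis j 1) $ l *\<^sub>R X l) =
      b *\<^sub>R (\<Sum>l\<in>UNIV. axis i 1 $ l *\<^sub>R X l) + c *\<^sub>R (\<Sum>l\<in>UNIV. axis j 1 $ l *\<^sub>R X l)"
    by (simp add: scaleR_left_distrib sum.distrib scaleR_sum_right)
  then show ?thesis by (simp only: sum_axis_scaleR)
qed

lemma evolution_matrix_mult_row:
  "(evolution_matrix a (i, j) ** X) $ k = (if k = i then (1 - a i j) *\<^sub>R X $ i + a i j *\<^sub>R X $ j else X $ k)"
  unfolding matrix_mult_row evolution_matrix_row
  by (cases "k = i") (simp_all only: simp_thms if_True if_False sum_axis_combination sum_axis_scaleR)

lemma convex_vector_convex: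
  assumes "convex_vector v" "convex_vector w" "0 \<le> c" "c \<le> 1"
  shows "convex_vector ((1 - c) *\<^sub>R v + c *\<^sub>R w)"
  using assms by (auto simp: convex_vector_def sum.distrib simp flip: sum_distrib_left)

lemma stochastic_evolution_matrix:
  assumes "0 \<le> a i j" "a i j \<le> 1"
  shows "stochastic (evolution_matrix a (i, j))"
  using assms by (simp add: stochastic_def evolution_matrix_row convex_vector_axis convex_vector_convex)

text \<open>Indexed by the edge as a set, so the order picked by \<open>end_points\<close> cannot
  matter; the factor 1/2 fits edges with two end points.\<close>

definition averaging_matrix :: "'n set \<Rightarrow> real ^ 'n ^ 'n" where
  "averaging_matrix e = (\<chi> k. if k \<in> e then (1 / 2) *\<^sub>R (\<Sum>l\<in>e. axis l 1) else axis k 1)"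

lemma averaging_matrix_row:
  assumes "i \<noteq> j"
  shows "averaging_matrix {i, j} $ k =
    (if k = i \<or> k = j then (1 / 2) *\<^sub>R axis i 1 + (1 / 2) *\<^sub>R axis j 1 else axis k 1)"
  using assms by (simp add: averaging_matrix_def scaleR_right_distrib)

lemma averaging_matrix_mult_row:
  assumes "i \<noteq> j"
  shows "(averaging_matrix {i, j} ** X) $ k =
    (if k = i \<or> k = j then (1 / 2) *\<^sub>R X $ i + (1 / 2) *\<^sub>R X $ j else X $ k)"
  unfolding matrix_mult_row averaging_matrix_row[OF assms]
  by (cases "k = i \<or> k = j") (simp_all only: simp_thms if_True if_False sum_axis_combination sum_axis_scaleR)

lemma stochastic_averaging_matrix:
  assumes "card e = 2"
  shows "stochastic (averaging_matrix e)"
proof -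
  obtain i j where e: "e = {i, j}" "i \<noteq> j" using assms by (meson card_2_iff)
  show ?thesis
    using convex_vector_convex[OF convex_vector_axis[of i] convex_vector_axis[of j], of "1 / 2"]
    by (simp add: stochastic_def e averaging_matrix_row convex_vector_axis)
qed

lemma averaging_matrix_column_sum:
  fixes X :: "real ^ 'm ^ 'n"
  assumes "card e = 2"
  shows "(\<Sum>k\<in>UNIV. (averaging_matrix e ** X) $ k) = (\<Sum>k\<in>UNIV. X $ k)"
proof -
  obtain i j where e: "e = {i, j}" "i \<noteq> j" using assms by (meson card_2_iff)
  have split: "(\<Sum>k\<in>UNIV. Y k) = Y i + Y j + (\<Sum>k\<in>UNIV - {i, j}. Y k)" for Y :: "'n \<Rightarrow> real ^ 'm"
    using e by (subst sum.subset_diff[of "{i, j}"]) (auto simp: add.commute)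
  have "(1 / 2) *\<^sub>R X $ i + (1 / 2) *\<^sub>R X $ j + ((1 / 2) *\<^sub>R X $ i + (1 / 2) *\<^sub>R X $ j) = X $ i + X $ j"
    by (simp add: vec_eq_iff)
  moreover have "(\<Sum>k\<in>UNIV - {i, j}. (averaging_matrix e ** X) $ k) = (\<Sum>k\<in>UNIV - {i, j}. X $ k)"
    by (intro sum.cong) (auto simp: e averaging_matrix_mult_row)
  ultimately show ?thesis
    using split[of "\<lambda>k. (averaging_matrix e ** X) $ k"] split[of "\<lambda>k. X $ k"]
    by (simp add: e averaging_matrix_mult_row)
qed

lemma end_points_card_2:
  assumes "card e = 2"
  obtains i j where "end_points e = (i, j)" "e = {i, j}" "i \<noteq> j"
proof -
  obtain i j where ij: "e = {i, j}" "i \<noteq> j" using assms by (meson card_2_iff)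
  have "case end_points e of (i, j) \<Rightarrow> e = {i, j}"
    unfolding end_points_def by (rule someI[of _ "(i, j)"]) (simp add: ij)
  then show ?thesis
    using that[of "fst (end_points e)" "snd (end_points e)"] ij by (auto simp: case_prod_beta doubleton_eq_iff)
qed

context optimally_coupled
begin

text \<open>Stochasticity of the evolution keeps the rows convex, as \<open>displacement_law\<close>
  requires, and one step changes row i just as the algorithm changes agent i. The weights are
  bounded along the selected edges only, which is where the algorithm reads them.\<close>

lemma directed_pawbar_law:
  assumes choice: "optimal_plan_choice \<gamma>opt"
    and a: "\<And>t i j. e t = (i, j) \<Longrightarrow> 0 \<le> a i j \<and> a i j \<le> 1"
  shows "directed_pawbar \<gamma>opt a (\<lambda>j. law (axis j 1)) e t k = law (evolution (evolution_matrix a) e t $ k)"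
proof (induction t arbitrary: k)
  case 0
  show ?case by (simp add: mat_1_row)
next
  case (Suc t)
  obtain i j where ij: "e t = (i, j)" by fastforce
  have "stochastic (evolution (evolution_matrix a) e t)"
  proof (rule stochastic_evolution)
    fix s show "stochastic (evolution_matrix a (e s))"
      using a[of s "fst (e s)" "snd (e s)"] stochastic_evolution_matrix[of a "fst (e s)" "snd (e s)"] by simp
  qed
  then show ?case
    by (simp add: ij Let_def Suc evolution_matrix_mult_row displacement_law[OF choice] stochastic_def)
qed

lemma symmetric_pawbar_law:
  assumes choice: "optimal_plan_choice \<gamma>opt" and e: "\<And>t. card (e t) = 2"
  shows "symmetric_pawbar \<gamma>opt (\<lambda>j. law (axis j 1)) e t k = law (evolution averaging_matrix e t $ k)"
proof (induction t arbitrary: k)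
  case 0
  show ?case by (simp add: mat_1_row)
next
  case (Suc t)
  obtain i j where ij: "end_points (e t) = (i, j)" "e t = {i, j}" "i \<noteq> j"
    using end_points_card_2[OF e] by blast
  have "stochastic (evolution averaging_matrix e t)"
    by (intro stochastic_evolution stochastic_averaging_matrix e)
  then show ?case
    using displacement_law[OF choice, of "evolution averaging_matrix e t $ i" "evolution averaging_matrix e t $ j" "1 / 2"]
    by (simp add: ij(1) Let_def Suc stochastic_def) (simp add: ij averaging_matrix_mult_row)
qed

lemma law_evolution_tendsto:
  assumes "evolution B e \<longlonglongrightarrow> outer 1 lam"
  shows "(\<lambda>t. W2 (law (evolution B e t $ k)) (law lam)) \<longlonglongrightarrow> 0"
proof (rule W2_law_tendsto)
  have "(\<lambda>t. evolution B e t $ k) \<longlonglongrightarrow> outer 1 lam $ k" using assms by (intro tendsto_intros)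
  then show "(\<lambda>t. evolution B e t $ k) \<longlonglongrightarrow> lam" by (simp add: outer_def)
qed

end

text \<open>Turns a limit that exists at almost every point into one measurable random vector: it is
  taken as the limit of a single row, and uniqueness of limits identifies it with the common limit
  of all rows.\<close>

lemma random_consensus_vector:
  fixes B :: "'e::finite \<Rightarrow> real ^ 'n ^ 'n" and e :: "nat \<Rightarrow> 'w \<Rightarrow> 'e"
  assumes meas: "\<And>t. e t \<in> measurable M (count_space UNIV)"
    and lim: "AE \<omega> in M. \<exists>l. convex_vector l \<and> evolution B (\<lambda>t. e t \<omega>) \<longlonglongrightarrow> outer 1 l"
  obtains lam where "random_convex_vector M lam" "AE \<omega> in M. convex_vector (lam \<omega>)"
    "AE \<omega> in M. evolution B (\<lambda>t. e t \<omega>) \<longlonglongrightarrow> outer 1 (lam \<omega>)"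
proof -
  \<comment> \<open>There are finitely many edges, so each step is a countable case split and the
    evolution is measurable even into the discrete space.\<close>
  have discrete: "(\<lambda>\<omega>. evolution B (\<lambda>t. e t \<omega>) t) \<in> measurable M (count_space UNIV)" for t
  proof (induction t)
    case (Suc t)
    then have "(\<lambda>\<omega>. B x ** evolution B (\<lambda>t. e t \<omega>) t) \<in> measurable M (count_space UNIV)" for x
      by (rule measurable_compose) simp
    then show ?case
      using measurable_compose_countable[OF _ meas, of "\<lambda>x \<omega>. B x ** evolution B (\<lambda>t. e t \<omega>) t"] by simp
  qed simp
  have "(\<lambda>\<omega>. evolution B (\<lambda>t. e t \<omega>) t $ undefined) \<in> borel_measurable M" for t
    by (rule measurable_compose[OF discrete]) simp
  moreover have row: "(\<lambda>t. evolution B e t $ undefined) \<longlonglongrightarrow> l"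
    if "evolution B e \<longlonglongrightarrow> outer 1 l" for l and e :: "nat \<Rightarrow> 'e"
  proof -
    have "(\<lambda>t. evolution B e t $ undefined) \<longlonglongrightarrow> outer 1 l $ undefined" using that by (intro tendsto_intros)
    then show ?thesis by (simp add: outer_def)
  qed
  have "AE \<omega> in M. \<exists>v. convex_vector v \<and> (\<lambda>t. evolution B (\<lambda>t. e t \<omega>) t $ undefined) \<longlonglongrightarrow> v"
    using lim by eventually_elim (use row in blast)
  ultimately obtain lam where lam: "random_convex_vector M lam"
      "AE \<omega> in M. (\<lambda>t. evolution B (\<lambda>t. e t \<omega>) t $ undefined) \<longlonglongrightarrow> lam \<omega>"
    using random_convex_vector_limit[of "\<lambda>t \<omega>. evolution B (\<lambda>t. e t \<omega>) t $ undefined" M] by blast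
  have "AE \<omega> in M. evolution B (\<lambda>t. e t \<omega>) \<longlonglongrightarrow> outer 1 (lam \<omega>)"
    using lim lam(2)
  proof eventually_elim
    case (elim \<omega>)
    then obtain l where l: "evolution B (\<lambda>t. e t \<omega>) \<longlonglongrightarrow> outer 1 l" by blast
    then have "l = lam \<omega>" using row[OF l] elim(2) LIMSEQ_unique by blast
    with l show ?case by simp
  qed
  moreover have "AE \<omega> in M. convex_vector (lam \<omega>)"
    using lam(1) by (intro AE_I2) (simp add: random_convex_vector_def)
  ultimately show ?thesis using that lam(1) by blast
qed

lemma directed_consensus:
  fixes e :: "nat \<Rightarrow> 'w \<Rightarrow> 'n::finite \<times> 'n"
  assumes conn: "strongly_connected E" and a: "\<forall>(i, j)\<in>E. 0 < a i j \<and> a i j < 1"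
    and E: "set_pmf p = E" and iid: "iid_edges M p e"
  obtains lam where "random_convex_vector M lam" "AE \<omega> in M. convex_vector (lam \<omega>)"
    "AE \<omega> in M. evolution (evolution_matrix a) (\<lambda>t. e t \<omega>) \<longlonglongrightarrow> outer 1 (lam \<omega>)"
proof -
  let ?B = "evolution_matrix a"
  have ax: "0 < a i j" "a i j < 1" if "(i, j) \<in> E" for i j using a that by auto
  have "AE \<omega> in M. \<exists>l. convex_vector l \<and> evolution ?B (\<lambda>t. e t \<omega>) \<longlonglongrightarrow> outer 1 l"
  proof (rule random_consensus[OF iid])
    fix x assume x: "x \<in> set_pmf p"
    obtain i j where ij: "x = (i, j)" by fastforce
    note b = ax[of i j, folded ij E, OF x]
    show "stochastic (?B x)" using b by (simp add: ij stochastic_evolution_matrix)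
    \<comment> \<open>The updated agent keeps the weight 1 - a i j (or 1 for a loop), all others
      keep 1.\<close>
    show "0 < ?B x $ k $ k" for k using b by (simp add: ij evolution_matrix_row axis_def)
  next
    fix i j
    have "0 < ?B (k, l) $ k $ l" if "(k, l) \<in> E" for k l
      using ax[OF that] by (simp add: evolution_matrix_row axis_def)
    then have "E \<subseteq> {(i, j). \<exists>x\<in>set_pmf p. 0 < ?B x $ i $ j}" using E by blast
    then show "(i, j) \<in> {(i, j). \<exists>x\<in>set_pmf p. 0 < ?B x $ i $ j}\<^sup>*"
      using conn rtrancl_mono unfolding strongly_connected_def by blast
  qed
  then show ?thesis
    by (rule random_consensus_vector[OF iid_edges_measurable[OF iid] _ that])
qed

lemma symmetric_consensus:
  fixes e :: "nat \<Rightarrow> 'w \<Rightarrow> 'n::finite set"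
  assumes conn: "connected_undirected F" and F: "set_pmf q = F" and iid: "iid_edges N q e"
  shows "AE \<omega> in N. evolution averaging_matrix (\<lambda>t. e t \<omega>) \<longlonglongrightarrow> outer 1 (\<chi> i. 1 / real CARD('n))"
proof -
  let ?B = averaging_matrix
  have card: "card x = 2" if "x \<in> set_pmf q" for x using that conn F by (simp add: connected_undirected_def)
  have "AE \<omega> in N. \<exists>l. convex_vector l \<and> evolution ?B (\<lambda>t. e t \<omega>) \<longlonglongrightarrow> outer 1 l"
  proof (rule random_consensus[OF iid])
    fix x assume x: "x \<in> set_pmf q"
    then obtain i j where ij: "x = {i, j}" "i \<noteq> j" using card by (meson card_2_iff)
    show "stochastic (?B x)" using card[OF x] by (rule stochastic_averaging_matrix)
    show "0 < ?B x $ k $ k" for k using ij(2) by (simp add: ij(1) averaging_matrix_row axis_def)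
  next
    fix i j
    have "0 < ?B {k, l} $ k $ l" if "{k, l} \<in> F" for k l
    proof -
      have "card {k, l} = 2" using card that F by blast
      then have "k \<noteq> l" by auto
      then show ?thesis by (simp add: averaging_matrix_row axis_def)
    qed
    then have "{(u, v). {u, v} \<in> F} \<subseteq> {(i, j). \<exists>x\<in>set_pmf q. 0 < ?B x $ i $ j}" using F by blast
    then show "(i, j) \<in> {(i, j). \<exists>x\<in>set_pmf q. 0 < ?B x $ i $ j}\<^sup>*"
      using conn rtrancl_mono unfolding connected_undirected_def by blast
  qed
  then show ?thesis
    using iid_edges_support[OF iid]
  proof eventually_elim
    case (elim \<omega>)
    let ?X = "evolution ?B (\<lambda>t. e t \<omega>)"
    obtain l where l: "?X \<longlonglongrightarrow> outer 1 l" using elim by blast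
    \<comment> \<open>Averaging two rows preserves the sum of all rows; in the limit this sum is n
      times l.\<close>
    have "(\<Sum>k\<in>UNIV. ?X t $ k) = 1" for t
    proof (induction t)
      case 0
      show ?case by (simp add: vec_eq_iff mat_def)
    next
      case (Suc t)
      then show ?case using elim(2) card by (simp add: averaging_matrix_column_sum)
    qed
    moreover have "(\<lambda>t. \<Sum>k\<in>UNIV. ?X t $ k) \<longlonglongrightarrow> (\<Sum>k\<in>UNIV. outer 1 l $ k)"
      using l by (intro tendsto_intros)
    ultimately have "(\<Sum>k\<in>(UNIV :: 'n set). outer 1 l $ k) = 1"
      by (simp add: LIMSEQ_const_iff)
    then have "(\<Sum>k\<in>(UNIV :: 'n set). outer 1 l $ k) $ i = 1" for i
      by simp
    then have "real CARD('n) * l $ i = 1" for i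
      by (simp add: outer_def del: sum_constant) simp
    then have "l = (\<chi> i. 1 / real CARD('n))"
      by (simp add: vec_eq_iff field_simps)
    with l show ?case by simp
  qed
qed

lemma convex_vector_uniform: "convex_vector (\<chi> i :: 'n::finite. 1 / real CARD('n))"
  by (simp add: convex_vector_def)

lemma barycenter_uniform:
  "wasserstein_barycenter (\<chi> i :: 'n::finite. 1 / real CARD('n)) \<mu> m \<longleftrightarrow> wasserstein_barycenter 1 \<mu> m"
proof -
  have "(\<chi> i :: 'n. 1 / real CARD('n)) = (1 / real CARD('n)) *\<^sub>R 1" by (simp add: vec_eq_iff)
  then show ?thesis by (simp add: wasserstein_barycenter_scale)
qed

context optimally_coupled
begin

lemma directed_pawbar_limit:
  fixes e :: "nat \<Rightarrow> 'w \<Rightarrow> 'n \<times> 'n"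
  assumes choice: "optimal_plan_choice \<gamma>opt"
    and a: "\<forall>(i, j)\<in>E. 0 < a i j \<and> a i j < 1" and E: "set_pmf p = E" and iid: "iid_edges M p e"
    and lim: "AE \<omega> in M. evolution (evolution_matrix a) (\<lambda>t. e t \<omega>) \<longlonglongrightarrow> outer 1 (lam \<omega>)"
  shows "AE \<omega> in M. \<forall>i. (\<lambda>t. W2 (directed_pawbar \<gamma>opt a (\<lambda>j. law (axis j 1)) (\<lambda>t. e t \<omega>) t i) (law (lam \<omega>))) \<longlonglongrightarrow> 0"
  using lim iid_edges_support[OF iid]
proof eventually_elim
  case (elim \<omega>)
  have "0 \<le> a i j \<and> a i j \<le> 1" if "e t \<omega> = (i, j)" for t i j
  proof -
    have "(i, j) \<in> E" using elim(2) E that by metis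
    with a show ?thesis by force
  qed
  then show ?case
    using law_evolution_tendsto[OF elim(1)] by (simp add: directed_pawbar_law[OF choice])
qed

lemma symmetric_pawbar_limit:
  fixes e :: "nat \<Rightarrow> 'w \<Rightarrow> 'n set"
  assumes choice: "optimal_plan_choice \<gamma>opt"
    and conn: "connected_undirected F" and F: "set_pmf q' = F" and iid: "iid_edges M q' e"
  shows "AE \<omega> in M. \<forall>i. (\<lambda>t. W2 (symmetric_pawbar \<gamma>opt (\<lambda>j. law (axis j 1)) (\<lambda>t. e t \<omega>) t i)
      (law (\<chi> i. 1 / real CARD('n)))) \<longlonglongrightarrow> 0"
  using symmetric_consensus[OF conn F iid] iid_edges_support[OF iid]
proof eventually_elim
  case (elim \<omega>)
  have "card (e t \<omega>) = 2" for t
    using elim(2) conn F by (auto simp: connected_undirected_def)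
  then show ?case
    using law_evolution_tendsto[OF elim(1)] by (simp add: symmetric_pawbar_law[OF choice])
qed

end

lemma continuous_initial_law:
  fixes \<mu> :: "'n::finite \<Rightarrow> real measure"
  assumes "continuous_initial \<mu>"
  shows "optimally_coupled unit_lborel (\<lambda>j. quantile (\<mu> j))"
    and "(\<lambda>j. optimally_coupled.law unit_lborel (\<lambda>j. quantile (\<mu> j)) (axis j 1)) = \<mu>"
    and "convex_vector lam \<Longrightarrow> wasserstein_barycenter lam \<mu> (optimally_coupled.law unit_lborel (\<lambda>j. quantile (\<mu> j)) lam)"
    and "quantile_average lam \<mu> (optimally_coupled.law unit_lborel (\<lambda>j. quantile (\<mu> j)) lam)"
proof -
  note P2 = continuous_initial_P2[OF assms]
  show "optimally_coupled unit_lborel (\<lambda>j. quantile (\<mu> j))" by (rule quantiles_optimally_coupled[OF P2])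
  then interpret optimally_coupled unit_lborel "\<lambda>j. quantile (\<mu> j)" .
  show "(\<lambda>j. law (axis j 1)) = \<mu>"
    by (simp add: fun_eq_iff law_def mix_axis distr_quantile P2)
  show "convex_vector lam \<Longrightarrow> wasserstein_barycenter lam \<mu> (law lam)"
    unfolding law_def by (rule line_barycenter[OF P2])
  show "quantile_average lam \<mu> (law lam)"
    unfolding law_def by (rule line_quantile_average[OF assms])
qed

text \<open>Hides the frame and the roots behind the same four facts as in
  \<open>continuous_initial_law\<close>, so that both cases of the theorem end alike.\<close>

lemma gaussian_initial_law:
  fixes \<nu> :: "'n::finite \<Rightarrow> (real ^ 'd) measure"
  assumes "gaussian_initial \<nu> S"
  obtains q :: "'n \<Rightarrow> real ^ 'd \<Rightarrow> real ^ 'd" where "optimally_coupled std_gaussian q"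
    "(\<lambda>j. optimally_coupled.law std_gaussian q (axis j 1)) = \<nu>"
    "\<And>lam. convex_vector lam \<Longrightarrow> wasserstein_barycenter lam \<nu> (optimally_coupled.law std_gaussian q lam)"
    "\<And>lam. convex_vector lam \<Longrightarrow> gaussian_average lam S (optimally_coupled.law std_gaussian q lam)"
proof -
  obtain U r where G: "gaussian_family U r" and S: "S = (\<lambda>j. spectral U (r j * r j))"
    and \<nu>: "\<nu> = (\<lambda>j. distr std_gaussian borel (\<lambda>x. spectral U (r j) *v x))"
    using gaussian_initial_family[OF assms] by blast
  interpret gaussian_family U r by (rule G)
  have eq: "(\<lambda>j. law (axis j 1)) = \<nu>" by (simp add: \<nu> law_def mix_axis)
  show ?thesis
  proof (rule that)
    show "optimally_coupled std_gaussian q" by (rule optimally_coupled_axioms)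
    show "(\<lambda>j. law (axis j 1)) = \<nu>" by (rule eq)
    show "wasserstein_barycenter lam \<nu> (law lam)" if lam: "convex_vector lam" for lam
      using barycenter[OF lam] by (simp only: eq)
    show "gaussian_average lam S (law lam)" if lam: "convex_vector lam" for lam
      using law_gaussian_average[OF lam] by (simp only: S)
  qed
qed

theorem corollary3p8:
  fixes \<mu> :: "'n::finite \<Rightarrow> real measure"
    and \<nu> :: "'n \<Rightarrow> (real ^ 'd) measure" and S :: "'n \<Rightarrow> real ^ 'd ^ 'd"
    and \<gamma>1 :: "real measure \<Rightarrow> real measure \<Rightarrow> (real \<times> real) measure"
    and \<gamma>d :: "(real ^ 'd) measure \<Rightarrow> (real ^ 'd) measure \<Rightarrow> ((real ^ 'd) \<times> (real ^ 'd)) measure"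
    and E :: "('n \<times> 'n) set" and a :: "'n \<Rightarrow> 'n \<Rightarrow> real"
    and M :: "'w measure" and p :: "('n \<times> 'n) pmf" and e :: "nat \<Rightarrow> 'w \<Rightarrow> 'n \<times> 'n"
    and F :: "'n set set"
    and N :: "'v measure" and q :: "'n set pmf" and f :: "nat \<Rightarrow> 'v \<Rightarrow> 'n set"
  assumes "CARD('n) \<ge> 2"
    and "optimal_plan_choice \<gamma>1" and "optimal_plan_choice \<gamma>d"
  shows
    "(strongly_connected E \<and> (\<forall>(i, j)\<in>E. 0 < a i j \<and> a i j < 1) \<and>
      set_pmf p = E \<and> iid_edges M p e \<longrightarrow>
        (\<exists>lam. random_convex_vector M lam \<and>
          (AE \<omega> in M. backward_product (\<lambda>t. evolution_matrix a (e t \<omega>))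
                         \<longlonglongrightarrow> outer 1 (lam \<omega>)) \<and>
          (continuous_initial \<mu> \<longrightarrow>
            (AE \<omega> in M. \<exists>m. wasserstein_barycenter (lam \<omega>) \<mu> m \<and>
               quantile_average (lam \<omega>) \<mu> m \<and>
               (\<forall>i. (\<lambda>t. W2 (directed_pawbar \<gamma>1 a \<mu> (\<lambda>t. e t \<omega>) t i) m) \<longlonglongrightarrow> 0))) \<and>
          (gaussian_initial \<nu> S \<longrightarrow>
            (AE \<omega> in M. \<exists>m. wasserstein_barycenter (lam \<omega>) \<nu> m \<and>
               gaussian_average (lam \<omega>) S m \<and>
               (\<forall>i. (\<lambda>t. W2 (directed_pawbar \<gamma>d a \<nu> (\<lambda>t. e t \<omega>) t i) m) \<longlonglongrightarrow> 0)))))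
     \<and>
     (connected_undirected F \<and> set_pmf q = F \<and> iid_edges N q f \<longrightarrow>
        (let lam = (\<chi> i. 1 / real CARD('n)) in
          (continuous_initial \<mu> \<longrightarrow>
            (\<exists>m. wasserstein_barycenter lam \<mu> m \<and> wasserstein_barycenter 1 \<mu> m \<and>
               quantile_average lam \<mu> m \<and>
               (AE \<omega> in N. \<forall>i.
                  (\<lambda>t. W2 (symmetric_pawbar \<gamma>1 \<mu> (\<lambda>t. f t \<omega>) t i) m) \<longlonglongrightarrow> 0))) \<and>
          (gaussian_initial \<nu> S \<longrightarrow>
            (\<exists>m. wasserstein_barycenter lam \<nu> m \<and> wasserstein_barycenter 1 \<nu> m \<and>
               gaussian_average lam S m \<and>
               (AE \<omega> in N. \<forall>i.
                  (\<lambda>t. W2 (symmetric_pawbar \<gamma>d \<nu> (\<lambda>t. f t \<omega>) t i) m) \<longlonglongrightarrow> 0)))))"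
proof (intro conjI impI)
  assume directed: "strongly_connected E \<and> (\<forall>(i, j)\<in>E. 0 < a i j \<and> a i j < 1) \<and> set_pmf p = E \<and> iid_edges M p e"
  then have dir: "strongly_connected E" "\<forall>(i, j)\<in>E. 0 < a i j \<and> a i j < 1" "set_pmf p = E" "iid_edges M p e"
    by auto
  \<comment> \<open>Obtained from the edges alone, before either kind of initial measures is
    assumed.\<close>
  then obtain lam where lam: "random_convex_vector M lam" "AE \<omega> in M. convex_vector (lam \<omega>)"
      and lim: "AE \<omega> in M. evolution (evolution_matrix a) (\<lambda>t. e t \<omega>) \<longlonglongrightarrow> outer 1 (lam \<omega>)"
    using directed_consensus by blast
  show "\<exists>lam. random_convex_vector M lam \<and>
      (AE \<omega> in M. backward_product (\<lambda>t. evolution_matrix a (e t \<omega>)) \<longlonglongrightarrow> outer 1 (lam \<omega>)) \<and>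
      (continuous_initial \<mu> \<longrightarrow>
        (AE \<omega> in M. \<exists>m. wasserstein_barycenter (lam \<omega>) \<mu> m \<and> quantile_average (lam \<omega>) \<mu> m \<and>
           (\<forall>i. (\<lambda>t. W2 (directed_pawbar \<gamma>1 a \<mu> (\<lambda>t. e t \<omega>) t i) m) \<longlonglongrightarrow> 0))) \<and>
      (gaussian_initial \<nu> S \<longrightarrow>
        (AE \<omega> in M. \<exists>m. wasserstein_barycenter (lam \<omega>) \<nu> m \<and> gaussian_average (lam \<omega>) S m \<and>
           (\<forall>i. (\<lambda>t. W2 (directed_pawbar \<gamma>d a \<nu> (\<lambda>t. e t \<omega>) t i) m) \<longlonglongrightarrow> 0)))"
  proof (intro exI conjI impI)
    show "random_convex_vector M lam" by (rule lam)
    show "AE \<omega> in M. backward_product (\<lambda>t. evolution_matrix a (e t \<omega>)) \<longlonglongrightarrow> outer 1 (lam \<omega>)"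
    proof -
      \<comment> \<open>The product up to time t includes the matrix of time t, hence the shift by
        one.\<close>
      have "backward_product (\<lambda>t. evolution_matrix a (e t \<omega>)) =
          (\<lambda>t. evolution (evolution_matrix a) (\<lambda>t. e t \<omega>) (Suc t))" for \<omega>
        by (rule ext) (rule backward_product_evolution)
      with lim show ?thesis by (auto elim!: eventually_mono intro: LIMSEQ_Suc simp del: evolution.simps)
    qed
  next
    assume init: "continuous_initial \<mu>"
    note law = continuous_initial_law[OF init]
    show "AE \<omega> in M. \<exists>m. wasserstein_barycenter (lam \<omega>) \<mu> m \<and> quantile_average (lam \<omega>) \<mu> m \<and>
        (\<forall>i. (\<lambda>t. W2 (directed_pawbar \<gamma>1 a \<mu> (\<lambda>t. e t \<omega>) t i) m) \<longlonglongrightarrow> 0)"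
      using lam(2) optimally_coupled.directed_pawbar_limit[OF law(1) assms(2) dir(2-4) lim, unfolded law(2)]
      by eventually_elim (use law in blast)
  next
    assume "gaussian_initial \<nu> S"
    then obtain q :: "'n \<Rightarrow> real ^ 'd \<Rightarrow> real ^ 'd" where law: "optimally_coupled std_gaussian q"
      "(\<lambda>j. optimally_coupled.law std_gaussian q (axis j 1)) = \<nu>"
      "\<And>lam. convex_vector lam \<Longrightarrow> wasserstein_barycenter lam \<nu> (optimally_coupled.law std_gaussian q lam)"
      "\<And>lam. convex_vector lam \<Longrightarrow> gaussian_average lam S (optimally_coupled.law std_gaussian q lam)"
      by (rule gaussian_initial_law) (rule that; blast)
    show "AE \<omega> in M. \<exists>m. wasserstein_barycenter (lam \<omega>) \<nu> m \<and> gaussian_average (lam \<omega>) S m \<and>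
        (\<forall>i. (\<lambda>t. W2 (directed_pawbar \<gamma>d a \<nu> (\<lambda>t. e t \<omega>) t i) m) \<longlonglongrightarrow> 0)"
      using lam(2) optimally_coupled.directed_pawbar_limit[OF law(1) assms(3) dir(2-4) lim, unfolded law(2)]
      by eventually_elim (use law in blast)
  qed
next
  assume symmetric: "connected_undirected F \<and> set_pmf q = F \<and> iid_edges N q f"
  let ?lam = "\<chi> i :: 'n. 1 / real CARD('n)"
  show "let lam = ?lam in
      (continuous_initial \<mu> \<longrightarrow>
        (\<exists>m. wasserstein_barycenter lam \<mu> m \<and> wasserstein_barycenter 1 \<mu> m \<and> quantile_average lam \<mu> m \<and>
          (AE \<omega> in N. \<forall>i. (\<lambda>t. W2 (symmetric_pawbar \<gamma>1 \<mu> (\<lambda>t. f t \<omega>) t i) m) \<longlonglongrightarrow> 0))) \<and>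
      (gaussian_initial \<nu> S \<longrightarrow>
        (\<exists>m. wasserstein_barycenter lam \<nu> m \<and> wasserstein_barycenter 1 \<nu> m \<and> gaussian_average lam S m \<and>
          (AE \<omega> in N. \<forall>i. (\<lambda>t. W2 (symmetric_pawbar \<gamma>d \<nu> (\<lambda>t. f t \<omega>) t i) m) \<longlonglongrightarrow> 0)))"
    unfolding Let_def
  proof (intro conjI impI)
    assume init: "continuous_initial \<mu>"
    note law = continuous_initial_law[OF init]
    show "\<exists>m. wasserstein_barycenter ?lam \<mu> m \<and> wasserstein_barycenter 1 \<mu> m \<and> quantile_average ?lam \<mu> m \<and>
        (AE \<omega> in N. \<forall>i. (\<lambda>t. W2 (symmetric_pawbar \<gamma>1 \<mu> (\<lambda>t. f t \<omega>) t i) m) \<longlonglongrightarrow> 0)"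
      using law(3,4)[of ?lam] optimally_coupled.symmetric_pawbar_limit[OF law(1) assms(2), of F q N f, unfolded law(2)]
        symmetric convex_vector_uniform barycenter_uniform by blast
  next
    assume "gaussian_initial \<nu> S"
    then obtain q' :: "'n \<Rightarrow> real ^ 'd \<Rightarrow> real ^ 'd" where law: "optimally_coupled std_gaussian q'"
      "(\<lambda>j. optimally_coupled.law std_gaussian q' (axis j 1)) = \<nu>"
      "\<And>lam. convex_vector lam \<Longrightarrow> wasserstein_barycenter lam \<nu> (optimally_coupled.law std_gaussian q' lam)"
      "\<And>lam. convex_vector lam \<Longrightarrow> gaussian_average lam S (optimally_coupled.law std_gaussian q' lam)"
      by (rule gaussian_initial_law) (rule that; blast)
    show "\<exists>m. wasserstein_barycenter ?lam \<nu> m \<and> wasserstein_barycenter 1 \<nu> m \<and> gaussian_average ?lam S m \<and>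
        (AE \<omega> in N. \<forall>i. (\<lambda>t. W2 (symmetric_pawbar \<gamma>d \<nu> (\<lambda>t. f t \<omega>) t i) m) \<longlonglongrightarrow> 0)"
      using law(3,4)[of ?lam] optimally_coupled.symmetric_pawbar_limit[OF law(1) assms(3), of F q N f, unfolded law(2)]
        symmetric convex_vector_uniform barycenter_uniform by blast
  qed
qed

end
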